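(* Fix $p\in[1,\infty)$, $n\in\mathbb{N}$ and $\varepsilon\in(0,1)$. Suppose $S_1,\dots,S_n$ are real-valued polynomials on $\mathbb{R}^d$ all of whose coefficients have absolute value bounded by a constant $M>0$, and set $s:=\max_{j=1,\dots,n}\deg(S_j)$. Fix an integer $1\le n_0\le n$ and let $\nu_{\varepsilon,n}$ denote the signed measure on $\mathbb{R}^d$ with density $$\phi(y)\Big(1+\sum_{j=n_0}^n\varepsilon^jS_j(y)\Big).$$ If $\mu$ is a probability measure on $\mathbb{R}^d$ such that $$\int_{\mathbb{R}^d}(1+|y|)^p\,d|\mu-\nu_{\varepsilon,n}|(y)\le\delta,$$ then $$\mathcal{W}_p(\mu,\phi)\le C_{d,M,n,p,s}\Big(\varepsilon^{n_0}+\delta^{1/p}+\varepsilon^{\frac{n+1}{p}}\Big),$$ where $C_{d,M,n,p,s}$ is a constant depending only on $d,M,n,p,s$.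
   Context: $\phi(y)=(2\pi)^{-d/2}e^{-|y|^2/2}$ is the standard Gaussian density on $\mathbb{R}^d$, and $|\mu-\nu|$ denotes the total variation measure of the signed measure $\mu-\nu$ (with density $|f-g|$ if $\mu,\nu$ have densities $f,g$). $\mathcal{W}_p(\mu,\phi)$ denotes the $p$-th Wasserstein distance between $\mu$ and the standard Gaussian law $N(0,I_d)$, i.e. $\mathcal{W}_p(\mu,\phi)=\inf\{(\mathbb{E}[|X-Y|_\infty^p])^{1/p}\}$ over all pairs of random variables $(X,Y)$ with $X\sim\mu$, $Y\sim N(0,I_d)$, where $|x|_\infty=\max_i|x_i|$. *)

theory Defs
  imports "HOL-Probability.Probability" "HOL-Library.Poly_Mapping"
begin

(* \<open>\<Sum>i. f i\<close> is \<open>suminf\<close>, not \<open>Sum_any\<close> *)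
no_syntax
  "_Sum_any" :: "pttrn \<Rightarrow> 'a \<Rightarrow> 'a::comm_monoid_add"  (\<open>(\<open>indent=2 notation=\<open>binder \<Sum>\<close>\<close>\<Sum>_. _)\<close> [0, 10] 10)

section \<open>Polynomials on real space\<close>

text \<open>
  A real polynomial in variables indexed by \<open>'d\<close> is a finitely supported map from exponent
  vectors to coefficients.
\<close>

type_synonym 'd mvpoly = "('d \<Rightarrow>\<^sub>0 nat) \<Rightarrow>\<^sub>0 real"

definition mvpoly_eval :: "'d::finite mvpoly \<Rightarrow> real^'d \<Rightarrow> real" where
  "mvpoly_eval q y =
     (\<Sum>m\<in>Poly_Mapping.keys q. Poly_Mapping.lookup q m * (\<Prod>i\<in>UNIV. (y $ i) ^ Poly_Mapping.lookup m i))"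

text \<open>Total degree; the zero polynomial has degree \<open>0\<close>.\<close>

definition mvpoly_degree :: "'d::finite mvpoly \<Rightarrow> nat" where
  "mvpoly_degree q =
     Max (insert 0 ((\<lambda>m. \<Sum>i\<in>UNIV. Poly_Mapping.lookup m i) ` Poly_Mapping.keys q))"

section \<open>The Gaussian density and its perturbation\<close>

definition gauss_density :: "real^'d::finite \<Rightarrow> real" where
  "gauss_density y = (2 * pi) powr (- real CARD('d) / 2) * exp (- (norm y)\<^sup>2 / 2)"

definition gauss_measure :: "(real^'d::finite) measure" where
  "gauss_measure = density lborel (\<lambda>y. ennreal (gauss_density y))"

definition perturbed_density ::
    "real \<Rightarrow> nat \<Rightarrow> nat \<Rightarrow> (nat \<Rightarrow> 'd::finite mvpoly) \<Rightarrow> real^'d \<Rightarrow> real" where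
  "perturbed_density \<epsilon> n\<^sub>0 n S y =
     gauss_density y * (1 + (\<Sum>j=n\<^sub>0..n. \<epsilon> ^ j * mvpoly_eval (S j) y))"

section \<open>Signed measures and total variation\<close>

text \<open>
  A finite signed measure is represented by its real-valued set function on the measurable sets.
\<close>

definition signed_density :: "'a measure \<Rightarrow> ('a \<Rightarrow> real) \<Rightarrow> 'a set \<Rightarrow> real" where
  "signed_density M f A = (LINT y:A|M. f y)"

definition total_variation_on :: "'a measure \<Rightarrow> ('a set \<Rightarrow> real) \<Rightarrow> 'a set \<Rightarrow> ennreal" where
  "total_variation_on M \<sigma> A =
     (SUP P \<in> {P. finite P \<and> P \<subseteq> sets M \<and> partition_on A P}. \<Sum>B\<in>P. ennreal \<bar>\<sigma> B\<bar>)"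

text \<open>
  Only the measurable sets of \<open>M\<close> matter here, not its values.  The construction
  \<open>measure_of\<close> returns the zero measure on set functions that are not countably additive;
  \<open>emeasure_total_variation\<close> below shows that this does not happen if \<open>\<sigma>\<close> is countably additive.
\<close>

definition total_variation :: "'a measure \<Rightarrow> ('a set \<Rightarrow> real) \<Rightarrow> 'a measure" where
  "total_variation M \<sigma> = measure_of (space M) (sets M) (total_variation_on M \<sigma>)"

lemma total_variation_on_empty: "total_variation_on M \<sigma> {} = 0"
proof -
  have "{P. finite P \<and> P \<subseteq> sets M \<and> partition_on {} P} = {{}}"
    by (auto simp: partition_on_empty)
  then show ?thesis by (simp add: total_variation_on_def)
qed

lemma total_variation_on_upper:
  "finite P \<Longrightarrow> P \<subseteq> sets M \<Longrightarrow> partition_on A P \<Longrightarrow>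
    (\<Sum>B\<in>P. ennreal \<bar>\<sigma> B\<bar>) \<le> total_variation_on M \<sigma> A"
  unfolding total_variation_on_def by (rule SUP_upper) auto

lemma total_variation_on_superadditive:
  assumes "A \<in> sets M" "B \<in> sets M" "A \<inter> B = {}"
  shows "total_variation_on M \<sigma> A + total_variation_on M \<sigma> B \<le> total_variation_on M \<sigma> (A \<union> B)"
proof -
  let ?I = "\<lambda>A. {P. finite P \<and> P \<subseteq> sets M \<and> partition_on A P}"
  have ne: "?I A \<noteq> {}" if "A \<in> sets M" for A
  proof (cases "A = {}")
    case True then show ?thesis by (auto intro!: exI[of _ "{}"] simp: partition_on_empty)
  next
    case False then show ?thesis using that
      by (auto intro!: exI[of _ "{A}"] partition_on_space)
  qed
  have *: "(\<Sum>B\<in>P. ennreal \<bar>\<sigma> B\<bar>) + (\<Sum>B\<in>Q. ennreal \<bar>\<sigma> B\<bar>) \<le> total_variation_on M \<sigma> (A \<union> B)"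
    if P: "P \<in> ?I A" and Q: "Q \<in> ?I B" for P Q
  proof -
    have d: "P \<inter> Q = {}"
    proof (rule equals0I)
      fix X assume "X \<in> P \<inter> Q"
      then have "X \<subseteq> A \<inter> B" "X \<noteq> {}" using P Q unfolding partition_on_def by auto
      then show False using assms(3) by blast
    qed
    have "partition_on (A \<union> B) (P \<union> Q)"
      using P Q assms(3) unfolding partition_on_def by (auto intro!: disjoint_union)
    then have "(\<Sum>B\<in>P \<union> Q. ennreal \<bar>\<sigma> B\<bar>) \<le> total_variation_on M \<sigma> (A \<union> B)"
      using P Q by (intro total_variation_on_upper) auto
    then show ?thesis using P Q d by (simp add: sum.union_disjoint)
  qed
  have "(\<Sum>B\<in>P. ennreal \<bar>\<sigma> B\<bar>) + total_variation_on M \<sigma> B \<le> total_variation_on M \<sigma> (A \<union> B)"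
    if P: "P \<in> ?I A" for P
    unfolding total_variation_on_def[of M \<sigma> B]
    by (subst ennreal_SUP_add_right[OF ne[OF assms(2)]]) (intro SUP_least * P)
  then show ?thesis
    unfolding total_variation_on_def[of M \<sigma> A]
    by (subst ennreal_SUP_add_left[symmetric, OF ne[OF assms(1)]]) (intro SUP_least)
qed

lemma emeasure_total_variation:
  assumes \<sigma>: "\<And>F. range F \<subseteq> sets M \<Longrightarrow> disjoint_family F \<Longrightarrow> (\<lambda>i::nat. \<sigma> (F i)) sums \<sigma> (\<Union>i. F i)"
    and A: "A \<in> sets M"
  shows "emeasure (total_variation M \<sigma>) A = total_variation_on M \<sigma> A"
  unfolding total_variation_def
proof (rule emeasure_measure_of_sigma[OF sets.sigma_algebra_axioms _ _ A])
  let ?v = "total_variation_on M \<sigma>"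
  show "positive (sets M) ?v" by (simp add: positive_def total_variation_on_empty)
  have \<sigma>0: "\<sigma> {} = 0"
  proof -
    have "(\<lambda>i::nat. \<sigma> {}) sums \<sigma> {}" using \<sigma>[of "\<lambda>_. {}"] by (auto simp: disjoint_family_on_def)
    then have "(\<lambda>i::nat. \<sigma> {}) \<longlonglongrightarrow> 0" by (intro summable_LIMSEQ_zero sums_summable)
    then show ?thesis by (simp add: LIMSEQ_const_iff)
  qed
  have mono: "?v X \<le> ?v Y" if "X \<in> sets M" "Y \<in> sets M" "X \<subseteq> Y" for X Y
  proof -
    have "?v X \<le> ?v X + ?v (Y - X)" by simp
    also have "\<dots> \<le> ?v (X \<union> (Y - X))"
      by (rule total_variation_on_superadditive) (use that in auto)
    also have "X \<union> (Y - X) = Y" using that by auto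
    finally show ?thesis .
  qed
  show "countably_additive (sets M) ?v"
    unfolding countably_additive_def
  proof (intro allI impI antisym)
    fix F :: "nat \<Rightarrow> _"
    assume F: "range F \<subseteq> sets M" "disjoint_family F" and U: "\<Union> (range F) \<in> sets M"
    have Fi: "F i \<in> sets M" for i using F by auto
    have fin: "(\<Sum>i<n. ?v (F i)) \<le> ?v (\<Union>i<n. F i)" for n
    proof (induction n)
      case (Suc n)
      have "(\<Sum>i<Suc n. ?v (F i)) \<le> ?v (\<Union>i<n. F i) + ?v (F n)"
        using Suc by (simp add: add_right_mono)
      also have "\<dots> \<le> ?v ((\<Union>i<n. F i) \<union> F n)"
      proof (rule total_variation_on_superadditive)
        have "F i \<inter> F n = {}" if "i < n" for i
          using F(2) that by (auto simp: disjoint_family_on_def)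
        then show "(\<Union>i<n. F i) \<inter> F n = {}" by blast
      qed (use Fi in auto)
      also have "(\<Union>i<n. F i) \<union> F n = (\<Union>i<Suc n. F i)" by (auto simp: less_Suc_eq)
      finally show ?case .
    qed (simp add: total_variation_on_empty)
    show "(\<Sum>i. ?v (F i)) \<le> ?v (\<Union> (range F))"
    proof (rule suminf_le_const)
      fix n show "(\<Sum>i<n. ?v (F i)) \<le> ?v (\<Union> (range F))"
        by (rule order_trans[OF fin mono]) (use U Fi in auto)
    qed simp
    show "?v (\<Union> (range F)) \<le> (\<Sum>i. ?v (F i))"
      unfolding total_variation_on_def[of M \<sigma> "\<Union> (range F)"]
    proof (rule SUP_least)
      fix P assume "P \<in> {P. finite P \<and> P \<subseteq> sets M \<and> partition_on (\<Union> (range F)) P}"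
      then have P: "finite P" "P \<subseteq> sets M" "partition_on (\<Union> (range F)) P" by auto
      have 1: "ennreal \<bar>\<sigma> B\<bar> \<le> (\<Sum>i. ennreal \<bar>\<sigma> (F i \<inter> B)\<bar>)" if B: "B \<in> P" for B
      proof (cases "summable (\<lambda>i. \<bar>\<sigma> (F i \<inter> B)\<bar>)")
        case True
        have "(\<lambda>i. \<sigma> (F i \<inter> B)) sums \<sigma> (\<Union>i. F i \<inter> B)"
          by (rule \<sigma>) (use F P B Fi in \<open>auto simp: disjoint_family_on_def\<close>)
        moreover have "(\<Union>i. F i \<inter> B) = B" using P B by (auto simp: partition_on_def)
        ultimately have "\<sigma> B = (\<Sum>i. \<sigma> (F i \<inter> B))" by (simp add: sums_unique)
        also have "\<bar>\<dots>\<bar> \<le> (\<Sum>i. \<bar>\<sigma> (F i \<inter> B)\<bar>)" by (rule summable_rabs[OF True])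
        finally show ?thesis using True by (simp add: suminf_ennreal2 ennreal_leI)
      next
        case False
        have "(\<Sum>i. ennreal \<bar>\<sigma> (F i \<inter> B)\<bar>) = top"
          by (rule ccontr) (use False summable_suminf_not_top in \<open>force simp del: suminf_ennreal\<close>)
        then show ?thesis by simp
      qed
      have 2: "(\<Sum>B\<in>P. ennreal \<bar>\<sigma> (F i \<inter> B)\<bar>) \<le> ?v (F i)" for i
      proof -
        have "(\<Sum>B\<in>P. ennreal \<bar>\<sigma> (F i \<inter> B)\<bar>) = (\<Sum>C\<in>(\<inter>) (F i) ` P. ennreal \<bar>\<sigma> C\<bar>)"
        proof (subst sum.reindex_nontrivial[OF P(1)])
          fix B C assume BC: "B \<in> P" "C \<in> P" "B \<noteq> C" and eq: "F i \<inter> B = F i \<inter> C"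
          have "B \<inter> C = {}" using P(3) BC by (auto simp: partition_on_def disjoint_def)
          then have "F i \<inter> B = {}" using eq by blast
          then show "ennreal \<bar>\<sigma> (F i \<inter> B)\<bar> = 0" using \<sigma>0 by simp
        qed simp
        also have "\<dots> = (\<Sum>C\<in>(\<inter>) (F i) ` P - {{}}. ennreal \<bar>\<sigma> C\<bar>)"
          using P \<sigma>0 by (intro sum.mono_neutral_right) auto
        also have "\<dots> \<le> ?v (F i)"
        proof (rule total_variation_on_upper)
          have "F i \<inter> \<Union> (range F) = F i" by auto
          then show "partition_on (F i) ((\<inter>) (F i) ` P - {{}})"
            using partition_on_restrict[OF P(3), of "F i"] by simp
        qed (use P Fi in auto)
        finally show ?thesis .
      qed
      have "(\<Sum>B\<in>P. ennreal \<bar>\<sigma> B\<bar>) \<le> (\<Sum>B\<in>P. \<Sum>i. ennreal \<bar>\<sigma> (F i \<inter> B)\<bar>)"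
        using 1 by (rule sum_mono)
      also have "\<dots> = (\<Sum>i. \<Sum>B\<in>P. ennreal \<bar>\<sigma> (F i \<inter> B)\<bar>)"
        by (rule suminf_sum[symmetric]) simp
      also have "\<dots> \<le> (\<Sum>i. ?v (F i))"
        using 2 by (intro suminf_le) auto
      finally show "(\<Sum>B\<in>P. ennreal \<bar>\<sigma> B\<bar>) \<le> (\<Sum>i. ?v (F i))" .
    qed
  qed
qed

lemma total_variation_signed_density:
  assumes f: "integrable M f" and A: "A \<in> sets M"
  shows "emeasure (total_variation M (signed_density M f)) A = (\<integral>\<^sup>+y\<in>A. ennreal \<bar>f y\<bar> \<partial>M)"
proof -
  have si: "set_integrable M B f" if "B \<in> sets M" for B
    using f that unfolding set_integrable_def by (rule integrable_mult_indicator[rotated])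
  have ab: "ennreal \<bar>LINT y:B|M. f y\<bar> \<le> (\<integral>\<^sup>+y\<in>B. ennreal \<bar>f y\<bar> \<partial>M)" if "B \<in> sets M" for B
  proof -
    have "ennreal \<bar>LINT y:B|M. f y\<bar> \<le> (\<integral>\<^sup>+y. ennreal \<bar>indicator B y *\<^sub>R f y\<bar> \<partial>M)"
      using integral_norm_bound_ennreal[OF si[OF that, unfolded set_integrable_def]]
      by (simp add: set_lebesgue_integral_def)
    also have "\<dots> = (\<integral>\<^sup>+y\<in>B. ennreal \<bar>f y\<bar> \<partial>M)"
      by (intro nn_integral_cong) (auto simp: indicator_def)
    finally show ?thesis .
  qed
  have fm[measurable]: "f \<in> borel_measurable M" using f by auto
  have "emeasure (total_variation M (signed_density M f)) A = total_variation_on M (signed_density M f) A"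
  proof (rule emeasure_total_variation[OF _ A])
    fix F :: "nat \<Rightarrow> _" assume F: "range F \<subseteq> sets M" "disjoint_family F"
    have "summable (\<lambda>i. norm (LINT y:F i|M. f y))"
    proof (rule summable_suminf_not_top)
      have "(\<Sum>i. ennreal (norm (LINT y:F i|M. f y))) \<le> (\<Sum>i. \<integral>\<^sup>+y\<in>F i. ennreal \<bar>f y\<bar> \<partial>M)"
        using F ab by (intro suminf_le) auto
      also have "\<dots> = (\<Sum>i. emeasure (density M (\<lambda>y. ennreal \<bar>f y\<bar>)) (F i))"
        using F by (intro suminf_cong) (subst emeasure_density, auto)
      also have "\<dots> = emeasure (density M (\<lambda>y. ennreal \<bar>f y\<bar>)) (\<Union>i. F i)"
        using F by (intro suminf_emeasure) auto
      also have "\<dots> \<le> (\<integral>\<^sup>+y. ennreal \<bar>f y\<bar> \<partial>M)"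
        using F by (subst emeasure_density) (auto intro!: nn_integral_mono simp: indicator_def)
      also have "\<dots> < top" using f by (auto simp: integrable_iff_bounded)
      finally show "(\<Sum>i. ennreal (norm (LINT y:F i|M. f y))) \<noteq> top" by simp
    qed auto
    moreover have "(LINT y:(\<Union>i. F i)|M. f y) = (\<Sum>i. (LINT y:F i|M. f y))"
      using F by (intro lebesgue_integral_countable_add si) (auto simp: disjoint_family_on_def)
    ultimately show "(\<lambda>i. signed_density M f (F i)) sums signed_density M f (\<Union>i. F i)"
      by (auto simp: signed_density_def sums_iff dest: summable_rabs_cancel)
  qed
  also have "\<dots> = (\<integral>\<^sup>+y\<in>A. ennreal \<bar>f y\<bar> \<partial>M)"
  proof (rule antisym)
    show "total_variation_on M (signed_density M f) A \<le> (\<integral>\<^sup>+y\<in>A. ennreal \<bar>f y\<bar> \<partial>M)"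
      unfolding total_variation_on_def
    proof (rule SUP_least)
      fix P assume "P \<in> {P. finite P \<and> P \<subseteq> sets M \<and> partition_on A P}"
      then have P: "finite P" "P \<subseteq> sets M" "partition_on A P" by auto
      have "(\<Sum>B\<in>P. ennreal \<bar>signed_density M f B\<bar>) \<le> (\<Sum>B\<in>P. \<integral>\<^sup>+y\<in>B. ennreal \<bar>f y\<bar> \<partial>M)"
        unfolding signed_density_def using P ab by (intro sum_mono) auto
      also have "\<dots> = (\<Sum>B\<in>P. emeasure (density M (\<lambda>y. ennreal \<bar>f y\<bar>)) B)"
        using P by (intro sum.cong) (auto simp: emeasure_density)
      also have "\<dots> = emeasure (density M (\<lambda>y. ennreal \<bar>f y\<bar>)) (\<Union>B\<in>P. B)"
        using P by (intro sum_emeasure)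
          (auto simp: partition_on_def disjoint_family_on_def disjoint_def)
      also have "(\<Union>B\<in>P. B) = A" using P by (auto simp: partition_on_def)
      also have "emeasure (density M (\<lambda>y. ennreal \<bar>f y\<bar>)) A = (\<integral>\<^sup>+y\<in>A. ennreal \<bar>f y\<bar> \<partial>M)"
        using A by (simp add: emeasure_density)
      finally show "(\<Sum>B\<in>P. ennreal \<bar>signed_density M f B\<bar>) \<le> (\<integral>\<^sup>+y\<in>A. ennreal \<bar>f y\<bar> \<partial>M)" .
    qed
    define Ap where "Ap = A \<inter> {y \<in> space M. 0 \<le> f y}"
    define Am where "Am = A \<inter> {y \<in> space M. f y < 0}"
    have s[measurable]: "Ap \<in> sets M" "Am \<in> sets M" using A by (auto simp: Ap_def Am_def)
    have d: "Ap \<inter> Am = {}" and u: "Ap \<union> Am = A"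
      using sets.sets_into_space[OF A] by (auto simp: Ap_def Am_def)
    have one: "(\<integral>\<^sup>+y\<in>B. ennreal \<bar>f y\<bar> \<partial>M) \<le> total_variation_on M (signed_density M f) B"
      if B: "B \<in> sets M" and c: "c = 1 \<or> c = -1" and abs: "\<And>y. y \<in> B \<Longrightarrow> \<bar>f y\<bar> = c * f y" for B c
    proof (cases "B = {}")
      case False
      have "(\<integral>\<^sup>+y\<in>B. ennreal \<bar>f y\<bar> \<partial>M) = (\<integral>\<^sup>+y. ennreal (c * (indicator B y * f y)) \<partial>M)"
        using abs by (intro nn_integral_cong) (auto simp: indicator_def)
      also have "\<dots> = ennreal (\<integral>y. c * (indicator B y * f y) \<partial>M)"
      proof (rule nn_integral_eq_integral)
        show "integrable M (\<lambda>y. c * (indicator B y * f y))"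
          using si[OF B] by (simp add: set_integrable_def)
        have "0 \<le> c * (indicator B y * f y)" for y
          using abs[of y] abs_ge_zero[of "f y"] by (cases "y \<in> B") (simp_all del: abs_ge_zero)
        then show "AE y in M. 0 \<le> c * (indicator B y * f y)" by simp
      qed
      also have "\<dots> \<le> ennreal \<bar>signed_density M f B\<bar>"
        using c by (intro ennreal_leI) (auto simp: signed_density_def set_lebesgue_integral_def)
      also have "\<dots> \<le> total_variation_on M (signed_density M f) B"
        using total_variation_on_upper[of "{B}" M B "signed_density M f"] False B
        by (simp add: partition_on_space)
      finally show ?thesis .
    qed simp
    have "(\<integral>\<^sup>+y\<in>A. ennreal \<bar>f y\<bar> \<partial>M) = (\<integral>\<^sup>+y\<in>Ap. ennreal \<bar>f y\<bar> \<partial>M) + (\<integral>\<^sup>+y\<in>Am. ennreal \<bar>f y\<bar> \<partial>M)"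
      using d by (subst nn_integral_add[symmetric])
        (auto simp: u[symmetric] indicator_def intro!: nn_integral_cong)
    also have "\<dots> \<le> total_variation_on M (signed_density M f) Ap + total_variation_on M (signed_density M f) Am"
      by (intro add_mono one[of _ 1] one[of _ "-1"] s) (auto simp: Ap_def Am_def)
    also have "\<dots> \<le> total_variation_on M (signed_density M f) A"
      using total_variation_on_superadditive[OF s d] by (simp add: u)
    finally show "(\<integral>\<^sup>+y\<in>A. ennreal \<bar>f y\<bar> \<partial>M) \<le> total_variation_on M (signed_density M f) A" .
  qed
  finally show ?thesis .
qed

section \<open>Wasserstein distance\<close>

definition ennreal_root :: "real \<Rightarrow> ennreal \<Rightarrow> ennreal" where
  "ennreal_root p x = (if x = \<top> then \<top> else ennreal (enn2real x powr (1 / p)))"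

text \<open>
  The infimum ranges over random variables \<open>X\<close>, \<open>Y\<close> on probability spaces whose sample space is the
  type of pairs.  By \<open>wasserstein_le\<close> below, no sample space of any other type gives a smaller
  value.  \<open>infnorm\<close> is the maximum norm.
\<close>

definition wasserstein :: "real \<Rightarrow> (real^'d::finite) measure \<Rightarrow> (real^'d) measure \<Rightarrow> ennreal" where
  "wasserstein p \<mu> \<nu> =
     Inf {ennreal_root p (\<integral>\<^sup>+\<omega>. ennreal (infnorm (X \<omega> - Y \<omega>) powr p) \<partial>\<Omega>) |
       (\<Omega> :: ((real^'d) \<times> (real^'d)) measure) X Y.
         prob_space \<Omega> \<and> X \<in> borel_measurable \<Omega> \<and> Y \<in> borel_measurable \<Omega> \<and>
         distr \<Omega> borel X = \<mu> \<and> distr \<Omega> borel Y = \<nu>}"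

lemma wasserstein_le:
  fixes \<Omega> :: "'w measure" and X Y :: "'w \<Rightarrow> real^'d::finite"
  assumes "prob_space \<Omega>" and [measurable]: "X \<in> borel_measurable \<Omega>" "Y \<in> borel_measurable \<Omega>"
    and "distr \<Omega> borel X = \<mu>" "distr \<Omega> borel Y = \<nu>"
  shows "wasserstein p \<mu> \<nu> \<le> ennreal_root p (\<integral>\<^sup>+\<omega>. ennreal (infnorm (X \<omega> - Y \<omega>) powr p) \<partial>\<Omega>)"
proof -
  let ?Q = "distr \<Omega> (borel \<Otimes>\<^sub>M borel) (\<lambda>\<omega>. (X \<omega>, Y \<omega>))"
  have [measurable]: "(infnorm :: real^'d \<Rightarrow> real) \<in> borel_measurable borel"
    by (intro borel_measurable_continuous_onI continuous_at_imp_continuous_on)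
      (auto intro!: continuous_intros continuous_infnorm)
  have "prob_space ?Q" using assms(1) by (rule prob_space.prob_space_distr) simp
  moreover have "distr ?Q borel fst = \<mu>" "distr ?Q borel snd = \<nu>"
    using assms by (simp_all add: distr_distr o_def)
  moreover have "(\<integral>\<^sup>+\<omega>. ennreal (infnorm (fst \<omega> - snd \<omega>) powr p) \<partial>?Q) =
      (\<integral>\<^sup>+\<omega>. ennreal (infnorm (X \<omega> - Y \<omega>) powr p) \<partial>\<Omega>)"
    by (simp add: nn_integral_distr)
  ultimately show ?thesis
    unfolding wasserstein_def
    by (intro Inf_lower CollectI exI[of _ ?Q] exI[of _ fst] exI[of _ snd]) simp
qed

end

theory Submission
  imports Defs
begin

text \<open>
  Write \<open>\<gamma>\<close> for the Gaussian law and \<open>h\<close> for the polynomial perturbation, so that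
  \<open>\<bar>h y\<bar> \<le> K \<eta> (1 + norm y)^s\<close> with \<open>\<eta> = \<epsilon>^n\<^sub>0\<close>.  The density \<open>1 + h\<close> may be negative, but clipping \<open>h\<close> to
  \<open>[-1/2, 1/2]\<close> changes it by at most \<open>\<bar>h\<bar> (2\<bar>h\<bar>)^n\<close>, which costs only \<open>O(\<eta>^(n+1))\<close> in weighted
  total variation.  After normalisation this gives a probability measure \<open>\<nu> = (1 + h') \<gamma>\<close> with
  \<open>1/3 \<le> 1 + h' \<le> 3\<close> at weighted distance \<open>O(\<delta> + \<epsilon>^(n+1))\<close> from \<open>\<mu>\<close>, and a maximal coupling
  \<open>(X, Z)\<close> of \<open>\<mu>\<close> and \<open>\<nu>\<close> contributes the \<open>p\<close>-th root of that quantity.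

  The gain from \<open>\<eta>^(1/p)\<close> to \<open>\<eta>\<close> comes from a deterministic map \<open>T\<close> taking \<open>\<nu>\<close> to \<open>\<gamma>\<close>, which makes
  \<open>(X, T Z)\<close> a coupling of \<open>\<mu>\<close> and \<open>\<gamma>\<close> without any gluing of transport plans.  It is a
  Knothe--Rosenblatt map: one coordinate after the other is moved by the monotone rearrangement of
  its conditional law to the standard normal law, and each step replaces \<open>h'\<close> by its Gaussian
  average over that coordinate.  As the hazard rate of the normal law is bounded below, a
  perturbation of relative size \<open>\<eta> exp (a t\<^sup>2)\<close> moves the point \<open>t\<close> by only \<open>O(\<eta> exp (a t\<^sup>2))\<close>; the
  weights \<open>exp (a (norm y)\<^sup>2)\<close> with \<open>a p < 1/2\<close> absorb all polynomials, factor over the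
  coordinates and have finite \<open>p\<close>-th moment.
\<close>

section \<open>The Gaussian measure as a product\<close>

definition std_normal :: "real measure" where
  "std_normal = density lborel (\<lambda>x. ennreal (std_normal_density x))"

lemma sets_std_normal [measurable_cong, simp]: "sets std_normal = sets borel"
  and space_std_normal [simp]: "space std_normal = UNIV"
  by (simp_all add: std_normal_def)

lemma real_distribution_std_normal: "real_distribution std_normal"
  using prob_space_normal_density[of 1 0]
  by (auto simp: real_distribution_def real_distribution_axioms_def std_normal_def)

interpretation std_normal: real_distribution std_normal
  by (rule real_distribution_std_normal)

lemma nn_integral_std_normal:
  assumes [measurable]: "f \<in> borel_measurable borel"
  shows "(\<integral>\<^sup>+x. f x \<partial>std_normal) = (\<integral>\<^sup>+x. ennreal (std_normal_density x) * f x \<partial>lborel)"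
  by (simp add: std_normal_def nn_integral_density)

lemma borel_measurable_gauss_density [measurable]: "gauss_density \<in> borel_measurable borel"
  unfolding gauss_density_def by measurable

lemma sets_gauss_measure [measurable_cong, simp]: "sets gauss_measure = sets borel"
  and space_gauss_measure [simp]: "space gauss_measure = UNIV"
  by (simp_all add: gauss_measure_def)

lemma gauss_density_nonneg [simp]: "0 \<le> gauss_density y"
  by (simp add: gauss_density_def)

lemma norm_vec_power2: "(norm (y :: real^'d::finite))\<^sup>2 = (\<Sum>i\<in>UNIV. (y $ i)\<^sup>2)"
  unfolding norm_vec_def L2_set_def by (simp add: sum_nonneg)

lemma gauss_density_eq_prod:
  "gauss_density (y :: real^'d::finite) = (\<Prod>i\<in>UNIV. std_normal_density (y $ i))"
proof -
  have "(\<Prod>i\<in>(UNIV::'d set). 1 / sqrt (2 * pi)) = (2 * pi) powr (- real CARD('d) / 2)"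
  proof -
    have "1 / sqrt (2 * pi) = (2 * pi) powr (-1/2)"
      by (simp add: powr_half_sqrt[symmetric] powr_minus_divide)
    then have "(\<Prod>i\<in>(UNIV::'d set). 1 / sqrt (2 * pi)) = ((2 * pi) powr (-1/2)) ^ CARD('d)"
      by simp
    also have "\<dots> = (2 * pi) powr (- real CARD('d) / 2)"
      by (subst powr_realpow[symmetric]) (simp_all add: powr_powr)
    finally show ?thesis .
  qed
  moreover have "(\<Prod>i\<in>UNIV. exp (- (y $ i)\<^sup>2 / 2)) = exp (- (norm y)\<^sup>2 / 2)"
    by (simp add: exp_sum[symmetric] norm_vec_power2 sum_negf sum_divide_distrib)
  ultimately show ?thesis
    unfolding gauss_density_def std_normal_density_def by (simp only: prod.distrib)
qed

lemma prod_Basis_vec: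
  fixes f :: "real^'d::finite \<Rightarrow> 'c::comm_monoid_mult"
  shows "prod f Basis = (\<Prod>i\<in>UNIV. f (axis i 1))"
proof -
  have "(Basis :: (real^'d) set) = (\<lambda>i. axis i 1) ` UNIV"
    by (auto simp: Basis_vec_def)
  moreover have "inj (\<lambda>i. axis i 1 :: real^'d)" by (auto simp: inj_on_def axis_eq_axis)
  ultimately show ?thesis using prod.reindex[of "\<lambda>i. axis i 1 :: real^'d" UNIV f] by (simp add: o_def)
qed

text \<open>Lebesgue measure is a product over \<open>Basis\<close>, and the Gaussian density
  factors over the same coordinates.\<close>

lemma nn_integral_gauss_prod:
  fixes f :: "'d::finite \<Rightarrow> real \<Rightarrow> ennreal"
  assumes [measurable]: "\<And>i. f i \<in> borel_measurable borel"
  shows "(\<integral>\<^sup>+y. (\<Prod>i\<in>UNIV. f i (y $ i)) \<partial>(gauss_measure :: (real^'d) measure)) =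
    (\<Prod>i\<in>UNIV. \<integral>\<^sup>+x. f i x \<partial>std_normal)"
proof -
  let ?g = "\<lambda>(b::real^'d) x. ennreal (std_normal_density x) * f (axis_index b) x"
  have "(\<integral>\<^sup>+y. (\<Prod>i\<in>UNIV. f i (y $ i)) \<partial>(gauss_measure :: (real^'d) measure)) =
      (\<integral>\<^sup>+y. ennreal (gauss_density y) * (\<Prod>i\<in>UNIV. f i (y $ i)) \<partial>lborel)"
    unfolding gauss_measure_def by (subst nn_integral_density) auto
  also have "\<dots> = (\<integral>\<^sup>+y. (\<Prod>b\<in>Basis. ?g b (y \<bullet> b)) \<partial>lborel)"
    by (intro nn_integral_cong)
      (simp add: gauss_density_eq_prod prod_ennreal[symmetric] prod.distrib prod_Basis_vec
        cart_eq_inner_axis[symmetric])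
  also have "\<dots> = (\<Prod>b\<in>Basis. \<integral>\<^sup>+x. ?g b x \<partial>lborel)"
    by (intro nn_integral_lborel_prod) auto
  also have "\<dots> = (\<Prod>i\<in>UNIV. \<integral>\<^sup>+x. f i x \<partial>std_normal)"
    by (simp add: prod_Basis_vec nn_integral_std_normal)
  finally show ?thesis .
qed

lemma emeasure_gauss_prod:
  fixes A :: "'d::finite \<Rightarrow> real set"
  assumes [measurable]: "\<And>i. A i \<in> sets borel"
  shows "emeasure gauss_measure {y :: real^'d. \<forall>i. y $ i \<in> A i} =
    (\<Prod>i\<in>UNIV. emeasure std_normal (A i))"
proof -
  have *: "{y :: real^'d. \<forall>i. y $ i \<in> A i} \<in> sets borel"
    by measurable
  have "emeasure gauss_measure {y :: real^'d. \<forall>i. y $ i \<in> A i} =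
      (\<integral>\<^sup>+y. indicator {y :: real^'d. \<forall>i. y $ i \<in> A i} y \<partial>gauss_measure)"
    using * by (subst nn_integral_indicator) auto
  also have "\<dots> = (\<integral>\<^sup>+(y::real^'d). (\<Prod>i\<in>UNIV. indicator (A i) (y $ i)) \<partial>gauss_measure)"
    by (intro nn_integral_cong) (auto simp: indicator_def prod_zero_iff)
  also have "\<dots> = (\<Prod>i\<in>UNIV. emeasure std_normal (A i))"
    by (subst nn_integral_gauss_prod) auto
  finally show ?thesis .
qed

lemma prob_space_gauss_measure: "prob_space (gauss_measure :: (real^'d::finite) measure)"
proof
  show "emeasure gauss_measure (space gauss_measure :: (real^'d) set) = 1"
    using emeasure_gauss_prod[of "\<lambda>_::'d. UNIV"] std_normal.emeasure_space_1 by simp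
qed

interpretation gauss: prob_space "gauss_measure :: (real^'d::finite) measure"
  by (rule prob_space_gauss_measure)

section \<open>Uniqueness of the Gaussian law from its values on boxes\<close>

lemma borel_measurable_vecI:
  fixes f :: "'a \<Rightarrow> real^'d::finite"
  assumes "\<And>i. (\<lambda>x. f x $ i) \<in> borel_measurable M"
  shows "f \<in> borel_measurable M"
proof (subst borel_measurable_euclidean_space, rule ballI)
  fix b :: "real^'d" assume "b \<in> Basis"
  then obtain i where "b = axis i 1" using axis_inverse by blast
  then show "(\<lambda>x. f x \<bullet> b) \<in> borel_measurable M"
    using assms[of i] by (simp add: cart_eq_inner_axis[symmetric])
qed

text \<open>Along \<open>vec_nth\<close> both laws become the product measure \<open>PiM\<close>,
  which boxes determine; \<open>vec_lambda\<close> is a measurable inverse and carries the equality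
  back.\<close>

lemma gauss_measure_unique:
  fixes N :: "(real^'d::finite) measure"
  assumes sets[measurable_cong, simp]: "sets N = sets borel"
    and eq: "\<And>A. (\<And>i. A i \<in> sets borel) \<Longrightarrow>
      emeasure N {y. \<forall>i. y $ i \<in> A i} = (\<Prod>i\<in>UNIV. emeasure std_normal (A i))"
  shows "N = gauss_measure"
proof -
  let ?P = "PiM (UNIV::'d set) (\<lambda>_. std_normal)"
  interpret product_sigma_finite "\<lambda>_::'d. std_normal"
    by standard
  have [simp]: "space N = UNIV" using sets_eq_imp_space_eq[OF sets] by simp
  have m: "vec_nth \<in> measurable N ?P" if "sets N = sets borel" for N :: "(real^'d) measure"
  proof (rule measurable_PiM_single')
    fix i :: 'd
    show "(\<lambda>x. x $ i) \<in> measurable N std_normal"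
      using that by (subst measurable_cong_sets[OF that sets_std_normal]) auto
  qed auto
  have d: "distr N ?P vec_nth = ?P" if s: "sets N = sets borel" and
    "\<And>A. (\<And>i. A i \<in> sets borel) \<Longrightarrow>
      emeasure N {y. \<forall>i. y $ i \<in> A i} = (\<Prod>i\<in>UNIV. emeasure std_normal (A i))"
    for N :: "(real^'d) measure"
  proof (rule PiM_eqI)
    fix A :: "'d \<Rightarrow> real set" assume A: "\<And>i. i \<in> UNIV \<Longrightarrow> A i \<in> sets std_normal"
    have "emeasure (distr N ?P vec_nth) (Pi\<^sub>E UNIV A) = emeasure N {y. \<forall>i. y $ i \<in> A i}"
      using A sets_eq_imp_space_eq[OF s] m[OF s]
      by (subst emeasure_distr) (auto intro!: sets_PiM_I_finite arg_cong2[where f=emeasure])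
    then show "emeasure (distr N ?P vec_nth) (Pi\<^sub>E UNIV A) = (\<Prod>i\<in>UNIV. emeasure std_normal (A i))"
      using that(2)[of A] A by simp
  qed auto
  have v: "vec_lambda \<in> measurable ?P (borel :: (real^'d) measure)"
  proof (rule borel_measurable_vecI)
    fix i :: 'd
    have "(\<lambda>f. f i) \<in> measurable ?P std_normal" by measurable
    then show "(\<lambda>f. vec_lambda f $ i) \<in> borel_measurable ?P"
      by (simp cong: measurable_cong_sets)
  qed
  have b: "distr (distr N ?P vec_nth) borel vec_lambda = N" if "sets N = sets borel"
    for N :: "(real^'d) measure"
    using v m[OF that] by (subst distr_distr) (simp_all add: o_def distr_id2[OF that[symmetric]] that)
  show ?thesis
    using b[OF sets] b[OF sets_gauss_measure] d[OF sets eq] d[OF sets_gauss_measure emeasure_gauss_prod]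
    by metis
qed

section \<open>Resampling a single coordinate\<close>

definition upd :: "'d::finite \<Rightarrow> real \<Rightarrow> real^'d \<Rightarrow> real^'d" where
  "upd i t y = (\<chi> j. if j = i then t else y $ j)"

lemma upd_nth [simp]: "upd i t y $ j = (if j = i then t else y $ j)"
  by (simp add: upd_def)

lemma upd_upd [simp]: "upd i t (upd i u y) = upd i t y"
  by (simp add: vec_eq_iff)

lemma borel_measurable_vec_nth_compose [measurable (raw)]:
  fixes f :: "'a \<Rightarrow> real^'d::finite"
  assumes "f \<in> borel_measurable M"
  shows "(\<lambda>x. f x $ i) \<in> borel_measurable M"
  using measurable_compose[OF assms, of "\<lambda>y. y $ i" borel] by simp

lemma measurable_upd [measurable (raw)]:
  assumes [measurable]: "f \<in> borel_measurable M" "g \<in> borel_measurable M"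
  shows "(\<lambda>x. upd i (f x) (g x)) \<in> borel_measurable M"
proof (rule borel_measurable_vecI)
  fix j show "(\<lambda>x. upd i (f x) (g x) $ j) \<in> borel_measurable M"
    by (cases "j = i") simp_all
qed

text \<open>Overwriting coordinate \<open>i\<close> by an independent normal sample preserves every
  box probability, because the factor for \<open>i\<close> is merely supplied by \<open>t\<close>
  instead of \<open>y\<close>. This is the disintegration along coordinate \<open>i\<close> on which
  the coordinatewise transport rests.\<close>

lemma distr_upd_gauss:
  "distr (gauss_measure \<Otimes>\<^sub>M std_normal) borel (\<lambda>(y, t). upd i t y) = (gauss_measure :: (real^'d::finite) measure)"
proof (rule gauss_measure_unique)
  fix A :: "'d \<Rightarrow> real set" assume A[measurable]: "\<And>i. A i \<in> sets borel"
  \<comment> \<open>The old value of coordinate \<open>i\<close> is discarded, so \<open>A'\<close>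
    leaves it unconstrained and has a factor 1 there.\<close>
  define A' where "A' j = (if j = i then UNIV else A j)" for j
  have A'[measurable]: "A' j \<in> sets borel" for j by (simp add: A'_def)
  have s: "{y :: real^'d. \<forall>j. y $ j \<in> A' j} \<in> sets borel" by measurable
  have "emeasure (distr (gauss_measure \<Otimes>\<^sub>M std_normal) borel (\<lambda>(y, t). upd i t y)) {y. \<forall>j. y $ j \<in> A j} =
    emeasure (gauss_measure \<Otimes>\<^sub>M std_normal) ((\<lambda>(y, t). upd i t y) -` {y. \<forall>j. y $ j \<in> A j})"
    by (subst emeasure_distr) (simp_all add: space_pair_measure)
  also have "(\<lambda>(y, t). upd i t y) -` {y. \<forall>j. y $ j \<in> A j} = {y. \<forall>j. y $ j \<in> A' j} \<times> A i"
    by (auto simp: A'_def split: if_splits)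
  also have "emeasure (gauss_measure \<Otimes>\<^sub>M std_normal) \<dots> =
      (\<Prod>j\<in>UNIV. emeasure std_normal (A' j)) * emeasure std_normal (A i)"
    using s by (subst std_normal.emeasure_pair_measure_Times) (simp_all add: emeasure_gauss_prod)
  also have "(\<Prod>j\<in>UNIV. emeasure std_normal (A' j)) = (\<Prod>j\<in>UNIV - {i}. emeasure std_normal (A j))"
    using std_normal.emeasure_space_1
    by (subst prod.remove[where x=i]) (auto simp: A'_def intro!: prod.cong)
  also have "\<dots> * emeasure std_normal (A i) = (\<Prod>j\<in>UNIV. emeasure std_normal (A j))"
    by (subst (2) prod.remove[where x=i]) (simp_all add: mult.commute)
  finally show "emeasure (distr (gauss_measure \<Otimes>\<^sub>M std_normal) borel (\<lambda>(y, t). upd i t y)) {y. \<forall>j. y $ j \<in> A j} =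
    (\<Prod>j\<in>UNIV. emeasure std_normal (A j))" .
qed simp

text \<open>Fubini for the law above: an identity between Gaussian integrals may be proved on each
  line parallel to the \<open>i\<close>-th axis.\<close>

lemma nn_integral_gauss_resample:
  fixes F :: "real^'d::finite \<Rightarrow> ennreal"
  assumes [measurable]: "F \<in> borel_measurable borel"
  shows "(\<integral>\<^sup>+y. F y \<partial>gauss_measure) = (\<integral>\<^sup>+y. \<integral>\<^sup>+t. F (upd i t y) \<partial>std_normal \<partial>gauss_measure)"
proof -
  have "(\<integral>\<^sup>+y. F y \<partial>gauss_measure) =
      (\<integral>\<^sup>+y. F y \<partial>distr (gauss_measure \<Otimes>\<^sub>M std_normal) borel (\<lambda>(y, t). upd i t y))"
    by (simp add: distr_upd_gauss)
  also have "\<dots> = (\<integral>\<^sup>+z. F (case z of (y, t) \<Rightarrow> upd i t y) \<partial>(gauss_measure \<Otimes>\<^sub>M std_normal))"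
    by (subst nn_integral_distr) auto
  also have "\<dots> = (\<integral>\<^sup>+y. \<integral>\<^sup>+t. F (upd i t y) \<partial>std_normal \<partial>gauss_measure)"
    by (subst std_normal.nn_integral_fst[symmetric]) auto
  finally show ?thesis .
qed

text \<open>The product of weight and density is a multiple of the normal density with variance
  \<open>1 / (1 - 2 * a)\<close>, which is positive as \<open>a < 1 / 2\<close>.\<close>

lemma nn_integral_std_normal_exp_finite:
  assumes "a < 1 / 2"
  shows "(\<integral>\<^sup>+x. ennreal (exp (a * x\<^sup>2)) \<partial>std_normal) < \<infinity>"
proof -
  define s where "s = 1 / sqrt (1 - 2 * a)"
  have s: "s > 0" "s\<^sup>2 = 1 / (1 - 2 * a)" using assms by (simp_all add: s_def power_divide)
  have "std_normal_density x * exp (a * x\<^sup>2) = s * normal_density 0 s x" for x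
  proof -
    have "- x\<^sup>2 / 2 + a * x\<^sup>2 = - x\<^sup>2 / (2 * s\<^sup>2)"
      using assms by (simp add: s(2) field_simps)
    then have "exp (- x\<^sup>2 / 2) * exp (a * x\<^sup>2) = exp (- x\<^sup>2 / (2 * s\<^sup>2))"
      by (simp add: exp_add[symmetric])
    moreover have "s * (1 / sqrt (2 * pi * s\<^sup>2)) = 1 / sqrt (2 * pi)"
      using s(1) by (simp add: real_sqrt_mult)
    ultimately have "1 / sqrt (2 * pi) * (exp (- x\<^sup>2 / 2) * exp (a * x\<^sup>2)) =
        s * (1 / sqrt (2 * pi * s\<^sup>2)) * exp (- x\<^sup>2 / (2 * s\<^sup>2))"
      by (simp only:)
    then show ?thesis by (simp add: normal_density_def)
  qed
  then have "(\<integral>\<^sup>+x. ennreal (exp (a * x\<^sup>2)) \<partial>std_normal) = (\<integral>\<^sup>+x. ennreal (s * normal_density 0 s x) \<partial>lborel)"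
    by (simp add: nn_integral_std_normal ennreal_mult[symmetric])
  also have "\<dots> = ennreal s"
    using s(1) by (subst nn_integral_eq_integral) auto
  finally show ?thesis by simp
qed

lemma nn_integral_gauss_exp_finite:
  assumes "a < 1 / 2"
  shows "(\<integral>\<^sup>+y. ennreal (exp (a * (norm y)\<^sup>2)) \<partial>(gauss_measure :: (real^'d::finite) measure)) < \<infinity>"
proof -
  have "(\<integral>\<^sup>+y. ennreal (exp (a * (norm y)\<^sup>2)) \<partial>(gauss_measure :: (real^'d::finite) measure)) =
      (\<integral>\<^sup>+y. (\<Prod>i\<in>UNIV. ennreal (exp (a * (y $ i)\<^sup>2))) \<partial>(gauss_measure :: (real^'d::finite) measure))"
    by (simp add: prod_ennreal exp_sum[symmetric] norm_vec_power2 sum_distrib_left)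
  also have "\<dots> = (\<Prod>i\<in>(UNIV::'d set). \<integral>\<^sup>+x. ennreal (exp (a * x\<^sup>2)) \<partial>std_normal)"
    by (rule nn_integral_gauss_prod) simp
  also have "\<dots> < \<infinity>"
    using nn_integral_std_normal_exp_finite[OF assms] by (simp add: power_less_top_ennreal)
  finally show ?thesis .
qed

section \<open>Monotone rearrangement in one dimension\<close>

lemma emeasure_std_normal:
  assumes [measurable]: "A \<in> sets borel"
  shows "emeasure std_normal A = (\<integral>\<^sup>+x. ennreal (std_normal_density x) * indicator A x \<partial>lborel)"
  by (simp add: std_normal_def emeasure_density)

lemma measure_std_normal_Ioc_ge:
  assumes "a \<le> b" "0 \<le> d" "\<And>u. a < u \<Longrightarrow> u \<le> b \<Longrightarrow> d \<le> std_normal_density u"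
  shows "d * (b - a) \<le> measure std_normal {a<..b}"
proof -
  have "ennreal (d * (b - a)) = (\<integral>\<^sup>+x. ennreal d * indicator {a<..b} x \<partial>lborel)"
    using assms by (subst nn_integral_cmult_indicator) (auto simp: ennreal_mult)
  also have "\<dots> \<le> emeasure std_normal {a<..b}"
    using assms(3) by (subst emeasure_std_normal) (auto intro!: nn_integral_mono simp: indicator_def ennreal_leI)
  finally show ?thesis
    by (simp add: std_normal.emeasure_eq_measure)
qed

lemma measure_std_normal_Ioc_pos:
  assumes "a < b"
  shows "0 < measure std_normal {a<..b}"
proof -
  \<comment> \<open>The modulus of every point of the interval is at most \<open>m\<close>, so the
    density at \<open>m\<close> is a lower bound there.\<close>
  define m where "m = max \<bar>a\<bar> \<bar>b\<bar>"
  have "std_normal_density m \<le> std_normal_density u" if "a < u" "u \<le> b" for u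
  proof -
    have "\<bar>u\<bar> \<le> \<bar>m\<bar>" using that by (auto simp: m_def)
    then have "u\<^sup>2 \<le> m\<^sup>2" by (simp add: abs_le_square_iff)
    then show ?thesis by (simp add: std_normal_density_def divide_right_mono)
  qed
  then have "std_normal_density m * (b - a) \<le> measure std_normal {a<..b}"
    using assms by (intro measure_std_normal_Ioc_ge) auto
  moreover have "0 < std_normal_density m * (b - a)"
    using assms by (simp add: normal_density_pos)
  ultimately show ?thesis by linarith
qed

lemma measure_std_normal_Ioi_pos: "0 < measure std_normal {a<..}"
  and measure_std_normal_Iic_pos: "0 < measure std_normal {..a}"
proof -
  have "measure std_normal {a<..a+1} \<le> measure std_normal {a<..}"
    "measure std_normal {a-1<..a} \<le> measure std_normal {..a}"
    by (auto intro!: std_normal.finite_measure_mono)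
  then show "0 < measure std_normal {a<..}" "0 < measure std_normal {..a}"
    using measure_std_normal_Ioc_pos[of a "a+1"] measure_std_normal_Ioc_pos[of "a-1" a] by linarith+
qed

lemma measure_std_normal_Ioi: "measure std_normal {a<..} = 1 - measure std_normal {..a}"
proof -
  have "{a<..} = space std_normal - {..a}" by auto
  then show ?thesis by (simp only:) (subst std_normal.prob_compl, auto)
qed

lemma nn_integral_std_normal_uminus:
  assumes [measurable]: "f \<in> borel_measurable borel"
  shows "(\<integral>\<^sup>+x. f (- x) \<partial>std_normal) = (\<integral>\<^sup>+x. f x \<partial>std_normal)"
  using nn_integral_real_affine[of "\<lambda>x. ennreal (std_normal_density x) * f x" "-1" 0]
  by (simp add: nn_integral_std_normal std_normal_density_def)

lemma measure_std_normal_singleton [simp]: "measure std_normal {x} = 0"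
  by (simp add: measure_def emeasure_std_normal nn_integral_indicator_singleton)

text \<open>Symmetry of the normal law; the end point left over by the reflection is a null set.
  Lower tails are thereby reduced to upper ones.\<close>

lemma measure_std_normal_uminus_Ioi: "measure std_normal {- a<..} = measure std_normal {..a}"
proof -
  have "emeasure std_normal {- a<..} = (\<integral>\<^sup>+x. indicator {- a<..} x \<partial>std_normal)" by simp
  also have "\<dots> = (\<integral>\<^sup>+x. indicator {- a<..} (- x) \<partial>std_normal)"
    by (rule nn_integral_std_normal_uminus[symmetric]) simp
  also have "\<dots> = (\<integral>\<^sup>+x. indicator {..<a} x \<partial>std_normal)"
    by (intro nn_integral_cong) (auto simp: indicator_def)
  also have "\<dots> = emeasure std_normal {..<a}" by simp
  finally have "measure std_normal {- a<..} = measure std_normal {..<a}"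
    by (simp add: measure_def)
  also have "\<dots> = measure std_normal ({..<a} \<union> {a})"
    by (subst std_normal.finite_measure_Union) auto
  also have "{..<a} \<union> {a} = {..a}" by auto
  finally show ?thesis .
qed

text \<open>As \<open>(u + v)^2 >= u^2 + v^2\<close> for \<open>u, v >= 0\<close>, the density at
  \<open>u + v\<close> is at most \<open>sqrt (2 * pi)\<close> times the product of the densities at
  \<open>u\<close> and \<open>v\<close>, and integrating over \<open>v\<close> leaves a factor at
  most 1. For \<open>u >= 0\<close> the hazard rate is thus at least
  \<open>1 / sqrt (2 * pi)\<close>.\<close>

lemma std_normal_tail_le:
  assumes "0 \<le> u"
  shows "measure std_normal {u<..} \<le> sqrt (2 * pi) * std_normal_density u"
proof -
  have "emeasure std_normal {u<..} =
      (\<integral>\<^sup>+v. ennreal (std_normal_density (u + v)) * indicator {u<..} (u + v) \<partial>lborel)"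
    using nn_integral_real_affine[of "\<lambda>x. ennreal (std_normal_density x) * indicator {u<..} x" 1 u]
    by (simp add: emeasure_std_normal)
  also have "\<dots> \<le> (\<integral>\<^sup>+v. ennreal (sqrt (2 * pi) * std_normal_density u) * ennreal (std_normal_density v) \<partial>lborel)"
  proof (intro nn_integral_mono)
    fix v
    show "ennreal (std_normal_density (u + v)) * indicator {u<..} (u + v) \<le>
      ennreal (sqrt (2 * pi) * std_normal_density u) * ennreal (std_normal_density v)"
    proof (cases "0 < v")
      case True
      have "u\<^sup>2 / 2 + v\<^sup>2 / 2 \<le> (u + v)\<^sup>2 / 2"
        using assms True by (simp add: power2_eq_square field_simps)
      then have "exp (- (u + v)\<^sup>2 / 2) \<le> exp (- u\<^sup>2 / 2) * exp (- v\<^sup>2 / 2)"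
        by (simp add: exp_add[symmetric])
      then have "std_normal_density (u + v) \<le> sqrt (2 * pi) * std_normal_density u * std_normal_density v"
        by (simp add: std_normal_density_def divide_right_mono)
      then show ?thesis
        using True by (simp add: ennreal_mult[symmetric] ennreal_leI)
    qed (simp add: indicator_def)
  qed
  also have "\<dots> = ennreal (sqrt (2 * pi) * std_normal_density u) * emeasure std_normal UNIV"
    by (subst nn_integral_cmult) (auto simp: emeasure_std_normal)
  finally show ?thesis
    using std_normal.emeasure_space_1 by (simp add: std_normal.emeasure_eq_measure)
qed

text \<open>Substituting \<open>u = t + (v - t) / (1 - 2 * a)\<close> turns the weighted tail into the plain one.\<close>

lemma std_normal_weighted_tail_le:
  assumes a: "0 \<le> a" "a < 1 / 2" and t: "0 \<le> t"
  shows "(\<integral>\<^sup>+u. ennreal (exp (a * u\<^sup>2)) * indicator {t<..} u \<partial>std_normal) \<le>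
    ennreal (1 / (1 - 2 * a) * exp (a * t\<^sup>2) * measure std_normal {t<..})"
proof -
  define k where "k = 1 / (1 - 2 * a)"
  have k: "1 \<le> k" "(1 - 2 * a) * k = 1" using a by (simp_all add: k_def)
  let ?f = "\<lambda>u. ennreal (std_normal_density u) * (ennreal (exp (a * u\<^sup>2)) * indicator {t<..} u)"
  have le: "?f (t - k * t + k * v) \<le> ennreal (exp (a * t\<^sup>2)) * (ennreal (std_normal_density v) * indicator {t<..} v)" for v
  proof (cases "t < v")
    case True
    define z where "z = v - t"
    have z: "0 < z" "v = t + z" "t - k * t + k * v = t + k * z"
      using True by (simp_all add: z_def algebra_simps)
    \<comment> \<open>Since \<open>(1 - 2 * a) * k = 1\<close>, the cross term becomes exactly
      \<open>2 * t * z\<close>, and \<open>k >= 1\<close> lets the coefficient of \<open>z^2\<close>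
      drop to 1. What remains is \<open>(t + z)^2 - 2 * a * t^2\<close>: the exponent of the plain
      density at \<open>v\<close>, with the weight at \<open>t\<close> split off.\<close>
    have "(1 - 2 * a) * (t + k * z)\<^sup>2 =
        (1 - 2 * a) * t\<^sup>2 + 2 * t * z * ((1 - 2 * a) * k) + k * z\<^sup>2 * ((1 - 2 * a) * k)"
      by (simp add: power2_eq_square algebra_simps)
    also have "\<dots> = (1 - 2 * a) * t\<^sup>2 + 2 * t * z + k * z\<^sup>2" by (simp add: k(2))
    also have "\<dots> \<ge> (1 - 2 * a) * t\<^sup>2 + 2 * t * z + 1 * z\<^sup>2"
      using k(1) by (intro add_left_mono mult_right_mono) auto
    finally have Q: "(1 - 2 * a) * t\<^sup>2 + 2 * t * z + z\<^sup>2 \<le> (1 - 2 * a) * (t + k * z)\<^sup>2" by simp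
    \<comment> \<open>\<open>Q\<close> stands for the square of \<open>t + k * z\<close>, which has
      to stay unexpanded while \<open>(t + z)^2\<close> is multiplied out.\<close>
    have "- Q / 2 + a * Q \<le> a * t\<^sup>2 + - (t + z)\<^sup>2 / 2"
      if "(1 - 2 * a) * t\<^sup>2 + 2 * t * z + z\<^sup>2 \<le> (1 - 2 * a) * Q" for Q
      using that unfolding power2_sum by (simp add: field_simps)
    from this[OF Q]
    have "- (t + k * z)\<^sup>2 / 2 + a * (t + k * z)\<^sup>2 \<le> a * t\<^sup>2 + - (t + z)\<^sup>2 / 2" .
    then have "exp (- (t + k * z)\<^sup>2 / 2) * exp (a * (t + k * z)\<^sup>2) \<le> exp (a * t\<^sup>2) * exp (- (t + z)\<^sup>2 / 2)"
      by (simp only: exp_add[symmetric] exp_le_cancel_iff)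
    then have "std_normal_density (t + k * z) * exp (a * (t + k * z)\<^sup>2) \<le> exp (a * t\<^sup>2) * std_normal_density (t + z)"
      by (simp add: std_normal_density_def divide_right_mono)
    then show ?thesis
      unfolding z(3) using z(1,2) True by (simp add: ennreal_mult[symmetric] ennreal_leI indicator_def)
  next
    case False
    then have "k * v \<le> k * t" using k(1) by (intro mult_left_mono) auto
    then show ?thesis by (simp add: indicator_def)
  qed
  have "(\<integral>\<^sup>+u. ennreal (exp (a * u\<^sup>2)) * indicator {t<..} u \<partial>std_normal) = (\<integral>\<^sup>+u. ?f u \<partial>lborel)"
    by (simp add: nn_integral_std_normal)
  also have "\<dots> = ennreal k * (\<integral>\<^sup>+v. ?f (t - k * t + k * v) \<partial>lborel)"
    using k(1) by (subst nn_integral_real_affine[where c=k and t="t - k * t"]) auto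
  also have "\<dots> \<le> ennreal k * (\<integral>\<^sup>+v. ennreal (exp (a * t\<^sup>2)) * (ennreal (std_normal_density v) * indicator {t<..} v) \<partial>lborel)"
    using le by (intro mult_left_mono nn_integral_mono) auto
  also have "\<dots> = ennreal k * (ennreal (exp (a * t\<^sup>2)) * emeasure std_normal {t<..})"
    by (subst nn_integral_cmult) (auto simp: emeasure_std_normal)
  also have "\<dots> = ennreal (k * exp (a * t\<^sup>2) * measure std_normal {t<..})"
    using k(1) by (simp add: std_normal.emeasure_eq_measure ennreal_mult[symmetric] mult.assoc)
  finally show ?thesis by (simp add: k_def)
qed

text \<open>The hazard rate of the normal law is bounded below on half lines bounded from below.\<close>

lemma std_normal_quantile_displacement:
  assumes c: "0 < c" and q: "0 < q"
  shows "\<exists>D>0. \<forall>t \<tau> r. 0 \<le> t \<longrightarrow> c * measure std_normal {t<..} \<le> measure std_normal {\<tau><..} \<longrightarrow>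
    q \<le> measure std_normal {..\<tau>} \<longrightarrow>
    \<bar>measure std_normal {\<tau><..} - measure std_normal {t<..}\<bar> \<le> r * measure std_normal {t<..} \<longrightarrow>
    \<bar>\<tau> - t\<bar> \<le> D * r"
proof -
  have "eventually (\<lambda>x. measure std_normal {..x} < q) at_bot"
    using order_tendstoD(2)[OF std_normal.cdf_lim_at_bot q] by (simp add: cdf_def)
  then obtain A0 where A0: "\<And>x. x \<le> A0 \<Longrightarrow> measure std_normal {..x} < q"
    unfolding eventually_at_bot_linorder by blast
  \<comment> \<open>A point with mass at least \<open>q\<close> to its left cannot lie too far left;
    \<open>- A\<close> is a lower bound for all such \<open>\<tau>\<close>, uniformly in
    \<open>t\<close>.\<close>
  define A where "A = max 0 (- A0)"
  have A: "0 \<le> A" "\<And>x. x \<le> - A \<Longrightarrow> measure std_normal {..x} < q"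
    using A0 by (auto simp: A_def)
  \<comment> \<open>A lower bound for the hazard rate to the right of \<open>- A\<close>. For
    \<open>u >= 0\<close> the tail estimate gives \<open>1 / sqrt (2 * pi)\<close>; for
    \<open>- A <= u < 0\<close> the tail is at most 1 and the density at least that at
    \<open>A\<close>.\<close>
  define \<kappa> where "\<kappa> = min (std_normal_density A) (1 / sqrt (2 * pi))"
  have \<kappa>: "0 < \<kappa>" by (simp add: \<kappa>_def normal_density_pos)
  have hazard: "\<kappa> * measure std_normal {u<..} \<le> std_normal_density u" if "- A \<le> u" for u
  proof (cases "0 \<le> u")
    case True
    have "\<kappa> * measure std_normal {u<..} \<le> 1 / sqrt (2 * pi) * (sqrt (2 * pi) * std_normal_density u)"
      using \<kappa> std_normal_tail_le[OF True] by (intro mult_mono) (auto simp: \<kappa>_def)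
    then show ?thesis by simp
  next
    case False
    then have "u\<^sup>2 \<le> A\<^sup>2" using that by (simp add: abs_le_square_iff[symmetric])
    then have "std_normal_density A \<le> std_normal_density u"
      by (simp add: std_normal_density_def divide_right_mono)
    moreover have "\<kappa> * measure std_normal {u<..} \<le> std_normal_density A * 1"
      using \<kappa> by (intro mult_mono) (auto simp: \<kappa>_def)
    ultimately show ?thesis by simp
  qed
  define D where "D = 1 / (\<kappa> * min c 1)"
  show ?thesis
  proof (intro exI[of _ D] conjI allI impI)
    show "0 < D" using c \<kappa> by (simp add: D_def)
    fix t \<tau> r
    let ?\<Psi> = "\<lambda>t. measure std_normal {t<..}"
    assume t: "0 \<le> t" and tail: "c * ?\<Psi> t \<le> ?\<Psi> \<tau>" and low: "q \<le> measure std_normal {..\<tau>}"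
      and diff: "\<bar>?\<Psi> \<tau> - ?\<Psi> t\<bar> \<le> r * ?\<Psi> t"
    have \<tau>: "- A \<le> \<tau>" using A(2)[of \<tau>] low by force
    \<comment> \<open>Between \<open>x\<close> and \<open>y\<close> the density is at least
      \<open>\<kappa>\<close> times the tail beyond \<open>y\<close>, so the mass of the interval,
      which is the difference of the two tails, controls its length. The pair \<open>x\<close>,
      \<open>y\<close> is \<open>t\<close>, \<open>\<tau>\<close> in increasing order, and
      \<open>min c 1\<close> covers the tail at either right end point.\<close>
    have main: "\<kappa> * (min c 1 * ?\<Psi> t) * (y - x) \<le> r * ?\<Psi> t"
      if xy: "x \<le> y" "- A \<le> x" "\<bar>?\<Psi> x - ?\<Psi> y\<bar> = \<bar>?\<Psi> \<tau> - ?\<Psi> t\<bar>" "min c 1 * ?\<Psi> t \<le> ?\<Psi> y" for x y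
    proof -
      have "\<kappa> * (min c 1 * ?\<Psi> t) * (y - x) \<le> measure std_normal {x<..y}"
      proof (rule measure_std_normal_Ioc_ge)
        fix u assume u: "x < u" "u \<le> y"
        have "?\<Psi> y \<le> ?\<Psi> u"
          using u(2) by (intro std_normal.finite_measure_mono) auto
        then have "\<kappa> * (min c 1 * ?\<Psi> t) \<le> \<kappa> * ?\<Psi> u"
          using \<kappa> xy(4) by (intro mult_left_mono) linarith+
        also have "\<dots> \<le> std_normal_density u" using u(1) xy(2) by (intro hazard) simp
        finally show "\<kappa> * (min c 1 * ?\<Psi> t) \<le> std_normal_density u" .
      next
        show "x \<le> y" by fact
        show "0 \<le> \<kappa> * (min c 1 * ?\<Psi> t)" using \<kappa> c by simp
      qed
      also have "\<dots> \<le> \<bar>?\<Psi> x - ?\<Psi> y\<bar>"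
      proof -
        have "{x<..} = {x<..y} \<union> {y<..}" using xy(1) by auto
        moreover have "measure std_normal ({x<..y} \<union> {y<..}) = measure std_normal {x<..y} + ?\<Psi> y"
          by (rule std_normal.finite_measure_Union) auto
        ultimately have "?\<Psi> x = measure std_normal {x<..y} + ?\<Psi> y" by metis
        then show ?thesis by simp
      qed
      finally show ?thesis using xy(3) diff by simp
    qed
    have one: "min c 1 * ?\<Psi> t \<le> ?\<Psi> \<tau>"
      using tail mult_right_mono[of "min c 1" c "?\<Psi> t"] by simp
    have two: "min c 1 * ?\<Psi> t \<le> ?\<Psi> t"
      using mult_right_mono[of "min c 1" 1 "?\<Psi> t"] by simp
    have "\<kappa> * (min c 1 * ?\<Psi> t) * \<bar>\<tau> - t\<bar> \<le> r * ?\<Psi> t"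
    proof (cases "t \<le> \<tau>")
      case True
      then show ?thesis using main[of t \<tau>] one t A(1) by (simp add: abs_minus_commute)
    next
      case False
      then show ?thesis using main[of \<tau> t] two \<tau> by simp
    qed
    then have "(\<kappa> * min c 1 * \<bar>\<tau> - t\<bar>) * ?\<Psi> t \<le> r * ?\<Psi> t" by (simp add: mult_ac)
    then have "\<kappa> * min c 1 * \<bar>\<tau> - t\<bar> \<le> r"
      using measure_std_normal_Ioi_pos[of t] by simp
    then show "\<bar>\<tau> - t\<bar> \<le> D * r"
      using c \<kappa> by (simp add: D_def pos_le_divide_eq mult.commute)
  qed
qed

section \<open>The normal distribution function and its inverse\<close>

lemma measure_std_normal_Iic_le_iff:
  "measure std_normal {..x} \<le> measure std_normal {..y} \<longleftrightarrow> x \<le> y"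
proof
  have *: "measure std_normal {..y} < measure std_normal {..x}" if "y < x" for x y
  proof -
    have "{..x} = {..y} \<union> {y<..x}" using that by auto
    moreover have "measure std_normal ({..y} \<union> {y<..x}) = measure std_normal {..y} + measure std_normal {y<..x}"
      by (rule std_normal.finite_measure_Union) auto
    ultimately show ?thesis using measure_std_normal_Ioc_pos[OF that] by simp
  qed
  assume "measure std_normal {..x} \<le> measure std_normal {..y}"
  then show "x \<le> y" using *[of y x] by force
next
  assume "x \<le> y"
  then show "measure std_normal {..x} \<le> measure std_normal {..y}"
    by (intro std_normal.finite_measure_mono) auto
qed

lemma (in real_distribution) exists_cdf_eq:
  assumes atomless: "\<And>x. measure M {x} = 0" and u: "0 < u" "u < 1"
  shows "\<exists>x. measure M {..x} = u"
proof -
  have "eventually (\<lambda>x. cdf M x < u) at_bot"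
    by (rule order_tendstoD(2)[OF cdf_lim_at_bot u(1)])
  then obtain l where l: "\<And>x. x \<le> l \<Longrightarrow> cdf M x < u"
    unfolding eventually_at_bot_linorder by blast
  have "eventually (\<lambda>x. u < cdf M x) at_top"
    by (rule order_tendstoD(1)[OF cdf_lim_at_top_prob u(2)])
  then obtain r where r: "\<And>x. r \<le> x \<Longrightarrow> u < cdf M x"
    unfolding eventually_at_top_linorder by blast
  \<comment> \<open>\<open>min\<close> and \<open>max\<close> order the end points without a
    separate proof of \<open>l <= r\<close>.\<close>
  have "\<exists>x. min l r \<le> x \<and> x \<le> max l r \<and> cdf M x = u"
  proof (rule IVT)
    show "\<forall>x. min l r \<le> x \<and> x \<le> max l r \<longrightarrow> isCont (cdf M) x"
      using atomless by (simp add: isCont_cdf)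
    show "cdf M (min l r) \<le> u" "u \<le> cdf M (max l r)"
      using l[of "min l r"] r[of "max l r"] by auto
  qed simp
  then show ?thesis by (auto simp: cdf_def)
qed

text \<open>The inverse of the normal distribution function on the open unit interval. Elsewhere no
  such \<open>x\<close> exists and the chosen value is arbitrary.\<close>

definition normal_quantile :: "real \<Rightarrow> real" where
  "normal_quantile u = (SOME x. measure std_normal {..x} = u)"

lemma measure_normal_quantile:
  assumes "0 < u" "u < 1"
  shows "measure std_normal {..normal_quantile u} = u"
  unfolding normal_quantile_def
  by (rule someI_ex) (intro std_normal.exists_cdf_eq assms, simp)

lemma normal_quantile_le_iff:
  assumes "0 < u" "u < 1"
  shows "normal_quantile u \<le> x \<longleftrightarrow> u \<le> measure std_normal {..x}"
  using measure_std_normal_Iic_le_iff[of "normal_quantile u" x]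
  by (simp add: measure_normal_quantile[OF assms])

text \<open>The choice operator carries no measurability by itself; through
  \<open>normal_quantile_le_iff\<close> the sublevel sets become sublevel sets of
  \<open>G\<close>.\<close>

lemma borel_measurable_normal_quantile:
  assumes [measurable]: "G \<in> borel_measurable M" and G: "\<And>x. x \<in> space M \<Longrightarrow> 0 < G x \<and> G x < 1"
  shows "(\<lambda>x. normal_quantile (G x)) \<in> borel_measurable M"
  unfolding borel_measurable_iff_le
proof
  fix a
  have "{w \<in> space M. normal_quantile (G w) \<le> a} = {w \<in> space M. G w \<le> measure std_normal {..a}}"
    using G by (auto simp: normal_quantile_le_iff)
  also have "\<dots> \<in> sets M" by measurable
  finally show "{w \<in> space M. normal_quantile (G w) \<le> a} \<in> sets M" .
qed

section \<open>Comparing a law with the normal law through its density\<close>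

lemma (in prob_space) measure_density_ge:
  assumes [measurable]: "k \<in> borel_measurable M" and \<nu>: "prob_space (density M (\<lambda>x. ennreal (k x)))"
    and c: "0 \<le> c" "\<And>x. c \<le> k x" and A[measurable]: "A \<in> sets M"
  shows "c * measure M A \<le> measure (density M (\<lambda>x. ennreal (k x))) A"
proof -
  interpret \<nu>: prob_space "density M (\<lambda>x. ennreal (k x))" by fact
  have "ennreal (c * measure M A) = (\<integral>\<^sup>+x. ennreal c * indicator A x \<partial>M)"
    using c by (simp add: nn_integral_cmult_indicator ennreal_mult emeasure_eq_measure)
  also have "\<dots> \<le> emeasure (density M (\<lambda>x. ennreal (k x))) A"
    using c by (subst emeasure_density) (auto intro!: nn_integral_mono simp: indicator_def ennreal_leI)
  finally show ?thesis by (simp add: \<nu>.emeasure_eq_measure)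
qed

text \<open>The pointwise bound on \<open>k - 1\<close> is integrated over \<open>A\<close>. Both
  directions are inequalities between sums of nonnegative integrals, so nothing has to be subtracted
  in \<open>ennreal\<close>.\<close>

lemma (in prob_space) measure_density_close:
  assumes [measurable]: "k \<in> borel_measurable M" and \<nu>: "prob_space (density M (\<lambda>x. ennreal (k x)))"
    and k: "\<And>x. 0 \<le> k x" and A[measurable]: "A \<in> sets M" and [measurable]: "w \<in> borel_measurable M"
    and w: "0 \<le> \<eta>" "\<And>x. 0 \<le> w x" "\<And>x. \<bar>k x - 1\<bar> \<le> \<eta> * w x"
    and B: "0 \<le> B" "(\<integral>\<^sup>+x. ennreal (w x) * indicator A x \<partial>M) \<le> ennreal B"
  shows "\<bar>measure (density M (\<lambda>x. ennreal (k x))) A - measure M A\<bar> \<le> \<eta> * B"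
proof -
  interpret \<nu>: prob_space "density M (\<lambda>x. ennreal (k x))" by fact
  have w': "(\<integral>\<^sup>+x. ennreal (\<eta> * w x) * indicator A x \<partial>M) \<le> ennreal (\<eta> * B)"
  proof -
    have "(\<integral>\<^sup>+x. ennreal (\<eta> * w x) * indicator A x \<partial>M) = ennreal \<eta> * (\<integral>\<^sup>+x. ennreal (w x) * indicator A x \<partial>M)"
      using w by (subst nn_integral_cmult[symmetric]) (auto simp: ennreal_mult mult.assoc)
    also have "\<dots> \<le> ennreal (\<eta> * B)"
      using B w by (auto simp: ennreal_mult intro!: mult_left_mono)
    finally show ?thesis .
  qed
  have e: "emeasure (density M (\<lambda>x. ennreal (k x))) A = (\<integral>\<^sup>+x. ennreal (k x) * indicator A x \<partial>M)"
    by (simp add: emeasure_density)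
  have a: "ennreal (k x) * indicator A x \<le> indicator A x + ennreal (\<eta> * w x) * indicator A x"
    "indicator A x \<le> ennreal (k x) * indicator A x + ennreal (\<eta> * w x) * indicator A x" for x
  proof -
    have "ennreal (k x) \<le> ennreal (1 + \<eta> * w x)" "ennreal 1 \<le> ennreal (k x + \<eta> * w x)"
      using w(3)[of x] by (auto intro!: ennreal_leI simp del: ennreal_plus)
    moreover have "ennreal (1 + \<eta> * w x) = 1 + ennreal (\<eta> * w x)"
      "ennreal (k x + \<eta> * w x) = ennreal (k x) + ennreal (\<eta> * w x)"
      using w k by (subst ennreal_plus; simp)+
    ultimately have "ennreal (k x) \<le> 1 + ennreal (\<eta> * w x)" "1 \<le> ennreal (k x) + ennreal (\<eta> * w x)"
      by simp_all
    then show "ennreal (k x) * indicator A x \<le> indicator A x + ennreal (\<eta> * w x) * indicator A x"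
      "indicator A x \<le> ennreal (k x) * indicator A x + ennreal (\<eta> * w x) * indicator A x"
      by (simp_all add: indicator_def)
  qed
  have "(\<integral>\<^sup>+x. ennreal (k x) * indicator A x \<partial>M) \<le> emeasure M A + ennreal (\<eta> * B)"
  proof -
    have "(\<integral>\<^sup>+x. ennreal (k x) * indicator A x \<partial>M) \<le>
        (\<integral>\<^sup>+x. indicator A x + ennreal (\<eta> * w x) * indicator A x \<partial>M)"
      by (intro nn_integral_mono a)
    also have "\<dots> = emeasure M A + (\<integral>\<^sup>+x. ennreal (\<eta> * w x) * indicator A x \<partial>M)"
      by (subst nn_integral_add) auto
    finally show ?thesis using w' by (meson add_left_mono order_trans)
  qed
  then have 1: "measure (density M (\<lambda>x. ennreal (k x))) A \<le> measure M A + \<eta> * B"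
    using w B unfolding e[symmetric]
    by (simp add: \<nu>.emeasure_eq_measure emeasure_eq_measure ennreal_plus[symmetric] del: ennreal_plus)
  have "emeasure M A \<le> (\<integral>\<^sup>+x. ennreal (k x) * indicator A x \<partial>M) + ennreal (\<eta> * B)"
  proof -
    have "emeasure M A = (\<integral>\<^sup>+x. indicator A x \<partial>M)" by simp
    also have "\<dots> \<le> (\<integral>\<^sup>+x. ennreal (k x) * indicator A x + ennreal (\<eta> * w x) * indicator A x \<partial>M)"
      by (intro nn_integral_mono a)
    also have "\<dots> = (\<integral>\<^sup>+x. ennreal (k x) * indicator A x \<partial>M) + (\<integral>\<^sup>+x. ennreal (\<eta> * w x) * indicator A x \<partial>M)"
      by (subst nn_integral_add) auto
    finally show ?thesis using w' by (meson add_left_mono order_trans)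
  qed
  then have 2: "measure M A \<le> measure (density M (\<lambda>x. ennreal (k x))) A + \<eta> * B"
    using w B unfolding e[symmetric]
    by (simp add: \<nu>.emeasure_eq_measure emeasure_eq_measure ennreal_plus[symmetric] del: ennreal_plus)
  from 1 2 show ?thesis by linarith
qed

text \<open>The distribution functions agree. As \<open>k >= c > 0\<close> and points are null, that
  of the source is continuous and strictly increasing; with \<open>t0\<close> the point where it
  reaches the normal value at \<open>x\<close>, the event \<open>\<tau> t <= x\<close> is
  \<open>t <= t0\<close>.\<close>

lemma distr_quantile_std_normal:
  assumes k[measurable]: "k \<in> borel_measurable borel"
    and \<nu>: "prob_space (density std_normal (\<lambda>x. ennreal (k x)))"
    and c: "0 < c" "\<And>x. c \<le> k x"
    and [measurable]: "\<tau> \<in> borel_measurable borel"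
    and \<tau>: "\<And>t. measure std_normal {..\<tau> t} = measure (density std_normal (\<lambda>x. ennreal (k x))) {..t}"
  shows "distr (density std_normal (\<lambda>x. ennreal (k x))) borel \<tau> = std_normal"
proof -
  let ?\<nu> = "density std_normal (\<lambda>x. ennreal (k x))"
  interpret \<nu>: real_distribution ?\<nu>
    using \<nu> by (auto simp: real_distribution_def real_distribution_axioms_def)
  have null: "measure ?\<nu> {x} = 0" for x
  proof -
    have "AE t in std_normal. t \<notin> {x}"
      by (rule AE_not_in)
        (simp add: null_sets_def std_normal.emeasure_eq_measure)
    then have "emeasure ?\<nu> {x} = 0"
      by (subst emeasure_density)
        (auto simp: nn_integral_0_iff_AE indicator_def)
    then show ?thesis by (simp add: measure_def)
  qed
  have mono: "measure ?\<nu> {..y} < measure ?\<nu> {..x}" if "y < x" for x y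
  proof -
    have "{..x} = {..y} \<union> {y<..x}" using that by auto
    moreover have "measure ?\<nu> ({..y} \<union> {y<..x}) = measure ?\<nu> {..y} + measure ?\<nu> {y<..x}"
      by (rule \<nu>.finite_measure_Union) auto
    moreover have "0 < c * measure std_normal {y<..x}"
      using measure_std_normal_Ioc_pos[OF that] c(1) by simp
    moreover have "c * measure std_normal {y<..x} \<le> measure ?\<nu> {y<..x}"
      using c by (intro std_normal.measure_density_ge \<nu>) auto
    ultimately show ?thesis by simp
  qed
  show ?thesis
  proof (rule cdf_unique[OF _ real_distribution_std_normal])
    show "real_distribution (distr ?\<nu> borel \<tau>)" by (rule \<nu>.real_distribution_distr) simp
    show "cdf (distr ?\<nu> borel \<tau>) = cdf std_normal"
    proof
      fix x
      have u: "0 < measure std_normal {..x}" "measure std_normal {..x} < 1"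
        using measure_std_normal_Iic_pos[of x] measure_std_normal_Ioi_pos[of x] measure_std_normal_Ioi[of x]
        by simp_all
      obtain t0 where t0: "measure ?\<nu> {..t0} = measure std_normal {..x}"
        using \<nu>.exists_cdf_eq[OF null u] by blast
      have "measure ?\<nu> {..t} \<le> measure ?\<nu> {..t0} \<longleftrightarrow> t \<le> t0" for t
        using mono[of t0 t] mono[of t t0] by (cases t t0 rule: linorder_cases) auto
      then have "\<tau> -` {..x} = {..t0}"
        using measure_std_normal_Iic_le_iff[of "\<tau> _" x] by (auto simp: \<tau> t0[symmetric])
      then show "cdf (distr ?\<nu> borel \<tau>) x = cdf std_normal x"
        by (simp add: cdf_def measure_distr t0)
    qed
  qed
qed

text \<open>For \<open>t >= 0\<close> the weighted tail bound shows that the upper tails of the two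
  laws at \<open>t\<close> differ by at most the fraction \<open>\<eta> * K * exp (a * t^2)\<close>
  of the normal tail, and the hazard rate turns this relative error into a displacement. Negative
  \<open>t\<close> is treated by reflection, since there it is the lower tail that is small.\<close>

lemma quantile_displacement:
  assumes c: "0 < c" and a: "0 \<le> a" "a < 1 / 2"
  shows "\<exists>D>0. \<forall>k \<tau> \<eta>. k \<in> borel_measurable borel \<longrightarrow>
    prob_space (density std_normal (\<lambda>x. ennreal (k x))) \<longrightarrow> (\<forall>t. c \<le> k t) \<longrightarrow>
    0 \<le> \<eta> \<longrightarrow> (\<forall>t. \<bar>k t - 1\<bar> \<le> \<eta> * exp (a * t\<^sup>2)) \<longrightarrow>
    (\<forall>t. measure std_normal {..\<tau> t} = measure (density std_normal (\<lambda>x. ennreal (k x))) {..t}) \<longrightarrow>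
    (\<forall>t. \<bar>\<tau> t - t\<bar> \<le> D * \<eta> * exp (a * t\<^sup>2))"
proof -
  let ?\<Psi> = "\<lambda>t. measure std_normal {t<..}" and ?\<Phi> = "\<lambda>t. measure std_normal {..t}"
  \<comment> \<open>The density is at least \<open>c\<close>, so a half line containing
    \<open>{..0}\<close> or \<open>{0<..}\<close> keeps mass at least \<open>q\<close>. This stops
    the image point from escaping to the side opposite to the tail considered.\<close>
  define q where "q = c * min (?\<Phi> 0) (?\<Psi> 0)"
  have "0 < q" using c measure_std_normal_Ioi_pos measure_std_normal_Iic_pos by (simp add: q_def)
  from std_normal_quantile_displacement[OF c this]
  obtain D where D: "0 < D" "\<And>t \<tau> r. 0 \<le> t \<Longrightarrow> c * ?\<Psi> t \<le> ?\<Psi> \<tau> \<Longrightarrow> q \<le> ?\<Phi> \<tau> \<Longrightarrow>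
      \<bar>?\<Psi> \<tau> - ?\<Psi> t\<bar> \<le> r * ?\<Psi> t \<Longrightarrow> \<bar>\<tau> - t\<bar> \<le> D * r" by blast
  define K where "K = 1 / (1 - 2 * a)"
  have K: "0 < K" using a by (simp add: K_def)
  show ?thesis
  proof (intro exI[of _ "D * K"] conjI allI impI)
    show "0 < D * K" using D(1) K by simp
    fix k :: "real \<Rightarrow> real" and \<tau> \<eta> t
    let ?\<nu> = "density std_normal (\<lambda>x. ennreal (k x))"
    assume k[measurable]: "k \<in> borel_measurable borel" and \<nu>: "prob_space ?\<nu>" and ck: "\<forall>t. c \<le> k t"
      and \<eta>: "0 \<le> \<eta>" "\<forall>t. \<bar>k t - 1\<bar> \<le> \<eta> * exp (a * t\<^sup>2)"
      and \<tau>: "\<forall>t. ?\<Phi> (\<tau> t) = measure ?\<nu> {..t}"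
    interpret \<nu>: prob_space ?\<nu> by fact
    have \<nu>c: "measure ?\<nu> {t<..} = 1 - measure ?\<nu> {..t}"
    proof -
      have "{t<..} = space ?\<nu> - {..t}" by auto
      then show ?thesis by (simp only:) (subst \<nu>.prob_compl, auto)
    qed
    have ge: "c * measure std_normal A \<le> measure ?\<nu> A" if "A \<in> sets borel" for A
      using c ck that by (intro std_normal.measure_density_ge \<nu>) auto
    \<comment> \<open>\<open>A\<close> will be \<open>{s<..}\<close> itself or its mirror image; the
      equality of weighted masses lets one estimate serve both tails.\<close>
    have close: "\<bar>measure ?\<nu> A - measure std_normal A\<bar> \<le> \<eta> * (K * exp (a * s\<^sup>2) * ?\<Psi> s)"
      if "A \<in> sets borel" and "(\<integral>\<^sup>+u. ennreal (exp (a * u\<^sup>2)) * indicator A u \<partial>std_normal) =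
        (\<integral>\<^sup>+u. ennreal (exp (a * u\<^sup>2)) * indicator {s<..} u \<partial>std_normal)" "0 \<le> s" for A s
      using c ck K std_normal_weighted_tail_le[OF a that(3)]
      by (intro std_normal.measure_density_close[where w="\<lambda>t. exp (a * t\<^sup>2)"] \<nu> that(1) \<eta> k)
        (auto simp: \<eta> that(1,2) K_def intro: order_trans[OF less_imp_le[OF c]])
    show "\<bar>\<tau> t - t\<bar> \<le> D * K * \<eta> * exp (a * t\<^sup>2)"
    proof (cases "0 \<le> t")
      case True
      have \<Psi>\<tau>: "?\<Psi> (\<tau> t) = measure ?\<nu> {t<..}" by (simp add: measure_std_normal_Ioi \<nu>c \<tau>)
      have "q \<le> c * ?\<Phi> 0" using c by (simp add: q_def)
      also have "\<dots> \<le> c * ?\<Phi> t" using c True by (simp add: measure_std_normal_Iic_le_iff)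
      also have "\<dots> \<le> ?\<Phi> (\<tau> t)" using ge[of "{..t}"] by (simp add: \<tau>)
      finally have "q \<le> ?\<Phi> (\<tau> t)" .
      then have "\<bar>\<tau> t - t\<bar> \<le> D * (\<eta> * K * exp (a * t\<^sup>2))"
        using True ge[of "{t<..}"] close[of "{t<..}" t]
        by (intro D(2)) (auto simp: \<Psi>\<tau> mult_ac)
      then show ?thesis by (simp add: mult_ac)
    next
      case False
      \<comment> \<open>The upper tail estimate is applied to \<open>- t\<close> and
        \<open>- \<tau> t\<close>, whose upper tails are the lower tails of \<open>t\<close> and
        \<open>\<tau> t\<close>.\<close>
      have r: "?\<Phi> (- x) = ?\<Psi> x" for x
        using measure_std_normal_uminus_Ioi[of "- x"] by simp
      have "q \<le> c * ?\<Psi> 0" using c by (simp add: q_def)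
      also have "\<dots> \<le> c * ?\<Psi> t" using c False by (intro mult_left_mono std_normal.finite_measure_mono) auto
      also have "\<dots> \<le> measure ?\<nu> {t<..}" by (rule ge) simp
      also have "\<dots> = ?\<Phi> (- \<tau> t)" by (simp add: r measure_std_normal_Ioi \<nu>c \<tau>)
      finally have "q \<le> ?\<Phi> (- \<tau> t)" .
      moreover have "\<bar>measure ?\<nu> {..t} - ?\<Phi> t\<bar> \<le> \<eta> * (K * exp (a * (- t)\<^sup>2) * ?\<Psi> (- t))"
      proof (rule close)
        have "(\<integral>\<^sup>+u. ennreal (exp (a * u\<^sup>2)) * indicator {- t<..} u \<partial>std_normal) =
            (\<integral>\<^sup>+u. ennreal (exp (a * (- u)\<^sup>2)) * indicator {- t<..} (- u) \<partial>std_normal)"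
          by (rule nn_integral_std_normal_uminus[symmetric]) simp
        also have "\<dots> = (\<integral>\<^sup>+u. ennreal (exp (a * u\<^sup>2)) * indicator {..t} u \<partial>std_normal)"
        proof (rule nn_integral_cong_AE)
          \<comment> \<open>Reflection turns \<open>{- t<..}\<close> into \<open>{..<t}\<close>,
            which differs from \<open>{..t}\<close> by a null point.\<close>
          have "AE u in std_normal. u \<notin> {t}"
            by (rule AE_not_in) (simp add: null_sets_def std_normal.emeasure_eq_measure)
          then show "AE u in std_normal. ennreal (exp (a * (- u)\<^sup>2)) * indicator {- t<..} (- u) =
              ennreal (exp (a * u\<^sup>2)) * indicator {..t} u"
            by eventually_elim (auto simp: indicator_def)
        qed
        finally show "(\<integral>\<^sup>+u. ennreal (exp (a * u\<^sup>2)) * indicator {..t} u \<partial>std_normal) =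
          (\<integral>\<^sup>+u. ennreal (exp (a * u\<^sup>2)) * indicator {- t<..} u \<partial>std_normal)" by simp
      qed (use False in auto)
      ultimately have "\<bar>- \<tau> t - - t\<bar> \<le> D * (\<eta> * K * exp (a * (- t)\<^sup>2))"
        using False ge[of "{..t}"]
        by (intro D(2)) (auto simp: \<tau> measure_std_normal_uminus_Ioi mult_ac)
      then show ?thesis by (simp add: mult_ac)
    qed
  qed
qed

section \<open>Transport one coordinate at a time\<close>

lemma norm_upd_power2: "(norm (upd i t y))\<^sup>2 = (norm y)\<^sup>2 - (y $ i)\<^sup>2 + t\<^sup>2"
proof -
  have "(\<Sum>j\<in>UNIV - {i}. (upd i t y $ j)\<^sup>2) = (\<Sum>j\<in>UNIV - {i}. (y $ j)\<^sup>2)"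
    by (intro sum.cong) auto
  then show ?thesis
    unfolding norm_vec_power2 by (simp add: sum.remove[of UNIV i])
qed

text \<open>Under the Gaussian law this is the conditional expectation of \<open>h\<close> given the
  other coordinates, so \<open>1 + coord_avg i h\<close> is the density, relative to the Gaussian
  law, of their marginal under \<open>1 + h\<close>.\<close>

definition coord_avg :: "'d::finite \<Rightarrow> (real^'d \<Rightarrow> real) \<Rightarrow> real^'d \<Rightarrow> real" where
  "coord_avg i h y = (\<integral>t. h (upd i t y) \<partial>std_normal)"

lemma coord_avg_upd [simp]: "coord_avg i h (upd i t y) = coord_avg i h y"
  by (simp add: coord_avg_def)

lemma borel_measurable_coord_avg [measurable]:
  assumes [measurable]: "h \<in> borel_measurable borel"
  shows "coord_avg i h \<in> borel_measurable borel"
  unfolding coord_avg_def by measurable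

lemma integrable_std_normal_exp:
  assumes "a < 1 / 2"
  shows "integrable std_normal (\<lambda>t. exp (a * t\<^sup>2))"
  using nn_integral_std_normal_exp_finite[OF assms] by (intro integrableI_bounded) auto

lemma integrable_std_normal_bounded:
  fixes f :: "real \<Rightarrow> real"
  assumes "f \<in> borel_measurable borel" "\<And>t. l \<le> f t" "\<And>t. f t \<le> u"
  shows "integrable std_normal f"
proof (rule std_normal.integrable_const_bound[where B="\<bar>l\<bar> + \<bar>u\<bar>"])
  have "\<bar>f t\<bar> \<le> \<bar>l\<bar> + \<bar>u\<bar>" for t using assms(2,3)[of t] by linarith
  then show "AE t in std_normal. norm (f t) \<le> \<bar>l\<bar> + \<bar>u\<bar>" by simp
qed (use assms(1) in simp)

text \<open>On each line parallel to the \<open>i\<close>-th axis \<open>1 + h\<close> is the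
  product of \<open>1 + coord_avg i h\<close>, which is constant on the line, and a conditional
  density \<open>k\<close>. The quantile map of \<open>k\<close> makes the conditional law normal
  and leaves the constant factor alone. As \<open>k\<close> is at least \<open>c / B\<close>, one
  displacement constant serves all lines.\<close>

lemma coord_transport:
  assumes a: "0 \<le> a" "a < 1 / 2" and c: "0 < c" and B: "0 < B"
  shows "\<exists>D>0. \<forall>(h :: real^'d::finite \<Rightarrow> real) \<eta>. h \<in> borel_measurable borel \<longrightarrow> 0 \<le> \<eta> \<longrightarrow>
    (\<forall>y. \<bar>h y\<bar> \<le> \<eta> * exp (a * (norm y)\<^sup>2)) \<longrightarrow> (\<forall>y. c \<le> 1 + h y \<and> 1 + h y \<le> B) \<longrightarrow>
    (\<forall>y. \<bar>coord_avg i h y\<bar> \<le> D * \<eta> * exp (a * (norm y)\<^sup>2)) \<and>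
    (\<forall>y. c \<le> 1 + coord_avg i h y \<and> 1 + coord_avg i h y \<le> B) \<and>
    (\<exists>T. T \<in> borel_measurable borel \<and>
      distr (density gauss_measure (\<lambda>y. ennreal (1 + h y))) borel T =
        density gauss_measure (\<lambda>y. ennreal (1 + coord_avg i h y)) \<and>
      (\<forall>y. norm (T y - y) \<le> D * \<eta> * exp (a * (norm y)\<^sup>2)))"
proof -
  have "0 < c / B" using c B by simp
  from quantile_displacement[OF this a]
  obtain D where D: "0 < D" "\<And>k \<tau> \<eta> t. k \<in> borel_measurable borel \<Longrightarrow>
    prob_space (density std_normal (\<lambda>x. ennreal (k x))) \<Longrightarrow> (\<And>t. c / B \<le> k t) \<Longrightarrow>
    0 \<le> \<eta> \<Longrightarrow> (\<And>t. \<bar>k t - 1\<bar> \<le> \<eta> * exp (a * t\<^sup>2)) \<Longrightarrow>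
    (\<And>t. measure std_normal {..\<tau> t} = measure (density std_normal (\<lambda>x. ennreal (k x))) {..t}) \<Longrightarrow>
    \<bar>\<tau> t - t\<bar> \<le> D * \<eta> * exp (a * t\<^sup>2)"
    by metis
  define \<kappa> where "\<kappa> = (\<integral>t. exp (a * t\<^sup>2) \<partial>std_normal)"
  have \<kappa>: "0 \<le> \<kappa>" by (simp add: \<kappa>_def)
  show ?thesis
  \<comment> \<open>The first entry dominates \<open>\<kappa>\<close>, by which averaging can
    enlarge the perturbation. The second is the displacement constant \<open>D\<close> times the
    relative size of \<open>k y t - 1\<close>.\<close>
  proof (intro exI[of _ "max (1 + \<kappa>) (D * ((1 + \<kappa>) / c))"] conjI allI impI)
    let ?D = "max (1 + \<kappa>) (D * ((1 + \<kappa>) / c))"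
    show "0 < ?D" using \<kappa> by (simp add: less_max_iff_disj)
    fix h :: "real^'d \<Rightarrow> real" and \<eta>
    assume h[measurable]: "h \<in> borel_measurable borel" and \<eta>: "0 \<le> \<eta>"
      and hW: "\<forall>y. \<bar>h y\<bar> \<le> \<eta> * exp (a * (norm y)\<^sup>2)" and hcB: "\<forall>y. c \<le> 1 + h y \<and> 1 + h y \<le> B"
    let ?m = "coord_avg i h"
    \<comment> \<open>The squared norm is additive over the coordinates, so the bound for
      \<open>h\<close> at \<open>upd i t y\<close> is \<open>r y * exp (a * t^2)\<close>, where
      \<open>r y\<close> does not involve coordinate \<open>i\<close>. Each line is thus a
      one-dimensional problem with \<open>r y\<close> in the role of \<open>\<eta>\<close>.\<close>
    define r where "r y = \<eta> * exp (a * ((norm y)\<^sup>2 - (y $ i)\<^sup>2))" for y :: "real^'d"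
    have r0: "0 \<le> r y" for y using \<eta> by (simp add: r_def)
    have r_exp: "r y * exp (a * (y $ i)\<^sup>2) = \<eta> * exp (a * (norm y)\<^sup>2)" for y
      by (simp add: r_def exp_add[symmetric] right_diff_distrib)
    have r_le: "r y \<le> \<eta> * exp (a * (norm y)\<^sup>2)" for y
      using r0[of y] a r_exp[of y] mult_left_mono[of 1 "exp (a * (y $ i)\<^sup>2)" "r y"] by simp
    have hr: "\<bar>h (upd i t y)\<bar> \<le> r y * exp (a * t\<^sup>2)" for t y
      using hW[rule_format, of "upd i t y"]
      by (simp add: norm_upd_power2 r_def exp_add distrib_left mult.assoc)
    have int_h: "integrable std_normal (\<lambda>t. h (upd i t y))" for y
      using hcB by (intro integrable_std_normal_bounded[where l="c - 1" and u="B - 1"]) (auto simp: algebra_simps)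
    have m_cB: "c \<le> 1 + ?m y \<and> 1 + ?m y \<le> B" for y
    proof -
      have "c - 1 \<le> h z \<and> h z \<le> B - 1" for z using hcB[rule_format, of z] by linarith
      then have "c - 1 \<le> (\<integral>t. h (upd i t y) \<partial>std_normal)" "(\<integral>t. h (upd i t y) \<partial>std_normal) \<le> B - 1"
        by (auto intro!: std_normal.integral_ge_const std_normal.integral_le_const int_h)
      then show ?thesis by (simp add: coord_avg_def)
    qed
    then show "c \<le> 1 + ?m y" "1 + ?m y \<le> B" for y by simp_all
    have m_r: "\<bar>?m y\<bar> \<le> r y * \<kappa>" for y
    proof -
      have "\<bar>?m y\<bar> \<le> (\<integral>t. \<bar>h (upd i t y)\<bar> \<partial>std_normal)"
        unfolding coord_avg_def by (rule integral_abs_bound)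
      also have "\<dots> \<le> (\<integral>t. r y * exp (a * t\<^sup>2) \<partial>std_normal)"
        using hr integrable_std_normal_exp[OF a(2)] int_h by (intro integral_mono) auto
      finally show ?thesis by (simp add: \<kappa>_def)
    qed
    show "\<bar>?m y\<bar> \<le> ?D * \<eta> * exp (a * (norm y)\<^sup>2)" for y
    proof -
      have "\<bar>?m y\<bar> \<le> \<kappa> * (\<eta> * exp (a * (norm y)\<^sup>2))"
        using m_r[of y] mult_left_mono[OF r_le \<kappa>, of y] by (simp add: mult.commute)
      also have "\<dots> \<le> ?D * (\<eta> * exp (a * (norm y)\<^sup>2))"
        using \<eta> by (intro mult_right_mono) auto
      finally show ?thesis by (simp add: mult.assoc)
    qed
    define k where "k y t = (1 + h (upd i t y)) / (1 + ?m y)" for y t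
    have k_upd[simp]: "k (upd i u y) = k y" for u y by (simp add: k_def fun_eq_iff)
    have k_meas2[measurable]: "(\<lambda>(y, t). k y t) \<in> borel_measurable (borel \<Otimes>\<^sub>M borel)"
      unfolding k_def by measurable
    have k_meas[measurable]: "k y \<in> borel_measurable borel" for y
      unfolding k_def by measurable
    have m_pos: "0 < 1 + ?m y" for y using m_cB[of y] c by linarith
    have k_mult: "(1 + ?m y) * k y t = 1 + h (upd i t y)" for y t
      using m_pos[of y] by (simp add: k_def)
    have k_ge: "c / B \<le> k y t" for y t
      unfolding k_def using hcB[rule_format, of "upd i t y"] m_cB[of y] c B by (intro frac_le) linarith+
    have k_nonneg: "0 \<le> k y t" for y t
      using k_ge[of y t] \<open>0 < c / B\<close> by linarith
    have k_le: "k y t \<le> B / c" for y t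
      unfolding k_def using hcB[rule_format, of "upd i t y"] m_cB[of y] c B by (intro frac_le) linarith+
    have int_k: "integrable std_normal (k y)" for y
      by (rule integrable_std_normal_bounded[OF k_meas k_nonneg k_le])
    have k_int: "(\<integral>t. k y t \<partial>std_normal) = 1" for y
    proof -
      have "(\<integral>t. 1 + h (upd i t y) \<partial>std_normal) = 1 + ?m y"
        using int_h std_normal.prob_space by (subst Bochner_Integration.integral_add) (auto simp: coord_avg_def)
      then show ?thesis using m_pos[of y] by (simp add: k_def)
    qed
    have prob_k: "prob_space (density std_normal (\<lambda>t. ennreal (k y t)))" for y
    proof
      show "emeasure (density std_normal (\<lambda>t. ennreal (k y t))) (space (density std_normal (\<lambda>t. ennreal (k y t)))) = 1"
        using nn_integral_eq_integral[OF int_k[of y]] k_nonneg k_int by (simp add: emeasure_density)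
    qed
    define G where "G y t = measure (density std_normal (\<lambda>t. ennreal (k y t))) {..t}" for y t
    have G_eq: "G y t = (\<integral>u. k y u * indicator {..t} u \<partial>std_normal)" for y t
    proof -
      have "emeasure (density std_normal (\<lambda>t. ennreal (k y t))) {..t} = (\<integral>\<^sup>+u. ennreal (k y u * indicator {..t} u) \<partial>std_normal)"
        by (subst emeasure_density) (auto intro!: nn_integral_cong simp: indicator_def)
      also have "\<dots> = ennreal (\<integral>u. k y u * indicator {..t} u \<partial>std_normal)"
        using k_nonneg int_k by (intro nn_integral_eq_integral integrable_real_mult_indicator) auto
      finally show ?thesis
        using k_nonneg by (simp add: G_def measure_def integral_nonneg_AE)
    qed
    have G_upd[simp]: "G (upd i u y) t = G y t" for u y t by (simp add: G_def)
    \<comment> \<open>With a condition \<open>u <= t\<close> in place of the set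
      \<open>{..t}\<close> the integrand is jointly measurable, so the threshold may itself depend
      on \<open>y\<close>.\<close>
    have G_if: "G y t = (\<integral>u. (if u \<le> t then k y u else 0) \<partial>std_normal)" for y t
      unfolding G_eq by (intro Bochner_Integration.integral_cong) auto
    have G_meas[measurable]: "(\<lambda>y. G y (y $ i)) \<in> borel_measurable borel"
      unfolding G_if k_def by measurable
    have G_meas1[measurable]: "G y \<in> borel_measurable borel" for y
      unfolding G_if k_def by measurable
    have G01: "0 < G y t \<and> G y t < 1" for y t
    proof -
      interpret k: prob_space "density std_normal (\<lambda>t. ennreal (k y t))" by (rule prob_k)
      have ge: "c / B * measure std_normal A \<le> k.prob A" if "A \<in> sets borel" for A
        using that k_ge[of y] \<open>0 < c / B\<close> by (intro std_normal.measure_density_ge prob_k) auto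
      have "0 < c / B * measure std_normal {..t}" "0 < c / B * measure std_normal {t<..}"
        using \<open>0 < c / B\<close> measure_std_normal_Iic_pos[of t] measure_std_normal_Ioi_pos[of t] by (metis mult_pos_pos)+
      moreover have "k.prob {t<..} = 1 - k.prob {..t}"
      proof -
        have "{t<..} = space (density std_normal (\<lambda>t. ennreal (k y t))) - {..t}" by auto
        then show ?thesis by (simp only:) (subst k.prob_compl, auto)
      qed
      ultimately show ?thesis using ge[of "{..t}"] ge[of "{t<..}"] unfolding G_def by simp
    qed
    define \<tau> where "\<tau> y t = normal_quantile (G y t)" for y t
    have \<tau>: "measure std_normal {..\<tau> y t} = G y t" for y t
      using G01 by (simp add: \<tau>_def measure_normal_quantile)
    have \<tau>_upd[simp]: "\<tau> (upd i u y) t = \<tau> y t" for u y t by (simp add: \<tau>_def)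
    have \<tau>_meas[measurable]: "(\<lambda>y. \<tau> y (y $ i)) \<in> borel_measurable borel"
      unfolding \<tau>_def using G01 by (intro borel_measurable_normal_quantile) auto
    have \<tau>_meas1[measurable]: "\<tau> y \<in> borel_measurable borel" for y
      unfolding \<tau>_def using G01 by (intro borel_measurable_normal_quantile) auto
    define T where "T y = upd i (\<tau> y (y $ i)) y" for y
    have T_upd: "T (upd i t y) = upd i (\<tau> y t) y" for t y by (simp add: T_def)
    have T_meas[measurable]: "T \<in> borel_measurable borel" unfolding T_def by measurable
    show "\<exists>T. T \<in> borel_measurable borel \<and>
      distr (density gauss_measure (\<lambda>y. ennreal (1 + h y))) borel T =
        density gauss_measure (\<lambda>y. ennreal (1 + coord_avg i h y)) \<and>
      (\<forall>y. norm (T y - y) \<le> ?D * \<eta> * exp (a * (norm y)\<^sup>2))"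
    proof (intro exI[of _ T] conjI allI)
      show "T \<in> borel_measurable borel" by fact
      show "distr (density gauss_measure (\<lambda>y. ennreal (1 + h y))) borel T =
        density gauss_measure (\<lambda>y. ennreal (1 + ?m y))"
      proof (rule measure_eqI)
        fix A assume "A \<in> sets (distr (density gauss_measure (\<lambda>y. ennreal (1 + h y))) borel T)"
        then have A[measurable]: "A \<in> sets borel" by simp
        \<comment> \<open>Change of variables on a single line;
          \<open>nn_integral_gauss_resample\<close> then assembles the lines.\<close>
        have inner: "(\<integral>\<^sup>+t. ennreal (1 + h (upd i t y)) * indicator A (T (upd i t y)) \<partial>std_normal) =
            (\<integral>\<^sup>+t. ennreal (1 + ?m (upd i t y)) * indicator A (upd i t y) \<partial>std_normal)" for y
        proof -
          have "(\<integral>\<^sup>+t. ennreal (1 + h (upd i t y)) * indicator A (T (upd i t y)) \<partial>std_normal) =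
              (\<integral>\<^sup>+t. ennreal (1 + ?m y) * (ennreal (k y t) * indicator A (upd i (\<tau> y t) y)) \<partial>std_normal)"
            using m_pos k_nonneg
            by (intro nn_integral_cong)
              (simp add: T_upd k_mult[symmetric] ennreal_mult less_imp_le mult.assoc)
          also have "\<dots> = ennreal (1 + ?m y) * (\<integral>\<^sup>+t. indicator A (upd i (\<tau> y t) y) \<partial>density std_normal (\<lambda>t. ennreal (k y t)))"
            by (subst nn_integral_cmult) (auto simp: nn_integral_density)
          also have "(\<integral>\<^sup>+t. indicator A (upd i (\<tau> y t) y) \<partial>density std_normal (\<lambda>t. ennreal (k y t))) =
              (\<integral>\<^sup>+t. indicator A (upd i t y) \<partial>distr (density std_normal (\<lambda>t. ennreal (k y t))) borel (\<tau> y))"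
            by (subst nn_integral_distr) auto
          also have "distr (density std_normal (\<lambda>t. ennreal (k y t))) borel (\<tau> y) = std_normal"
            using \<open>0 < c / B\<close> k_ge by (intro distr_quantile_std_normal prob_k) (auto simp: \<tau> G_def)
          also have "ennreal (1 + ?m y) * (\<integral>\<^sup>+t. indicator A (upd i t y) \<partial>std_normal) =
              (\<integral>\<^sup>+t. ennreal (1 + ?m (upd i t y)) * indicator A (upd i t y) \<partial>std_normal)"
            by (subst nn_integral_cmult[symmetric]) auto
          finally show ?thesis .
        qed
        have "emeasure (distr (density gauss_measure (\<lambda>y. ennreal (1 + h y))) borel T) A =
            (\<integral>\<^sup>+y. ennreal (1 + h y) * indicator A (T y) \<partial>gauss_measure)"
          using measurable_sets[OF T_meas A]
          by (subst emeasure_distr) (auto simp: emeasure_density indicator_def intro!: nn_integral_cong)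
        also have "\<dots> = (\<integral>\<^sup>+y. ennreal (1 + ?m y) * indicator A y \<partial>gauss_measure)"
          by (subst (1 2) nn_integral_gauss_resample[where i=i]) (simp_all only: inner, measurable)
        also have "\<dots> = emeasure (density gauss_measure (\<lambda>y. ennreal (1 + ?m y))) A"
          by (simp add: emeasure_density)
        finally show "emeasure (distr (density gauss_measure (\<lambda>y. ennreal (1 + h y))) borel T) A =
          emeasure (density gauss_measure (\<lambda>y. ennreal (1 + ?m y))) A" .
      qed simp
      fix y
      \<comment> \<open>\<open>k y t - 1\<close> is the deviation of \<open>h\<close> from its
        average divided by \<open>1 + coord_avg i h >= c\<close>. The average is at most
        \<open>r y * \<kappa>\<close>, and it fits under the same weight because
        \<open>exp (a * t^2) >= 1\<close>.\<close>
      have k1: "\<bar>k y t - 1\<bar> \<le> (1 + \<kappa>) / c * r y * exp (a * t\<^sup>2)" for t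
      proof -
        have "\<bar>h (upd i t y) - ?m y\<bar> \<le> r y * exp (a * t\<^sup>2) + r y * \<kappa> * exp (a * t\<^sup>2)"
          using hr[of t y] m_r[of y] a r0[of y] \<kappa> mult_left_mono[of 1 "exp (a * t\<^sup>2)" "r y * \<kappa>"] by simp
        then have num: "\<bar>h (upd i t y) - ?m y\<bar> \<le> (1 + \<kappa>) * r y * exp (a * t\<^sup>2)"
          by (simp add: algebra_simps)
        have "k y t - 1 = (h (upd i t y) - ?m y) / (1 + ?m y)"
          using m_pos[of y] by (simp add: k_def field_simps)
        then have "\<bar>k y t - 1\<bar> = \<bar>h (upd i t y) - ?m y\<bar> / (1 + ?m y)"
          using m_pos[of y] by (simp add: abs_divide)
        also have "\<dots> \<le> ((1 + \<kappa>) * r y * exp (a * t\<^sup>2)) / c"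
          using num m_cB[of y] c by (intro frac_le) auto
        finally show ?thesis by simp
      qed
      have "T y - y = axis i (\<tau> y (y $ i) - y $ i)"
        by (simp add: T_def vec_eq_iff axis_def)
      then have "norm (T y - y) = \<bar>\<tau> y (y $ i) - y $ i\<bar>" by (simp add: norm_eq_sqrt_inner inner_axis_axis)
      also have "\<dots> \<le> D * ((1 + \<kappa>) / c * r y) * exp (a * (y $ i)\<^sup>2)"
        using k1 \<kappa> c r0 by (intro D(2)[where k="k y"] prob_k k_ge) (auto simp: \<tau> G_def)
      also have "\<dots> = D * ((1 + \<kappa>) / c) * (\<eta> * exp (a * (norm y)\<^sup>2))"
        by (simp add: r_exp[symmetric])
      also have "\<dots> \<le> ?D * (\<eta> * exp (a * (norm y)\<^sup>2))"
        using \<eta> by (intro mult_right_mono) auto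
      finally show "norm (T y - y) \<le> ?D * \<eta> * exp (a * (norm y)\<^sup>2)" by (simp add: mult.assoc)
    qed
  qed
qed

section \<open>Composing the coordinate maps\<close>

lemma powr_add_le:
  fixes x y p :: real
  assumes "0 \<le> x" "0 \<le> y" "0 \<le> p"
  shows "(x + y) powr p \<le> 2 powr p * (x powr p + y powr p)"
proof -
  have "(x + y) powr p \<le> (2 * max x y) powr p"
    using assms by (intro powr_mono2) auto
  also have "\<dots> = 2 powr p * (max x y) powr p"
    using assms by (simp add: powr_mult)
  also have "\<dots> \<le> 2 powr p * (x powr p + y powr p)"
    by (intro mult_left_mono) (auto simp: max_def)
  finally show ?thesis .
qed

text \<open>Induction on the set \<open>I\<close> of coordinates on which \<open>h\<close> may
  depend. Averaging over \<open>i\<close> removes \<open>i\<close> from this set and replaces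
  \<open>\<eta>\<close> by \<open>D * \<eta>\<close>, while the bounds \<open>c\<close> and
  \<open>B\<close> persist. The maps are composed, and no constant depends on \<open>h\<close> or
  \<open>\<eta>\<close>.\<close>

lemma gauss_transport:
  assumes a: "0 \<le> a" "a < 1 / 2" "a * p < 1 / 2" and p: "1 \<le> p" and c: "0 < c" and B: "0 < B"
    and I: "finite I"
  shows "\<exists>C>0. \<forall>(h :: real^'d::finite \<Rightarrow> real) \<eta>. h \<in> borel_measurable borel \<longrightarrow> 0 \<le> \<eta> \<longrightarrow>
    (\<forall>y. \<bar>h y\<bar> \<le> \<eta> * exp (a * (norm y)\<^sup>2)) \<longrightarrow> (\<forall>y. c \<le> 1 + h y \<and> 1 + h y \<le> B) \<longrightarrow>
    (\<forall>y y'. (\<forall>i\<in>I. y $ i = y' $ i) \<longrightarrow> h y = h y') \<longrightarrow>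
    prob_space (density gauss_measure (\<lambda>y. ennreal (1 + h y))) \<longrightarrow>
    (\<exists>T. T \<in> borel_measurable borel \<and>
      distr (density gauss_measure (\<lambda>y. ennreal (1 + h y))) borel T = gauss_measure \<and>
      (\<integral>\<^sup>+y. ennreal (norm (T y - y) powr p) \<partial>density gauss_measure (\<lambda>y. ennreal (1 + h y)))
        \<le> ennreal (C * \<eta> powr p))"
  using I
proof (induction I rule: finite_induct)
  case empty
  show ?case
  proof (intro exI[of _ 1] conjI allI impI)
    fix h :: "real^'d \<Rightarrow> real" and \<eta> :: real
    assume h: "\<forall>y y'. (\<forall>i\<in>{}. y $ i = y' $ i) \<longrightarrow> h y = h y'"
      and cB: "\<forall>y. c \<le> 1 + h y \<and> 1 + h y \<le> B"
      and pr: "prob_space (density gauss_measure (\<lambda>y. ennreal (1 + h y)))"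
    \<comment> \<open>A constant density of total mass 1 over a probability measure equals 1, so
      nothing is left to move and the identity serves as \<open>T\<close>.\<close>
    have h0: "h y = h 0" for y using h by blast
    then have "(\<lambda>y. ennreal (1 + h y)) = (\<lambda>_. ennreal (1 + h 0))" by metis
    then have "1 = emeasure (density gauss_measure (\<lambda>_::real^'d. ennreal (1 + h 0))) UNIV"
      using prob_space.emeasure_space_1[OF pr] by simp
    also have "\<dots> = (\<integral>\<^sup>+y. ennreal (1 + h 0) \<partial>(gauss_measure :: (real^'d) measure))"
      by (subst emeasure_density) auto
    also have "\<dots> = ennreal (1 + h 0)"
      by (simp add: gauss.emeasure_space_1[unfolded space_gauss_measure])
    finally have "1 + h 0 = 1" using cB c by (metis ennreal_eq_1)
    then have "h = (\<lambda>_. 0)" using h0 by (intro ext) simp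
    then show "\<exists>T. T \<in> borel_measurable borel \<and>
      distr (density gauss_measure (\<lambda>y. ennreal (1 + h y))) borel T = gauss_measure \<and>
      (\<integral>\<^sup>+y. ennreal (norm (T y - y) powr p) \<partial>density gauss_measure (\<lambda>y. ennreal (1 + h y)))
        \<le> ennreal (1 * \<eta> powr p)"
      by (intro exI[of _ "\<lambda>y. y"]) (simp add: density_1 distr_id2)
  qed simp
next
  case (insert i I)
  from insert.IH obtain C where C: "0 < C" and CT: "\<forall>(h :: real^'d \<Rightarrow> real) \<eta>.
    h \<in> borel_measurable borel \<longrightarrow> 0 \<le> \<eta> \<longrightarrow>
    (\<forall>y. \<bar>h y\<bar> \<le> \<eta> * exp (a * (norm y)\<^sup>2)) \<longrightarrow> (\<forall>y. c \<le> 1 + h y \<and> 1 + h y \<le> B) \<longrightarrow>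
    (\<forall>y y'. (\<forall>i\<in>I. y $ i = y' $ i) \<longrightarrow> h y = h y') \<longrightarrow>
    prob_space (density gauss_measure (\<lambda>y. ennreal (1 + h y))) \<longrightarrow>
    (\<exists>T. T \<in> borel_measurable borel \<and>
      distr (density gauss_measure (\<lambda>y. ennreal (1 + h y))) borel T = gauss_measure \<and>
      (\<integral>\<^sup>+y. ennreal (norm (T y - y) powr p) \<partial>density gauss_measure (\<lambda>y. ennreal (1 + h y)))
        \<le> ennreal (C * \<eta> powr p))"
    by (elim exE conjE) (rule that)
  from coord_transport[OF a(1,2) c B, where i=i and 'd='d]
  obtain D where D: "0 < D" and DT: "\<forall>(h :: real^'d \<Rightarrow> real) \<eta>. h \<in> borel_measurable borel \<longrightarrow> 0 \<le> \<eta> \<longrightarrow>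
    (\<forall>y. \<bar>h y\<bar> \<le> \<eta> * exp (a * (norm y)\<^sup>2)) \<longrightarrow> (\<forall>y. c \<le> 1 + h y \<and> 1 + h y \<le> B) \<longrightarrow>
    (\<forall>y. \<bar>coord_avg i h y\<bar> \<le> D * \<eta> * exp (a * (norm y)\<^sup>2)) \<and>
    (\<forall>y. c \<le> 1 + coord_avg i h y \<and> 1 + coord_avg i h y \<le> B) \<and>
    (\<exists>T. T \<in> borel_measurable borel \<and>
      distr (density gauss_measure (\<lambda>y. ennreal (1 + h y))) borel T =
        density gauss_measure (\<lambda>y. ennreal (1 + coord_avg i h y)) \<and>
      (\<forall>y. norm (T y - y) \<le> D * \<eta> * exp (a * (norm y)\<^sup>2)))"
    by (elim exE conjE) (rule that)
  define E where "E = enn2real (\<integral>\<^sup>+y. ennreal (exp (a * p * (norm y)\<^sup>2)) \<partial>(gauss_measure :: (real^'d) measure))"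
  have E: "0 \<le> E" "(\<integral>\<^sup>+y. ennreal (exp (a * p * (norm y)\<^sup>2)) \<partial>(gauss_measure :: (real^'d) measure)) = ennreal E"
    using nn_integral_gauss_exp_finite[OF a(3), where 'd='d] by (simp_all add: E_def)
  \<comment> \<open>\<open>2 powr p\<close> comes from splitting the displacement of
    \<open>T2 \<circ> T1\<close>. The first summand is the inductive cost at
    \<open>D * \<eta>\<close>; the second is the cost of \<open>T1\<close>, where \<open>B\<close>
    bounds the density and \<open>E\<close> is the Gaussian integral of the \<open>p\<close>-th
    power of the weight.\<close>
  define C' where "C' = 2 powr p * (C * D powr p + B * D powr p * E)"
  have "0 < C * D powr p" using C D by simp
  moreover have "0 \<le> B * D powr p * E" using B E by simp
  ultimately have C': "0 < C'" by (simp add: C'_def add_pos_nonneg)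
  show ?case
  proof (intro exI[of _ C'] conjI allI impI)
    show "0 < C'" by fact
    fix h :: "real^'d \<Rightarrow> real" and \<eta> :: real
    assume h[measurable]: "h \<in> borel_measurable borel" and \<eta>: "0 \<le> \<eta>"
      and hW: "\<forall>y. \<bar>h y\<bar> \<le> \<eta> * exp (a * (norm y)\<^sup>2)" and hcB: "\<forall>y. c \<le> 1 + h y \<and> 1 + h y \<le> B"
      and dep: "\<forall>y y'. (\<forall>i\<in>insert i I. y $ i = y' $ i) \<longrightarrow> h y = h y'"
      and pr: "prob_space (density gauss_measure (\<lambda>y. ennreal (1 + h y)))"
    let ?\<nu> = "density gauss_measure (\<lambda>y. ennreal (1 + h y))"
    let ?\<nu>' = "density gauss_measure (\<lambda>y. ennreal (1 + coord_avg i h y))"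
    obtain T1 where T1[measurable]: "T1 \<in> borel_measurable borel" and d1: "distr ?\<nu> borel T1 = ?\<nu>'"
      and T1W: "\<And>y. norm (T1 y - y) \<le> D * \<eta> * exp (a * (norm y)\<^sup>2)"
      and avg: "\<And>y. \<bar>coord_avg i h y\<bar> \<le> D * \<eta> * exp (a * (norm y)\<^sup>2)"
      "\<And>y. c \<le> 1 + coord_avg i h y \<and> 1 + coord_avg i h y \<le> B"
      using DT[rule_format, OF h \<eta> hW[rule_format] hcB[rule_format]] by blast
    have pr': "prob_space ?\<nu>'"
      unfolding d1[symmetric] using pr by (rule prob_space.prob_space_distr) simp
    have dep': "\<forall>y y'. (\<forall>j\<in>I. y $ j = y' $ j) \<longrightarrow> coord_avg i h y = coord_avg i h y'"
    proof (intro allI impI)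
      fix y y' :: "real^'d" assume that: "\<forall>j\<in>I. y $ j = y' $ j"
      have "h (upd i t y) = h (upd i t y')" for t using that by (intro dep[rule_format]) auto
      then show "coord_avg i h y = coord_avg i h y'" by (simp add: coord_avg_def)
    qed
    have avg': "\<forall>y. \<bar>coord_avg i h y\<bar> \<le> D * \<eta> * exp (a * (norm y)\<^sup>2)"
      "\<forall>y. c \<le> 1 + coord_avg i h y \<and> 1 + coord_avg i h y \<le> B" using avg by blast+
    have D\<eta>: "0 \<le> D * \<eta>" using D \<eta> by simp
    obtain T2 where T2[measurable]: "T2 \<in> borel_measurable borel" and d2: "distr ?\<nu>' borel T2 = gauss_measure"
      and T2W: "(\<integral>\<^sup>+y. ennreal (norm (T2 y - y) powr p) \<partial>?\<nu>') \<le> ennreal (C * (D * \<eta>) powr p)"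
      using CT[THEN spec, THEN spec, THEN mp, THEN mp, THEN mp, THEN mp, THEN mp, THEN mp,
          OF borel_measurable_coord_avg[OF h] D\<eta> avg' dep' pr'] by blast
    show "\<exists>T. T \<in> borel_measurable borel \<and> distr ?\<nu> borel T = gauss_measure \<and>
      (\<integral>\<^sup>+y. ennreal (norm (T y - y) powr p) \<partial>?\<nu>) \<le> ennreal (C' * \<eta> powr p)"
    proof (intro exI[of _ "T2 \<circ> T1"] conjI)
      show "T2 \<circ> T1 \<in> borel_measurable borel" by measurable
      show "distr ?\<nu> borel (T2 \<circ> T1) = gauss_measure"
        using d2 unfolding d1[symmetric] by (subst (asm) distr_distr) auto
      have i1: "(\<integral>\<^sup>+y. ennreal (norm (T2 (T1 y) - T1 y) powr p) \<partial>?\<nu>) \<le> ennreal (C * D powr p * \<eta> powr p)"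
      proof -
        have "(\<integral>\<^sup>+y. ennreal (norm (T2 (T1 y) - T1 y) powr p) \<partial>?\<nu>) = (\<integral>\<^sup>+y. ennreal (norm (T2 y - y) powr p) \<partial>?\<nu>')"
          unfolding d1[symmetric] by (subst nn_integral_distr) auto
        then show ?thesis using T2W D \<eta> by (simp add: powr_mult mult.assoc)
      qed
      have i2: "(\<integral>\<^sup>+y. ennreal (norm (T1 y - y) powr p) \<partial>?\<nu>) \<le> ennreal (B * D powr p * E * \<eta> powr p)"
      proof -
        have "(\<integral>\<^sup>+y. ennreal (norm (T1 y - y) powr p) \<partial>?\<nu>) =
            (\<integral>\<^sup>+y. ennreal (1 + h y) * ennreal (norm (T1 y - y) powr p) \<partial>gauss_measure)"
          by (subst nn_integral_density) auto
        also have "\<dots> \<le> (\<integral>\<^sup>+y. ennreal (B * (D * \<eta>) powr p) * ennreal (exp (a * p * (norm y)\<^sup>2)) \<partial>(gauss_measure :: (real^'d) measure))"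
        proof (intro nn_integral_mono)
          fix y
          have "norm (T1 y - y) powr p \<le> (D * \<eta> * exp (a * (norm y)\<^sup>2)) powr p"
            using T1W p by (intro powr_mono2) auto
          also have "\<dots> = (D * \<eta>) powr p * exp (a * p * (norm y)\<^sup>2)"
            using D \<eta> by (subst powr_mult) (auto simp: powr_def mult_ac)
          finally have "(1 + h y) * norm (T1 y - y) powr p \<le> B * ((D * \<eta>) powr p * exp (a * p * (norm y)\<^sup>2))"
            using hcB B by (intro mult_mono) auto
          then show "ennreal (1 + h y) * ennreal (norm (T1 y - y) powr p) \<le>
              ennreal (B * (D * \<eta>) powr p) * ennreal (exp (a * p * (norm y)\<^sup>2))"
            using hcB[rule_format, of y] c B
            by (subst (1 2) ennreal_mult[symmetric]) (auto intro!: ennreal_leI simp: mult.assoc)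
        qed
        also have "\<dots> = ennreal (B * (D * \<eta>) powr p) * ennreal E"
          by (subst nn_integral_cmult) (auto simp: E(2))
        also have "\<dots> = ennreal (B * D powr p * E * \<eta> powr p)"
          using D \<eta> B E(1) by (simp add: ennreal_mult[symmetric] powr_mult mult_ac)
        finally show ?thesis .
      qed
      have "(\<integral>\<^sup>+y. ennreal (norm ((T2 \<circ> T1) y - y) powr p) \<partial>?\<nu>) \<le>
          (\<integral>\<^sup>+y. ennreal (2 powr p) * (ennreal (norm (T2 (T1 y) - T1 y) powr p) + ennreal (norm (T1 y - y) powr p)) \<partial>?\<nu>)"
      proof (intro nn_integral_mono)
        fix y
        have "norm ((T2 \<circ> T1) y - y) powr p \<le> (norm (T2 (T1 y) - T1 y) + norm (T1 y - y)) powr p"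
          using p norm_triangle_ineq[of "T2 (T1 y) - T1 y" "T1 y - y"] by (intro powr_mono2) auto
        also have "\<dots> \<le> 2 powr p * (norm (T2 (T1 y) - T1 y) powr p + norm (T1 y - y) powr p)"
          using p by (intro powr_add_le) auto
        finally show "ennreal (norm ((T2 \<circ> T1) y - y) powr p) \<le>
            ennreal (2 powr p) * (ennreal (norm (T2 (T1 y) - T1 y) powr p) + ennreal (norm (T1 y - y) powr p))"
          by (simp add: ennreal_mult[symmetric] ennreal_plus[symmetric] ennreal_leI del: ennreal_plus)
      qed
      also have "\<dots> = ennreal (2 powr p) * ((\<integral>\<^sup>+y. ennreal (norm (T2 (T1 y) - T1 y) powr p) \<partial>?\<nu>) +
          (\<integral>\<^sup>+y. ennreal (norm (T1 y - y) powr p) \<partial>?\<nu>))"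
        by (simp add: nn_integral_cmult nn_integral_add)
      also have "\<dots> \<le> ennreal (2 powr p) * (ennreal (C * D powr p * \<eta> powr p) + ennreal (B * D powr p * E * \<eta> powr p))"
        by (intro mult_left_mono add_mono i1 i2) simp
      also have "\<dots> = ennreal (C' * \<eta> powr p)"
        using C B E(1)
        by (simp add: C'_def ennreal_mult[symmetric] ennreal_plus[symmetric] algebra_simps del: ennreal_plus)
      finally show "(\<integral>\<^sup>+y. ennreal (norm ((T2 \<circ> T1) y - y) powr p) \<partial>?\<nu>) \<le> ennreal (C' * \<eta> powr p)" .
    qed
  qed
qed

section \<open>Maximal coupling and total variation\<close>

abbreviation unif01 :: "real measure" where
  "unif01 \<equiv> uniform_measure lborel {0..1}"

lemma prob_space_unif01: "prob_space unif01"
  by (rule prob_space_uniform_measure) simp_all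

text \<open>For \<open>u > 0\<close> the threshold event has probability
  \<open>min 1 (v / u)\<close>. The factor \<open>u\<close> in the statement covers
  \<open>u = 0\<close> without a division.\<close>

lemma emeasure_unif01_threshold:
  assumes "0 \<le> u" "0 \<le> v"
  shows "ennreal u * emeasure unif01 {t. t * u \<le> v} = ennreal (min u v)"
    and "ennreal u * emeasure unif01 {t. \<not> t * u \<le> v} = ennreal (max 0 (u - v))"
proof -
  have "ennreal u * emeasure unif01 {t. t * u \<le> v} = ennreal (min u v) \<and>
      ennreal u * emeasure unif01 {t. \<not> t * u \<le> v} = ennreal (max 0 (u - v))"
  proof (cases "u = 0")
    case False
    then have u: "0 < u" using assms by simp
    define r where "r = min 1 (v / u)"
    have r: "0 \<le> r" "r \<le> 1" using assms u by (auto simp: r_def)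
    have ur: "u * r = min u v" using u by (auto simp: r_def min_def field_simps)
    have "{0..1} \<inter> {t. t * u \<le> v} = {0..r}" "{0..1} \<inter> {t. \<not> t * u \<le> v} = {r<..1}"
      using u divide_nonneg_pos[OF assms(2) u] by (auto simp: r_def pos_le_divide_eq[symmetric])
    then have "emeasure unif01 {t. t * u \<le> v} = ennreal r" "emeasure unif01 {t. \<not> t * u \<le> v} = ennreal (1 - r)"
      using r by (simp_all add: divide_ennreal_def)
    moreover have "u * (1 - r) = max 0 (u - v)" using ur by (simp add: right_diff_distrib min_def max_def)
    ultimately show ?thesis using u r ur by (simp add: ennreal_mult[symmetric])
  qed (use assms in auto)
  then show "ennreal u * emeasure unif01 {t. t * u \<le> v} = ennreal (min u v)"
    "ennreal u * emeasure unif01 {t. \<not> t * u \<le> v} = ennreal (max 0 (u - v))" by auto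
qed

text \<open>Integration over \<open>t\<close>, then \<open>z\<close>, then \<open>x\<close>: the
  mass \<open>min (u x) (v x)\<close> stays at \<open>x\<close>, and the excess of \<open>u\<close>
  over \<open>v\<close> is redistributed by \<open>R\<close>. With \<open>f\<close> and
  \<open>g\<close> general, one computation gives both marginals and the cost of the maximal
  coupling.\<close>

lemma nn_integral_threshold_mixture:
  fixes L :: "'a measure" and u v :: "'a \<Rightarrow> real"
  assumes [measurable]: "u \<in> borel_measurable L" "v \<in> borel_measurable L"
    and nonneg: "\<And>x. 0 \<le> u x" "\<And>x. 0 \<le> v x"
    and R: "prob_space R" and [measurable_cong, simp]: "sets R = sets L"
    and [measurable]: "f \<in> borel_measurable L" "(\<lambda>(x, z). g x z) \<in> borel_measurable (L \<Otimes>\<^sub>M L)"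
  shows "(\<integral>\<^sup>+((x, z), t). (if t * u x \<le> v x then f x else g x z)
      \<partial>((density L (\<lambda>x. ennreal (u x)) \<Otimes>\<^sub>M R) \<Otimes>\<^sub>M unif01)) =
    (\<integral>\<^sup>+x. ennreal (min (u x) (v x)) * f x \<partial>L) +
    (\<integral>\<^sup>+x. ennreal (max 0 (u x - v x)) * (\<integral>\<^sup>+z. g x z \<partial>R) \<partial>L)"
proof -
  interpret R: prob_space R by fact
  interpret U: prob_space unif01 by (rule prob_space_unif01)
  have g[measurable]: "(\<lambda>w. g (fst w) (snd w)) \<in> borel_measurable (L \<Otimes>\<^sub>M L)"
    using assms(8) by (simp only: case_prod_beta')
  define q where "q x = emeasure unif01 {t. t * u x \<le> v x}" for x
  define r where "r x = emeasure unif01 {t. \<not> t * u x \<le> v x}" for x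
  have qr: "ennreal (u x) * q x = ennreal (min (u x) (v x))"
    "ennreal (u x) * r x = ennreal (max 0 (u x - v x))" for x
    unfolding q_def r_def by (rule emeasure_unif01_threshold[OF nonneg])+
  have q_eq: "q x = (\<integral>\<^sup>+t. (if t * u x \<le> v x then 1 else 0) \<partial>unif01)"
    and r_eq: "r x = (\<integral>\<^sup>+t. (if t * u x \<le> v x then 0 else 1) \<partial>unif01)" for x
  proof -
    have "(\<integral>\<^sup>+t. (if t * u x \<le> v x then 1 else 0) \<partial>unif01) = (\<integral>\<^sup>+t. indicator {t. t * u x \<le> v x} t \<partial>unif01)"
      by (intro nn_integral_cong) auto
    also have "\<dots> = q x" unfolding q_def by (rule nn_integral_indicator) simp
    finally show "q x = (\<integral>\<^sup>+t. (if t * u x \<le> v x then 1 else 0) \<partial>unif01)" ..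
    have "(\<integral>\<^sup>+t. (if t * u x \<le> v x then 0 else 1) \<partial>unif01) = (\<integral>\<^sup>+t. indicator {t. \<not> t * u x \<le> v x} t \<partial>unif01)"
      by (intro nn_integral_cong) auto
    also have "\<dots> = r x" unfolding r_def by (rule nn_integral_indicator) simp
    finally show "r x = (\<integral>\<^sup>+t. (if t * u x \<le> v x then 0 else 1) \<partial>unif01)" ..
  qed
  have qm[measurable]: "q \<in> borel_measurable L" and rm[measurable]: "r \<in> borel_measurable L"
    unfolding q_eq r_eq by measurable
  have t: "(\<integral>\<^sup>+t. (if t * u x \<le> v x then a else b) \<partial>unif01) = q x * a + r x * b" for x and a b :: ennreal
  proof -
    have "(\<integral>\<^sup>+t. (if t * u x \<le> v x then a else b) \<partial>unif01) =
        (\<integral>\<^sup>+t. (if t * u x \<le> v x then 1 else 0) * a + (if t * u x \<le> v x then 0 else 1) * b \<partial>unif01)"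
      by (intro nn_integral_cong) auto
    also have "\<dots> = q x * a + r x * b"
      unfolding q_eq r_eq by (subst nn_integral_add) (auto simp: nn_integral_multc)
    finally show ?thesis .
  qed
  have z: "(\<integral>\<^sup>+z. q x * f x + r x * g x z \<partial>R) = q x * f x + r x * (\<integral>\<^sup>+z. g x z \<partial>R)" if "x \<in> space L" for x
  proof -
    have [measurable]: "g x \<in> borel_measurable L"
      using measurable_Pair2[OF assms(8) that] by simp
    show ?thesis by (subst nn_integral_add) (auto simp: nn_integral_cmult R.emeasure_space_1)
  qed
  have "(\<integral>\<^sup>+((x, z), t). (if t * u x \<le> v x then f x else g x z)
      \<partial>((density L (\<lambda>x. ennreal (u x)) \<Otimes>\<^sub>M R) \<Otimes>\<^sub>M unif01)) =
    (\<integral>\<^sup>+w. (\<integral>\<^sup>+t. (if t * u (fst w) \<le> v (fst w) then f (fst w) else g (fst w) (snd w)) \<partial>unif01)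
      \<partial>(density L (\<lambda>x. ennreal (u x)) \<Otimes>\<^sub>M R))"
    by (subst U.nn_integral_fst[symmetric]) (auto simp: case_prod_beta' cong: if_cong)
  also have "\<dots> = (\<integral>\<^sup>+x. \<integral>\<^sup>+z. q x * f x + r x * g x z \<partial>R \<partial>density L (\<lambda>x. ennreal (u x)))"
    unfolding t by (subst R.nn_integral_fst[symmetric]) auto
  also have "\<dots> = (\<integral>\<^sup>+x. q x * f x + r x * (\<integral>\<^sup>+z. g x z \<partial>R) \<partial>density L (\<lambda>x. ennreal (u x)))"
    using z by (intro nn_integral_cong) simp
  also have "\<dots> = (\<integral>\<^sup>+x. ennreal (u x) * (q x * f x + r x * (\<integral>\<^sup>+z. g x z \<partial>R)) \<partial>L)"
    by (subst nn_integral_density) auto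
  also have "\<dots> = (\<integral>\<^sup>+x. ennreal (min (u x) (v x)) * f x + ennreal (max 0 (u x - v x)) * (\<integral>\<^sup>+z. g x z \<partial>R) \<partial>L)"
    by (simp add: distrib_left mult.assoc[symmetric] qr)
  also have "\<dots> = (\<integral>\<^sup>+x. ennreal (min (u x) (v x)) * f x \<partial>L) +
    (\<integral>\<^sup>+x. ennreal (max 0 (u x - v x)) * (\<integral>\<^sup>+z. g x z \<partial>R) \<partial>L)"
    by (rule nn_integral_add) auto
  finally show ?thesis .
qed

text \<open>
  The maximal coupling: \<open>Z\<close> keeps the value \<open>X = x\<close> with probability \<open>min 1 (v x / u x)\<close> and is
  otherwise redrawn from the normalised excess of \<open>v\<close> over \<open>u\<close>.
\<close>

lemma maximal_coupling:
  fixes L :: "'a::{real_normed_vector, second_countable_topology} measure" and u v :: "'a \<Rightarrow> real"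
  assumes sets_L[measurable_cong, simp]: "sets L = sets borel"
    and u[measurable]: "u \<in> borel_measurable borel" and v[measurable]: "v \<in> borel_measurable borel"
    and nonneg: "\<And>x. 0 \<le> u x" "\<And>x. 0 \<le> v x"
    and \<mu>: "prob_space (density L (\<lambda>x. ennreal (u x)))" and \<nu>: "prob_space (density L (\<lambda>x. ennreal (v x)))"
    and p: "0 \<le> p"
  shows "\<exists>(\<Omega> :: (('a \<times> 'a) \<times> real) measure) X Z. prob_space \<Omega> \<and>
    X \<in> borel_measurable \<Omega> \<and> Z \<in> borel_measurable \<Omega> \<and>
    distr \<Omega> borel X = density L (\<lambda>x. ennreal (u x)) \<and> distr \<Omega> borel Z = density L (\<lambda>x. ennreal (v x)) \<and>
    (\<integral>\<^sup>+\<omega>. ennreal (norm (X \<omega> - Z \<omega>) powr p) \<partial>\<Omega>) \<le>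
      ennreal (2 powr p) * (\<integral>\<^sup>+x. ennreal (\<bar>u x - v x\<bar> * norm x powr p) \<partial>L)"
proof -
  let ?\<mu> = "density L (\<lambda>x. ennreal (u x))" and ?\<nu> = "density L (\<lambda>x. ennreal (v x))"
  interpret \<mu>: prob_space ?\<mu> by fact
  interpret \<nu>: prob_space ?\<nu> by fact
  have space_L[simp]: "space L = UNIV" using sets_eq_imp_space_eq[OF sets_L] by simp
  have nn_u: "(\<integral>\<^sup>+x. ennreal (u x) \<partial>L) = 1"
    using \<mu>.emeasure_space_1 by (simp add: emeasure_density)
  have nn_v: "(\<integral>\<^sup>+x. ennreal (v x) \<partial>L) = 1"
    using \<nu>.emeasure_space_1 by (simp add: emeasure_density)
  define m where "m = (\<integral>\<^sup>+x. ennreal (max 0 (v x - u x)) \<partial>L)"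
  define m' where "m' = (\<integral>\<^sup>+x. ennreal (max 0 (u x - v x)) \<partial>L)"
  define c where "c = (\<integral>\<^sup>+x. ennreal (min (u x) (v x)) \<partial>L)"
  \<comment> \<open>The common mass together with the excess of either side makes 1, so the two
    excesses have the same mass.\<close>
  have cm: "c + m' = 1" "c + m = 1"
    unfolding c_def m_def m'_def using nonneg
    by (subst nn_integral_add[symmetric], simp, simp, subst nn_u[symmetric] nn_v[symmetric],
        auto intro!: nn_integral_cong simp: ennreal_plus[symmetric] max_def min_def simp del: ennreal_plus)+
  have "c \<noteq> \<top>" using cm(1) by auto
  then have mm: "m' = m" using cm by (metis ennreal_add_left_cancel infinity_ennreal_def)
  then have mm': "(\<integral>\<^sup>+x. ennreal (u x - v x) \<partial>L) = m" by (simp add: m'_def)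
  have m_fin: "m \<noteq> \<top>" using cm(2) by auto
  \<comment> \<open>If \<open>m = 0\<close> the excess cannot be normalised; \<open>\<nu>\<close>
    then stands in as some probability measure, and it enters with weight 0.\<close>
  define R where "R = (if m = 0 then ?\<nu> else density L (\<lambda>x. ennreal (max 0 (v x - u x)) / m))"
  have sets_R[measurable_cong, simp]: "sets R = sets borel" by (simp add: R_def)
  have R: "prob_space R"
  proof (cases "m = 0")
    case False
    show ?thesis
    proof
      have "emeasure R (space R) = (\<integral>\<^sup>+x. ennreal (max 0 (v x - u x)) / m \<partial>L)"
        using False by (simp add: R_def emeasure_density)
      also have "\<dots> = m / m" unfolding m_def by (rule nn_integral_divide) simp
      also have "\<dots> = 1" using False m_fin by (intro ennreal_divide_self) (auto simp: less_top)
      finally show "emeasure R (space R) = 1" .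
    qed
  qed (simp add: R_def \<nu>)
  interpret R: prob_space R by fact
  have R_int: "m * (\<integral>\<^sup>+x. f x \<partial>R) = (\<integral>\<^sup>+x. ennreal (max 0 (v x - u x)) * f x \<partial>L)"
    if f[measurable]: "f \<in> borel_measurable borel" for f
  proof (cases "m = 0")
    case True
    then have "AE x in L. ennreal (max 0 (v x - u x)) = 0"
      unfolding m_def by (subst (asm) nn_integral_0_iff_AE) auto
    then have "(\<integral>\<^sup>+x. ennreal (max 0 (v x - u x)) * f x \<partial>L) = 0"
      by (subst nn_integral_0_iff_AE) auto
    then show ?thesis using True by simp
  next
    case False
    have "m * (\<integral>\<^sup>+x. f x \<partial>R) = (\<integral>\<^sup>+x. m * (ennreal (max 0 (v x - u x)) / m * f x) \<partial>L)"
      using False by (simp add: R_def nn_integral_density nn_integral_cmult)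
    also have "\<dots> = (\<integral>\<^sup>+x. ennreal (max 0 (v x - u x)) * f x \<partial>L)"
    proof (intro nn_integral_cong)
      fix x
      have "m * (ennreal (max 0 (v x - u x)) / m) = ennreal (max 0 (v x - u x))"
        using False m_fin by (subst ennreal_times_divide, subst mult.commute) (rule ennreal_mult_divide_eq)
      then show "m * (ennreal (max 0 (v x - u x)) / m * f x) = ennreal (max 0 (v x - u x)) * f x"
        by (simp add: mult.assoc[symmetric])
    qed
    finally show ?thesis .
  qed
  define \<Omega> where "\<Omega> = (?\<mu> \<Otimes>\<^sub>M R) \<Otimes>\<^sub>M unif01"
  define X :: "('a \<times> 'a) \<times> real \<Rightarrow> 'a" where "X \<omega> = fst (fst \<omega>)" for \<omega>
  define Z :: "('a \<times> 'a) \<times> real \<Rightarrow> 'a" where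
    "Z \<omega> = (if snd \<omega> * u (fst (fst \<omega>)) \<le> v (fst (fst \<omega>)) then fst (fst \<omega>) else snd (fst \<omega>))" for \<omega>
  interpret U: prob_space unif01 by (rule prob_space_unif01)
  interpret \<mu>R: pair_prob_space ?\<mu> R ..
  interpret \<Omega>: pair_prob_space "?\<mu> \<Otimes>\<^sub>M R" unif01 ..
  have meas[measurable]: "X \<in> borel_measurable \<Omega>" "Z \<in> borel_measurable \<Omega>"
    unfolding X_def Z_def \<Omega>_def by measurable
  have mix: "(\<integral>\<^sup>+((x, z), t). (if t * u x \<le> v x then f x else g x z) \<partial>\<Omega>) =
    (\<integral>\<^sup>+x. ennreal (min (u x) (v x)) * f x \<partial>L) +
    (\<integral>\<^sup>+x. ennreal (max 0 (u x - v x)) * (\<integral>\<^sup>+z. g x z \<partial>R) \<partial>L)"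
    if "f \<in> borel_measurable borel" "(\<lambda>(x, z). g x z) \<in> borel_measurable (borel \<Otimes>\<^sub>M borel)" for f g
    unfolding \<Omega>_def using that
    by (intro nn_integral_threshold_mixture nonneg R)
      (simp_all cong: measurable_cong_sets sets_pair_measure_cong)
  let ?N = "\<lambda>x :: 'a. ennreal (norm x powr p)"
  have "prob_space \<Omega>" unfolding \<Omega>_def by unfold_locales
  moreover have "distr \<Omega> borel X = ?\<mu>"
  proof (rule measure_eqI)
    fix A assume "A \<in> sets (distr \<Omega> borel X)"
    then have A[measurable]: "A \<in> sets borel" by simp
    have "emeasure (distr \<Omega> borel X) A = (\<integral>\<^sup>+\<omega>. indicator A (X \<omega>) \<partial>\<Omega>)"
      by (subst nn_integral_indicator[symmetric], simp) (subst nn_integral_distr, auto)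
    also have "\<dots> = (\<integral>\<^sup>+((x, z), t). (if t * u x \<le> v x then indicator A x else indicator A x) \<partial>\<Omega>)"
      by (simp add: X_def case_prod_beta')
    also have "\<dots> = (\<integral>\<^sup>+x. ennreal (min (u x) (v x)) * indicator A x \<partial>L) +
        (\<integral>\<^sup>+x. ennreal (max 0 (u x - v x)) * indicator A x \<partial>L)"
      by (subst mix) (auto simp: R.emeasure_space_1)
    also have "\<dots> = (\<integral>\<^sup>+x. ennreal (u x) * indicator A x \<partial>L)"
      using nonneg
      by (subst nn_integral_add[symmetric])
        (auto intro!: nn_integral_cong simp: indicator_def ennreal_plus[symmetric] max_def min_def simp del: ennreal_plus)
    finally show "emeasure (distr \<Omega> borel X) A = emeasure ?\<mu> A" by (simp add: emeasure_density)
  qed simp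
  moreover have "distr \<Omega> borel Z = ?\<nu>"
  proof (rule measure_eqI)
    fix A assume "A \<in> sets (distr \<Omega> borel Z)"
    then have A[measurable]: "A \<in> sets borel" by simp
    have "emeasure (distr \<Omega> borel Z) A = (\<integral>\<^sup>+\<omega>. indicator A (Z \<omega>) \<partial>\<Omega>)"
      by (subst nn_integral_indicator[symmetric], simp) (subst nn_integral_distr, auto)
    also have "\<dots> = (\<integral>\<^sup>+((x, z), t). (if t * u x \<le> v x then indicator A x else indicator A z) \<partial>\<Omega>)"
      by (simp add: Z_def case_prod_beta' if_distrib)
    also have "\<dots> = (\<integral>\<^sup>+x. ennreal (min (u x) (v x)) * indicator A x \<partial>L) + m * (\<integral>\<^sup>+z. indicator A z \<partial>R)"
      by (subst mix) (auto simp: nn_integral_multc mm')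
    also have "\<dots> = (\<integral>\<^sup>+x. ennreal (v x) * indicator A x \<partial>L)"
      using nonneg
      by (subst R_int, simp, subst nn_integral_add[symmetric])
        (auto intro!: nn_integral_cong simp: indicator_def ennreal_plus[symmetric] max_def min_def simp del: ennreal_plus)
    finally show "emeasure (distr \<Omega> borel Z) A = emeasure ?\<nu> A" by (simp add: emeasure_density)
  qed simp
  \<comment> \<open>Kept points cost nothing. For a redrawn point, \<open>norm x\<close> is
    integrated against the excess of \<open>u\<close> and \<open>norm z\<close>, by
    \<open>R_int\<close>, against the excess of \<open>v\<close>; the two excesses add up to the
    absolute difference of the densities.\<close>
  moreover have "(\<integral>\<^sup>+\<omega>. ennreal (norm (X \<omega> - Z \<omega>) powr p) \<partial>\<Omega>) \<le>
      ennreal (2 powr p) * (\<integral>\<^sup>+x. ennreal (\<bar>u x - v x\<bar> * norm x powr p) \<partial>L)"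
  proof -
    have "(\<integral>\<^sup>+\<omega>. ennreal (norm (X \<omega> - Z \<omega>) powr p) \<partial>\<Omega>) \<le>
      (\<integral>\<^sup>+((x, z), t). (if t * u x \<le> v x then 0 else ennreal (2 powr p) * (?N x + ?N z)) \<partial>\<Omega>)"
    proof (intro nn_integral_mono)
      fix \<omega> :: "('a \<times> 'a) \<times> real"
      obtain x z t where \<omega>: "\<omega> = ((x, z), t)" by (metis surj_pair)
      have "norm (x - z) powr p \<le> (norm x + norm z) powr p"
        using p norm_triangle_ineq4[of x z] by (intro powr_mono2) auto
      also have "\<dots> \<le> 2 powr p * (norm x powr p + norm z powr p)"
        using p by (intro powr_add_le) auto
      finally have "ennreal (norm (x - z) powr p) \<le> ennreal (2 powr p) * (?N x + ?N z)"
        by (simp add: ennreal_mult[symmetric] ennreal_plus[symmetric] ennreal_leI del: ennreal_plus)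
      then show "ennreal (norm (X \<omega> - Z \<omega>) powr p) \<le>
          (\<lambda>((x, z), t). if t * u x \<le> v x then 0 else ennreal (2 powr p) * (?N x + ?N z)) \<omega>"
        by (simp add: X_def Z_def \<omega>)
    qed
    also have "\<dots> = (\<integral>\<^sup>+x. ennreal (max 0 (u x - v x)) * (ennreal (2 powr p) * (?N x + (\<integral>\<^sup>+z. ?N z \<partial>R))) \<partial>L)"
      by (subst mix) (auto simp: nn_integral_cmult nn_integral_add R.emeasure_space_1)
    also have "\<dots> = (\<integral>\<^sup>+x. ennreal (2 powr p) * (ennreal (max 0 (u x - v x)) * ?N x) +
        ennreal (2 powr p) * (ennreal (max 0 (u x - v x)) * (\<integral>\<^sup>+z. ?N z \<partial>R)) \<partial>L)"
      by (intro nn_integral_cong) (simp add: distrib_left mult_ac)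
    also have "\<dots> = ennreal (2 powr p) * (\<integral>\<^sup>+x. ennreal (max 0 (u x - v x)) * ?N x \<partial>L) +
        ennreal (2 powr p) * (m * (\<integral>\<^sup>+z. ?N z \<partial>R))"
      by (simp add: nn_integral_add nn_integral_cmult nn_integral_multc mm')
    also have "\<dots> = ennreal (2 powr p) * ((\<integral>\<^sup>+x. ennreal (max 0 (u x - v x)) * ?N x \<partial>L) +
        (\<integral>\<^sup>+x. ennreal (max 0 (v x - u x)) * ?N x \<partial>L))"
      by (simp add: R_int distrib_left)
    also have "(\<integral>\<^sup>+x. ennreal (max 0 (u x - v x)) * ?N x \<partial>L) + (\<integral>\<^sup>+x. ennreal (max 0 (v x - u x)) * ?N x \<partial>L) =
        (\<integral>\<^sup>+x. ennreal (\<bar>u x - v x\<bar> * norm x powr p) \<partial>L)"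
      by (subst nn_integral_add[symmetric])
        (auto intro!: nn_integral_cong simp: max_def ennreal_mult[symmetric] abs_if)
    finally show ?thesis .
  qed
  ultimately show ?thesis using meas by blast
qed

text \<open>In the application the given law need not have a Lebesgue density, so both laws are put
  over a common measure. \<open>sup_measure'\<close> dominates each of them and its total mass is at
  most the sum of theirs; hence it is finite and Radon-Nikodym applies.\<close>

lemma exists_common_density:
  fixes \<mu> \<nu> :: "'a measure"
  assumes "finite_measure \<mu>" "finite_measure \<nu>" and sets[simp]: "sets \<nu> = sets \<mu>"
  obtains L u v where "sets L = sets \<mu>"
    "u \<in> borel_measurable \<mu>" "v \<in> borel_measurable \<mu>"
    "\<And>x. 0 \<le> u x" "\<And>x. 0 \<le> (v x :: real)"
    "\<mu> = density L (\<lambda>x. ennreal (u x))" "\<nu> = density L (\<lambda>x. ennreal (v x))"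
proof -
  interpret \<mu>: finite_measure \<mu> by fact
  interpret \<nu>: finite_measure \<nu> by fact
  define L where "L = sup_measure' \<mu> \<nu>"
  have sets_L[simp]: "sets L = sets \<mu>" by (simp add: L_def)
  have "emeasure L (space L) \<le> emeasure \<mu> (space \<mu>) + emeasure \<nu> (space \<nu>)"
    unfolding L_def by (subst emeasure_sup_measure')
      (auto intro!: SUP_least add_mono emeasure_mono simp: sets_eq_imp_space_eq[OF sets] dest: sets.sets_into_space)
  then have "finite_measure L"
    using \<mu>.emeasure_finite \<nu>.emeasure_finite
    by (intro finite_measureI) (metis ennreal_add_eq_top infinity_ennreal_def top.extremum_uniqueI)
  then interpret L: finite_measure L .
  have le: "emeasure \<mu> A \<le> emeasure L A" "emeasure \<nu> A \<le> emeasure L A" if "A \<in> sets \<mu>" for A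
    using that unfolding L_def by (auto intro: le_emeasure_sup_measure'1 le_emeasure_sup_measure'2)
  have "A \<in> null_sets \<mu> \<and> A \<in> null_sets \<nu>" if A: "A \<in> null_sets L" for A
  proof -
    have "A \<in> sets \<mu>" "emeasure L A = 0" using null_setsD2[OF A] null_setsD1[OF A] by simp_all
    then show ?thesis using le[of A] by (intro conjI null_setsI) simp_all
  qed
  then have ac: "absolutely_continuous L \<mu>" "absolutely_continuous L \<nu>"
    unfolding absolutely_continuous_def by blast+
  have "\<exists>u. u \<in> borel_measurable L \<and> (\<forall>x. 0 \<le> u x) \<and> N = density L (\<lambda>x. ennreal (u x))"
    if N: "finite_measure N" "absolutely_continuous L N" "sets N = sets L" for N
  proof -
    obtain D where D: "D \<in> borel_measurable L" "AE x in L. RN_deriv L N x = ennreal (D x)"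
      "AE x in N. 0 < D x" "\<And>x. 0 \<le> D x"
      by (rule L.real_RN_deriv[OF N], rule that) assumption+
    have "N = density L (RN_deriv L N)" using L.density_RN_deriv[OF N(2,3)] by simp
    also have "\<dots> = density L (\<lambda>x. ennreal (D x))"
      using D by (intro density_cong) auto
    finally show ?thesis using D by blast
  qed
  note RN = this
  obtain u where u: "u \<in> borel_measurable L" "\<forall>x. 0 \<le> u x" "\<mu> = density L (\<lambda>x. ennreal (u x))"
    using RN[OF assms(1) ac(1)] by auto
  obtain v where v: "v \<in> borel_measurable L" "\<forall>x. 0 \<le> v x" "\<nu> = density L (\<lambda>x. ennreal (v x))"
    using RN[OF assms(2) ac(2)] by auto
  show ?thesis
  proof (rule that[of L u v])
    show "u \<in> borel_measurable \<mu>" "v \<in> borel_measurable \<mu>"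
      using u(1) v(1) measurable_cong_sets[OF sets_L refl, of borel] by blast+
    show "sets L = sets \<mu>" by (rule sets_L)
    show "0 \<le> u x" "0 \<le> v x" for x using u(2) v(2) by blast+
  qed (fact u(3) v(3))+
qed

text \<open>The total variation measure is built from the values of \<open>\<sigma>\<close> on
  measurable sets alone. The base measure may therefore be exchanged for one over which
  \<open>\<sigma>\<close> has a density.\<close>

lemma total_variation_eq_density:
  assumes f: "integrable M f" and sets: "sets N = sets M"
    and \<sigma>: "\<And>A. A \<in> sets M \<Longrightarrow> \<sigma> A = signed_density M f A"
  shows "total_variation N \<sigma> = density M (\<lambda>y. ennreal \<bar>f y\<bar>)"
proof -
  have "total_variation_on N \<sigma> = total_variation_on M (signed_density M f)"
    unfolding fun_eq_iff total_variation_on_def sets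
    using \<sigma> by (intro allI SUP_cong sum.cong refl) auto
  then have "total_variation N \<sigma> = total_variation M (signed_density M f)"
    unfolding total_variation_def using sets sets_eq_imp_space_eq[OF sets] by simp
  also have "\<dots> = density M (\<lambda>y. ennreal \<bar>f y\<bar>)"
  proof (rule measure_eqI)
    show s: "sets (total_variation M (signed_density M f)) = sets (density M (\<lambda>y. ennreal \<bar>f y\<bar>))"
      by (simp add: total_variation_def sets.space_closed)
    fix A assume "A \<in> sets (total_variation M (signed_density M f))"
    then have A: "A \<in> sets M" using s by simp
    have [measurable]: "f \<in> borel_measurable M" using f by auto
    show "emeasure (total_variation M (signed_density M f)) A = emeasure (density M (\<lambda>y. ennreal \<bar>f y\<bar>)) A"
      using A by (simp add: total_variation_signed_density[OF f A] emeasure_density)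
  qed
  finally show ?thesis .
qed

section \<open>Perturbed Gaussian densities\<close>

text \<open>From \<open>1 + x <= exp x\<close> and the completed square behind
  \<open>q * x <= q^2 / (4 * a) + a * x^2\<close>. Any power weight is thus absorbed by an
  arbitrarily small Gaussian exponent.\<close>

lemma powr_one_plus_le_exp:
  fixes a x q :: real
  assumes "0 < a" "0 \<le> x" "0 \<le> q"
  shows "(1 + x) powr q \<le> exp (q\<^sup>2 / (4 * a)) * exp (a * x\<^sup>2)"
proof -
  have "(1 + x) powr q \<le> exp x powr q"
    using assms by (intro powr_mono2) (auto simp: add.commute)
  also have "\<dots> = exp (q * x)" by (simp add: powr_def)
  also have "q * x \<le> q\<^sup>2 / (4 * a) + a * x\<^sup>2"
  proof -
    have "0 \<le> (q - 2 * a * x)\<^sup>2 / (4 * a)" using assms by simp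
    then show ?thesis using assms(1) by (simp add: power2_eq_square field_simps)
  qed
  finally show ?thesis by (simp add: exp_add)
qed

lemma integrable_gauss_norm_powr:
  assumes "0 \<le> q"
  shows "integrable (gauss_measure :: (real^'d::finite) measure) (\<lambda>y. (1 + norm y) powr q)"
proof (rule Bochner_Integration.integrable_bound)
  show "integrable (gauss_measure :: (real^'d) measure) (\<lambda>y. exp (q\<^sup>2) * exp (1 / 4 * (norm y)\<^sup>2))"
    using nn_integral_gauss_exp_finite[of "1 / 4", where 'd='d]
    by (intro integrable_mult_right integrableI_bounded) auto
  show "AE y in (gauss_measure :: (real^'d) measure). norm ((1 + norm y) powr q) \<le> norm (exp (q\<^sup>2) * exp (1 / 4 * (norm y)\<^sup>2))"
    using powr_one_plus_le_exp[of "1 / 4" _ q] assms by (intro AE_I2) simp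
qed simp

definition clip :: "real \<Rightarrow> real" where
  "clip x = max (- 1 / 2) (min (1 / 2) x)"

lemma abs_clip_le: "\<bar>clip x\<bar> \<le> \<bar>x\<bar>" "\<bar>clip x\<bar> \<le> 1 / 2"
  by (auto simp: clip_def)

text \<open>The difference vanishes unless \<open>2 * \<bar>x\<bar> > 1\<close>, and then any power
  of \<open>2 * \<bar>x\<bar>\<close> may be inserted for free. A truncation error of order
  \<open>\<eta>\<close> thereby becomes one of order \<open>\<eta> ^ (n + 1)\<close>.\<close>

lemma abs_diff_clip_le: "\<bar>x - clip x\<bar> \<le> \<bar>x\<bar> * (2 * \<bar>x\<bar>) ^ n"
proof (cases "\<bar>x\<bar> \<le> 1 / 2")
  case True
  then have "clip x = x" by (auto simp: clip_def)
  then show ?thesis by simp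
next
  case False
  then have "\<bar>x - clip x\<bar> \<le> \<bar>x\<bar> * 1" by (auto simp: clip_def)
  also have "\<dots> \<le> \<bar>x\<bar> * (2 * \<bar>x\<bar>) ^ n"
    using False by (intro mult_left_mono one_le_power) auto
  finally show ?thesis .
qed

lemma borel_measurable_clip [measurable]: "clip \<in> borel_measurable borel"
  unfolding clip_def by measurable

text \<open>\<open>1 + h'\<close> is the clipped density \<open>1 + g\<close> divided by its mass
  \<open>m\<close>. Both lie between \<open>1 / 2\<close> and \<open>3 / 2\<close>, whence the
  bounds \<open>1 / 3\<close> and 3. The defect \<open>m - 1\<close> is estimated twice: by a
  multiple of \<open>\<eta>\<close> for the pointwise bound, and by the integral of \<open>h\<close>
  plus the clipping error for the weighted distance.\<close>

lemma gauss_clip_normalise: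
  assumes p: "0 \<le> p" and K: "0 \<le> K" and a: "0 < a"
  shows "\<exists>K'>0. \<forall>(h :: real^'d::finite \<Rightarrow> real) \<eta>. h \<in> borel_measurable borel \<longrightarrow> 0 \<le> \<eta> \<longrightarrow>
    (\<forall>y. \<bar>h y\<bar> \<le> K * \<eta> * (1 + norm y) ^ s) \<longrightarrow>
    (\<exists>h'. h' \<in> borel_measurable borel \<and> (\<forall>y. 1 / 3 \<le> 1 + h' y \<and> 1 + h' y \<le> 3) \<and>
      prob_space (density gauss_measure (\<lambda>y. ennreal (1 + h' y))) \<and>
      (\<forall>y. \<bar>h' y\<bar> \<le> K' * \<eta> * exp (a * (norm y)\<^sup>2)) \<and>
      (\<integral>\<^sup>+y. ennreal (\<bar>h y - h' y\<bar> * (1 + norm y) powr p) \<partial>gauss_measure) \<le>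
        ennreal (K' * (\<bar>\<integral>y. h y \<partial>gauss_measure\<bar> + \<eta> ^ (n + 1))))"
proof -
  let ?\<gamma> = "gauss_measure :: (real^'d) measure"
  define E where "E q = (\<integral>y. (1 + norm y) powr q \<partial>?\<gamma>)" for q
  have E0: "0 \<le> E q" for q by (simp add: E_def)
  have pw: "(1 + norm y) ^ k = (1 + norm y) powr real k" for y :: "real^'d" and k
    by (subst powr_realpow) (auto simp: add_pos_nonneg)
  have one_le: "1 \<le> (1 + norm y) powr q" if "0 \<le> q" for y :: "real^'d" and q
    using that by (intro ge_one_powr_ge_zero) auto
  \<comment> \<open>The weight exponent \<open>p\<close> plus the degree of the bound for
    \<open>h ^ (n + 1)\<close>.\<close>
  define r where "r = p + real (s * (n + 1))"
  define K2 where "K2 = 2 ^ n * K ^ (n + 1) * E r"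
  define c where "c = exp ((real s)\<^sup>2 / (4 * a))"
  \<comment> \<open>\<open>c\<close> is the price of exchanging the polynomial weight for the
    exponential one and \<open>E s\<close> comes from the defect \<open>m - 1\<close>; the last
    summand serves the weighted distance.\<close>
  define K' where "K' = 1 + K * (c + 3 * E s) + (1 + 3 * E p) * (1 + K2)"
  have K2: "0 \<le> K2" using K E0 by (simp add: K2_def)
  have K'1: "K * (c + 3 * E s) \<le> K'" "(1 + 3 * E p) * (1 + K2) \<le> K'" "0 < K'"
    using K E0 K2 by (simp_all add: K'_def c_def add_pos_nonneg)
  show ?thesis
  proof (intro exI[of _ K'] conjI allI impI)
    show "0 < K'" by fact
    fix h :: "real^'d \<Rightarrow> real" and \<eta> :: real
    assume h[measurable]: "h \<in> borel_measurable borel" and \<eta>: "0 \<le> \<eta>"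
      and hK: "\<forall>y. \<bar>h y\<bar> \<le> K * \<eta> * (1 + norm y) ^ s"
    define g where "g y = clip (h y)" for y
    have g[measurable]: "g \<in> borel_measurable borel" unfolding g_def by measurable
    have g_half: "\<bar>g y\<bar> \<le> 1 / 2" and g_h: "\<bar>g y\<bar> \<le> \<bar>h y\<bar>" for y
      unfolding g_def by (rule abs_clip_le)+
    have int_g: "integrable ?\<gamma> g"
      using g_half by (intro gauss.integrable_const_bound[where B="1 / 2"]) auto
    have int_h: "integrable ?\<gamma> h"
    proof (rule Bochner_Integration.integrable_bound)
      show "integrable ?\<gamma> (\<lambda>y. K * \<eta> * (1 + norm y) powr real s)"
        by (intro integrable_mult_right integrable_gauss_norm_powr) simp
      show "AE y in ?\<gamma>. norm (h y) \<le> norm (K * \<eta> * (1 + norm y) powr real s)"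
        using hK K \<eta> by (intro AE_I2) (simp add: pw)
    qed simp
    have diff: "\<bar>h y - g y\<bar> * (1 + norm y) powr p \<le> 2 ^ n * K ^ (n + 1) * \<eta> ^ (n + 1) * (1 + norm y) powr r" for y
    proof -
      have "\<bar>h y - g y\<bar> \<le> \<bar>h y\<bar> * (2 * \<bar>h y\<bar>) ^ n" unfolding g_def by (rule abs_diff_clip_le)
      also have "\<dots> = 2 ^ n * \<bar>h y\<bar> ^ (n + 1)" by (simp add: power_mult_distrib)
      also have "\<dots> \<le> 2 ^ n * (K * \<eta> * (1 + norm y) ^ s) ^ (n + 1)"
        using hK by (intro mult_left_mono power_mono) auto
      also have "\<dots> = 2 ^ n * K ^ (n + 1) * \<eta> ^ (n + 1) * (1 + norm y) powr real (s * (n + 1))"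
        unfolding pw[symmetric] power_mult_distrib power_mult by simp
      finally have "\<bar>h y - g y\<bar> * (1 + norm y) powr p \<le>
          2 ^ n * K ^ (n + 1) * \<eta> ^ (n + 1) * (1 + norm y) powr real (s * (n + 1)) * (1 + norm y) powr p"
        by (intro mult_right_mono) auto
      then show ?thesis by (simp add: r_def powr_add mult_ac)
    qed
    have int_r: "integrable ?\<gamma> (\<lambda>y. 2 ^ n * K ^ (n + 1) * \<eta> ^ (n + 1) * (1 + norm y) powr r)"
      using p by (intro integrable_mult_right integrable_gauss_norm_powr) (simp add: r_def)
    have int_diff: "integrable ?\<gamma> (\<lambda>y. \<bar>h y - g y\<bar> * (1 + norm y) powr p)"
      by (rule Bochner_Integration.integrable_bound[OF int_r])
        (use diff K \<eta> in \<open>auto simp: abs_mult intro!: AE_I2\<close>)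
    have diff_int: "(\<integral>y. \<bar>h y - g y\<bar> * (1 + norm y) powr p \<partial>?\<gamma>) \<le> K2 * \<eta> ^ (n + 1)"
    proof -
      have "(\<integral>y. \<bar>h y - g y\<bar> * (1 + norm y) powr p \<partial>?\<gamma>) \<le>
          (\<integral>y. 2 ^ n * K ^ (n + 1) * \<eta> ^ (n + 1) * (1 + norm y) powr r \<partial>?\<gamma>)"
        by (intro integral_mono int_diff int_r diff)
      then show ?thesis by (simp add: K2_def E_def mult_ac)
    qed
    define m where "m = 1 + (\<integral>y. g y \<partial>?\<gamma>)"
    have m_half: "\<bar>m - 1\<bar> \<le> 1 / 2"
    proof -
      have "\<bar>m - 1\<bar> \<le> (\<integral>y. \<bar>g y\<bar> \<partial>?\<gamma>)" unfolding m_def by (simp add: integral_abs_bound)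
      also have "\<dots> \<le> 1 / 2"
        using g_half int_g by (intro gauss.integral_le_const) auto
      finally show ?thesis .
    qed
    then have m: "1 / 2 \<le> m" "m \<le> 3 / 2" by linarith+
    have m_\<eta>: "\<bar>m - 1\<bar> \<le> K * \<eta> * E s"
    proof -
      have "\<bar>m - 1\<bar> \<le> (\<integral>y. \<bar>g y\<bar> \<partial>?\<gamma>)" unfolding m_def by (simp add: integral_abs_bound)
      also have "\<dots> \<le> (\<integral>y. K * \<eta> * (1 + norm y) powr real s \<partial>?\<gamma>)"
        using int_g hK g_h
        by (intro integral_mono integrable_mult_right integrable_gauss_norm_powr)
          (auto simp: pw intro: order_trans)
      finally show ?thesis by (simp add: E_def)
    qed
    \<comment> \<open>The mass defect of \<open>g\<close> equals that of \<open>h\<close> up to the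
      clipping error; this is how the integral of \<open>h\<close> gets into the conclusion.\<close>
    have m_h: "\<bar>m - 1\<bar> \<le> \<bar>\<integral>y. h y \<partial>?\<gamma>\<bar> + K2 * \<eta> ^ (n + 1)"
    proof -
      have "(\<integral>y. h y \<partial>?\<gamma>) - (\<integral>y. g y \<partial>?\<gamma>) = (\<integral>y. h y - g y \<partial>?\<gamma>)"
        using int_h int_g by simp
      then have "\<bar>(\<integral>y. h y \<partial>?\<gamma>) - (\<integral>y. g y \<partial>?\<gamma>)\<bar> \<le> (\<integral>y. \<bar>h y - g y\<bar> \<partial>?\<gamma>)"
        by (simp add: integral_abs_bound)
      also have "\<dots> \<le> (\<integral>y. \<bar>h y - g y\<bar> * (1 + norm y) powr p \<partial>?\<gamma>)"
      proof (intro integral_mono int_diff)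
        show "integrable ?\<gamma> (\<lambda>y. \<bar>h y - g y\<bar>)" using int_h int_g by simp
        show "\<bar>h y - g y\<bar> \<le> \<bar>h y - g y\<bar> * (1 + norm y) powr p" for y
          using mult_left_mono[OF one_le[OF p, of y], of "\<bar>h y - g y\<bar>"] by simp
      qed
      finally show ?thesis using diff_int unfolding m_def by linarith
    qed
    define h' where "h' y = (1 + g y) / m - 1" for y
    have h'[measurable]: "h' \<in> borel_measurable borel" unfolding h'_def by measurable
    \<comment> \<open>The 3 is the upper bound \<open>3 / 2\<close> for \<open>1 + g y\<close>
      divided by the lower bound \<open>1 / 2\<close> for \<open>m\<close>.\<close>
    have h'_g: "\<bar>g y - h' y\<bar> \<le> 3 * \<bar>m - 1\<bar>" for y
    proof -
      have "g y - h' y = (1 + g y) * (m - 1) / m" using m by (simp add: h'_def field_simps)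
      then have "\<bar>g y - h' y\<bar> = \<bar>1 + g y\<bar> * \<bar>m - 1\<bar> / m" using m by (simp add: abs_mult)
      also have "\<dots> \<le> (3 / 2 * \<bar>m - 1\<bar>) / (1 / 2)"
        using m g_half[of y] by (intro frac_le mult_right_mono) (auto simp: abs_le_iff)
      finally show ?thesis by simp
    qed
    show "\<exists>h'. h' \<in> borel_measurable borel \<and> (\<forall>y. 1 / 3 \<le> 1 + h' y \<and> 1 + h' y \<le> 3) \<and>
      prob_space (density gauss_measure (\<lambda>y. ennreal (1 + h' y))) \<and>
      (\<forall>y. \<bar>h' y\<bar> \<le> K' * \<eta> * exp (a * (norm y)\<^sup>2)) \<and>
      (\<integral>\<^sup>+y. ennreal (\<bar>h y - h' y\<bar> * (1 + norm y) powr p) \<partial>gauss_measure) \<le>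
        ennreal (K' * (\<bar>\<integral>y. h y \<partial>gauss_measure\<bar> + \<eta> ^ (n + 1)))"
    proof (intro exI[of _ h'] conjI allI)
      show "h' \<in> borel_measurable borel" by fact
      have gb: "1 / 2 \<le> 1 + g y" "1 + g y \<le> 3 / 2" for y
        using g_half[of y] by (auto simp: abs_le_iff)
      show lo: "1 / 3 \<le> 1 + h' y" for y
        using gb[of y] m by (simp add: h'_def field_simps)
      show "1 + h' y \<le> 3" for y
        using gb[of y] m by (simp add: h'_def field_simps)
      show "prob_space (density gauss_measure (\<lambda>y. ennreal (1 + h' y)))"
      proof
        have int: "integrable ?\<gamma> (\<lambda>y. 1 + h' y)" using int_g by (simp add: h'_def)
        have "(\<integral>y. 1 + h' y \<partial>?\<gamma>) = (\<integral>y. 1 + g y \<partial>?\<gamma>) / m" by (simp add: h'_def)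
        also have "(\<integral>y. 1 + g y \<partial>?\<gamma>) = m"
          using int_g gauss.prob_space[where 'd='d] by (simp add: m_def)
        finally have "(\<integral>y. 1 + h' y \<partial>?\<gamma>) = 1" using m by simp
        moreover have "0 \<le> 1 + h' y" for y using lo[of y] by simp
        ultimately show "emeasure (density gauss_measure (\<lambda>y. ennreal (1 + h' y)))
          (space (density gauss_measure (\<lambda>y::real^'d. ennreal (1 + h' y)))) = 1"
          using nn_integral_eq_integral[OF int] by (simp add: emeasure_density)
      qed
      show "\<bar>h' y\<bar> \<le> K' * \<eta> * exp (a * (norm y)\<^sup>2)" for y
      proof -
        have 1: "1 \<le> exp (a * (norm y)\<^sup>2)" using a by simp
        have "\<bar>h' y\<bar> \<le> \<bar>g y\<bar> + 3 * \<bar>m - 1\<bar>" using h'_g[of y] by linarith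
        also have "\<dots> \<le> K * \<eta> * (c * exp (a * (norm y)\<^sup>2)) + 3 * (K * \<eta> * E s) * exp (a * (norm y)\<^sup>2)"
        proof (rule add_mono)
          have "\<bar>g y\<bar> \<le> K * \<eta> * (1 + norm y) powr real s" using g_h[of y] hK[rule_format, of y] by (simp add: pw)
          also have "\<dots> \<le> K * \<eta> * (c * exp (a * (norm y)\<^sup>2))"
            unfolding c_def using a K \<eta> by (intro mult_left_mono powr_one_plus_le_exp) auto
          finally show "\<bar>g y\<bar> \<le> K * \<eta> * (c * exp (a * (norm y)\<^sup>2))" .
          have "3 * \<bar>m - 1\<bar> \<le> 3 * (K * \<eta> * E s) * 1" using m_\<eta> by simp
          also have "\<dots> \<le> 3 * (K * \<eta> * E s) * exp (a * (norm y)\<^sup>2)"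
            using 1 K \<eta> E0 by (intro mult_left_mono) auto
          finally show "3 * \<bar>m - 1\<bar> \<le> 3 * (K * \<eta> * E s) * exp (a * (norm y)\<^sup>2)" .
        qed
        also have "\<dots> = K * (c + 3 * E s) * (\<eta> * exp (a * (norm y)\<^sup>2))" by (simp add: algebra_simps)
        also have "\<dots> \<le> K' * (\<eta> * exp (a * (norm y)\<^sup>2))" using K'1(1) \<eta> by (intro mult_right_mono) auto
        finally show ?thesis by (simp add: mult.assoc)
      qed
      let ?I = "\<bar>\<integral>y. h y \<partial>?\<gamma>\<bar>"
      have "(\<integral>\<^sup>+y. ennreal (\<bar>h y - h' y\<bar> * (1 + norm y) powr p) \<partial>?\<gamma>) \<le>
          (\<integral>\<^sup>+y. ennreal (\<bar>h y - g y\<bar> * (1 + norm y) powr p + 3 * \<bar>m - 1\<bar> * (1 + norm y) powr p) \<partial>?\<gamma>)"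
      proof (intro nn_integral_mono ennreal_leI)
        fix y
        have "\<bar>h y - h' y\<bar> \<le> \<bar>h y - g y\<bar> + 3 * \<bar>m - 1\<bar>" using h'_g[of y] by linarith
        then have "\<bar>h y - h' y\<bar> * (1 + norm y) powr p \<le> (\<bar>h y - g y\<bar> + 3 * \<bar>m - 1\<bar>) * (1 + norm y) powr p"
          by (intro mult_right_mono) auto
        then show "\<bar>h y - h' y\<bar> * (1 + norm y) powr p \<le>
            \<bar>h y - g y\<bar> * (1 + norm y) powr p + 3 * \<bar>m - 1\<bar> * (1 + norm y) powr p"
          by (simp add: distrib_right)
      qed
      also have "\<dots> = ennreal (\<integral>y. \<bar>h y - g y\<bar> * (1 + norm y) powr p + 3 * \<bar>m - 1\<bar> * (1 + norm y) powr p \<partial>?\<gamma>)"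
        using int_diff integrable_gauss_norm_powr[OF p] by (intro nn_integral_eq_integral) auto
      also have "\<dots> = ennreal ((\<integral>y. \<bar>h y - g y\<bar> * (1 + norm y) powr p \<partial>?\<gamma>) + 3 * \<bar>m - 1\<bar> * E p)"
        using int_diff integrable_gauss_norm_powr[OF p, where 'd='d] by (simp add: E_def)
      also have "\<dots> \<le> ennreal (K' * (?I + \<eta> ^ (n + 1)))"
      proof (rule ennreal_leI)
        have "3 * \<bar>m - 1\<bar> * E p \<le> 3 * (?I + K2 * \<eta> ^ (n + 1)) * E p"
          using m_h E0 by (intro mult_right_mono) auto
        then have "(\<integral>y. \<bar>h y - g y\<bar> * (1 + norm y) powr p \<partial>?\<gamma>) + 3 * \<bar>m - 1\<bar> * E p \<le>
            K2 * \<eta> ^ (n + 1) + 3 * (?I + K2 * \<eta> ^ (n + 1)) * E p"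
          using diff_int by linarith
        also have "\<dots> \<le> (1 + 3 * E p) * (1 + K2) * (?I + \<eta> ^ (n + 1))"
        proof -
          have "0 \<le> ?I + \<eta> ^ (n + 1) + K2 * ?I + 3 * E p * (\<eta> ^ (n + 1) + K2 * ?I)"
            using K2 E0[of p] \<eta> by simp
          then show ?thesis by (simp add: algebra_simps)
        qed
        also have "\<dots> \<le> K' * (?I + \<eta> ^ (n + 1))" using K'1(2) \<eta> by (intro mult_right_mono) auto
        finally show "(\<integral>y. \<bar>h y - g y\<bar> * (1 + norm y) powr p \<partial>?\<gamma>) + 3 * \<bar>m - 1\<bar> * E p \<le> K' * (?I + \<eta> ^ (n + 1))" .
      qed
      finally show "(\<integral>\<^sup>+y. ennreal (\<bar>h y - h' y\<bar> * (1 + norm y) powr p) \<partial>?\<gamma>) \<le>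
        ennreal (K' * (?I + \<eta> ^ (n + 1)))" .
    qed
  qed
qed


section \<open>Assembling the coupling with the Gaussian law\<close>

lemma powr_add3_le:
  fixes x y z r :: real
  assumes "0 \<le> x" "0 \<le> y" "0 \<le> z" "0 \<le> r"
  shows "(x + y + z) powr r \<le> 3 powr r * (x powr r + y powr r + z powr r)"
proof -
  have "(x + y + z) powr r \<le> (3 * max x (max y z)) powr r"
    using assms by (intro powr_mono2) auto
  also have "\<dots> = 3 powr r * max x (max y z) powr r"
    using assms by (simp add: powr_mult)
  also have "\<dots> \<le> 3 powr r * (x powr r + y powr r + z powr r)"
    by (intro mult_left_mono) (auto simp: max_def)
  finally show ?thesis .
qed

lemma ennreal_root_le:
  assumes "1 \<le> p" "0 \<le> b" "x \<le> ennreal b"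
  shows "ennreal_root p x \<le> ennreal (b powr (1 / p))"
proof -
  have x: "x \<noteq> \<top>" using assms(3) by (auto simp: top_unique)
  have "enn2real x \<le> b" using assms(2,3) by (simp add: enn2real_leI)
  then show ?thesis
    using x assms by (auto simp: ennreal_root_def intro!: ennreal_leI powr_mono2)
qed

text \<open>\<open>X\<close> has law \<open>\<mu>\<close>, \<open>Z\<close> has the clipped and
  normalised law and is maximally coupled to \<open>X\<close>, and \<open>T (Z \<omega>)\<close> is
  Gaussian. The first leg costs the \<open>p\<close>-th root of a weighted total variation, the
  second is linear in \<open>\<eta>\<close>. Of \<open>h\<close> only its polynomial growth
  enters.\<close>

lemma wasserstein_perturbed_gauss:
  assumes p: "1 \<le> p" and K: "0 \<le> K"
  shows "\<exists>C>0. \<forall>(h :: real^'d::finite \<Rightarrow> real) \<eta> \<mu> \<delta>. h \<in> borel_measurable borel \<longrightarrow> 0 \<le> \<eta> \<longrightarrow>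
    (\<forall>y. \<bar>h y\<bar> \<le> K * \<eta> * (1 + norm y) ^ s) \<longrightarrow> prob_space \<mu> \<longrightarrow> sets \<mu> = sets borel \<longrightarrow> 0 \<le> \<delta> \<longrightarrow>
    (\<integral>\<^sup>+y. ennreal ((1 + norm y) powr p) \<partial>total_variation borel
      (\<lambda>A. measure \<mu> A - signed_density lborel (\<lambda>y. gauss_density y * (1 + h y)) A)) \<le> ennreal \<delta> \<longrightarrow>
    wasserstein p \<mu> gauss_measure \<le> ennreal (C * (\<eta> + \<delta> powr (1 / p) + (\<eta> ^ (n + 1)) powr (1 / p)))"
proof -
  let ?\<gamma> = "gauss_measure :: (real^'d) measure"
  \<comment> \<open>Then \<open>a * p = 1 / 4\<close>, and \<open>a <= 1 / 4\<close> because
    \<open>p >= 1\<close>.\<close>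
  define a where "a = 1 / (4 * p)"
  have a: "0 < a" "a < 1 / 2" "a * p < 1 / 2" using p by (auto simp: a_def field_simps)
  have p0: "0 \<le> p" using p by simp
  from gauss_clip_normalise[OF p0 K a(1), where 'd='d and s=s and n=n]
  obtain K' where K': "0 < K'" and clip: "\<forall>(h :: real^'d \<Rightarrow> real) \<eta>. h \<in> borel_measurable borel \<longrightarrow> 0 \<le> \<eta> \<longrightarrow>
    (\<forall>y. \<bar>h y\<bar> \<le> K * \<eta> * (1 + norm y) ^ s) \<longrightarrow>
    (\<exists>h'. h' \<in> borel_measurable borel \<and> (\<forall>y. 1 / 3 \<le> 1 + h' y \<and> 1 + h' y \<le> 3) \<and>
      prob_space (density gauss_measure (\<lambda>y. ennreal (1 + h' y))) \<and>
      (\<forall>y. \<bar>h' y\<bar> \<le> K' * \<eta> * exp (a * (norm y)\<^sup>2)) \<and>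
      (\<integral>\<^sup>+y. ennreal (\<bar>h y - h' y\<bar> * (1 + norm y) powr p) \<partial>gauss_measure) \<le>
        ennreal (K' * (\<bar>\<integral>y. h y \<partial>gauss_measure\<bar> + \<eta> ^ (n + 1))))"
    by (elim exE conjE) (rule that)
  have "0 < (1 / 3 :: real)" "0 < (3 :: real)" by simp_all
  from gauss_transport[OF less_imp_le[OF a(1)] a(2,3) p this finite[of "UNIV :: 'd set"]]
  obtain D where D: "0 < D" and transport: "\<forall>(h :: real^'d \<Rightarrow> real) \<eta>. h \<in> borel_measurable borel \<longrightarrow> 0 \<le> \<eta> \<longrightarrow>
    (\<forall>y. \<bar>h y\<bar> \<le> \<eta> * exp (a * (norm y)\<^sup>2)) \<longrightarrow> (\<forall>y. 1 / 3 \<le> 1 + h y \<and> 1 + h y \<le> 3) \<longrightarrow>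
    (\<forall>y y'. (\<forall>i\<in>UNIV. y $ i = y' $ i) \<longrightarrow> h y = h y') \<longrightarrow>
    prob_space (density gauss_measure (\<lambda>y. ennreal (1 + h y))) \<longrightarrow>
    (\<exists>T. T \<in> borel_measurable borel \<and>
      distr (density gauss_measure (\<lambda>y. ennreal (1 + h y))) borel T = gauss_measure \<and>
      (\<integral>\<^sup>+y. ennreal (norm (T y - y) powr p) \<partial>density gauss_measure (\<lambda>y. ennreal (1 + h y)))
        \<le> ennreal (D * \<eta> powr p))"
    by (elim exE conjE) (rule that)
  \<comment> \<open>The outer \<open>2 powr p\<close> splits the distance from \<open>X\<close> to
    \<open>T Z\<close> at \<open>Z\<close>, the inner one belongs to the maximal coupling.
    \<open>1 + K'\<close> bounds the weighted total variation, and \<open>D * K' powr p\<close> is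
    the cost of \<open>T\<close> at \<open>K' * \<eta>\<close>.\<close>
  define B where "B = 2 powr p * (2 powr p * (1 + K') + D * K' powr p)"
  have B: "0 < B" using K' D by (simp add: B_def add_pos_nonneg)
  define C where "C = B powr (1 / p) * 3 powr (1 / p)"
  show ?thesis
  proof (intro exI[of _ C] conjI allI impI)
    show "0 < C" using B by (simp add: C_def)
    fix h :: "real^'d \<Rightarrow> real" and \<eta> \<delta> :: real and \<mu> :: "(real^'d) measure"
    assume h[measurable]: "h \<in> borel_measurable borel" and \<eta>: "0 \<le> \<eta>"
      and hK: "\<forall>y. \<bar>h y\<bar> \<le> K * \<eta> * (1 + norm y) ^ s"
      and \<mu>: "prob_space \<mu>" and sets_\<mu>: "sets \<mu> = sets borel" and \<delta>: "0 \<le> \<delta>"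
      and tv: "(\<integral>\<^sup>+y. ennreal ((1 + norm y) powr p) \<partial>total_variation borel
        (\<lambda>A. measure \<mu> A - signed_density lborel (\<lambda>y. gauss_density y * (1 + h y)) A)) \<le> ennreal \<delta>"
    from clip[THEN spec, THEN spec, THEN mp, THEN mp, THEN mp, OF h \<eta> hK]
    obtain h' where h'[measurable]: "h' \<in> borel_measurable borel"
      and h'_bounds: "\<forall>y. 1 / 3 \<le> 1 + h' y \<and> 1 + h' y \<le> 3"
      and pr': "prob_space (density ?\<gamma> (\<lambda>y. ennreal (1 + h' y)))"
      and h'_exp: "\<forall>y. \<bar>h' y\<bar> \<le> K' * \<eta> * exp (a * (norm y)\<^sup>2)"
      and hh': "(\<integral>\<^sup>+y. ennreal (\<bar>h y - h' y\<bar> * (1 + norm y) powr p) \<partial>?\<gamma>) \<le>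
        ennreal (K' * (\<bar>\<integral>y. h y \<partial>?\<gamma>\<bar> + \<eta> ^ (n + 1)))"
      by blast
    have K'\<eta>: "0 \<le> K' * \<eta>" using K' \<eta> by simp
    \<comment> \<open>All coordinates are transported, so the dependence hypothesis is just
      extensionality of vectors.\<close>
    have coords: "\<forall>y y'. (\<forall>i\<in>UNIV. y $ i = y' $ i) \<longrightarrow> h' y = h' y'"
      by (auto simp: vec_eq_iff[symmetric])
    from transport[THEN spec, THEN spec, THEN mp, THEN mp, THEN mp, THEN mp, THEN mp, THEN mp,
        OF h' K'\<eta> h'_exp h'_bounds coords pr']
    obtain T where T[measurable]: "T \<in> borel_measurable borel"
      and distr_T: "distr (density ?\<gamma> (\<lambda>y. ennreal (1 + h' y))) borel T = ?\<gamma>"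
      and T_cost: "(\<integral>\<^sup>+y. ennreal (norm (T y - y) powr p) \<partial>density ?\<gamma> (\<lambda>y. ennreal (1 + h' y)))
        \<le> ennreal (D * (K' * \<eta>) powr p)"
      by blast
    interpret \<mu>: prob_space \<mu> by fact
    obtain L u v where sets_L': "sets L = sets \<mu>"
      and uv: "u \<in> borel_measurable \<mu>" "v \<in> borel_measurable \<mu>"
      and u0: "\<And>x. 0 \<le> u x" and v0: "\<And>x. 0 \<le> (v x :: real)"
      and \<mu>_eq: "\<mu> = density L (\<lambda>x. ennreal (u x))" and \<gamma>_eq: "?\<gamma> = density L (\<lambda>x. ennreal (v x))"
    proof (rule exists_common_density)
      show "finite_measure \<mu>" "finite_measure ?\<gamma>" "sets ?\<gamma> = sets \<mu>"
        by (simp_all add: sets_\<mu> \<mu>.finite_measure_axioms gauss.finite_measure_axioms)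
    qed (rule that, assumption+)
    have sets_L[measurable_cong, simp]: "sets L = sets borel" using sets_L' sets_\<mu> by simp
    have u[measurable]: "u \<in> borel_measurable borel" and v[measurable]: "v \<in> borel_measurable borel"
      using uv measurable_cong_sets[OF sets_\<mu> refl, of borel] by blast+
    have space_L[simp]: "space L = UNIV" using sets_eq_imp_space_eq[OF sets_L] by simp
    have int_\<gamma>: "integrable ?\<gamma> f \<longleftrightarrow> integrable L (\<lambda>y. v y * f y)"
      if "f \<in> borel_measurable borel" for f :: "real^'d \<Rightarrow> real"
      unfolding \<gamma>_eq using that v0 by (subst integrable_density) auto
    have integral_\<gamma>: "(\<integral>y. f y \<partial>?\<gamma>) = (\<integral>y. v y * f y \<partial>L)"
      if "f \<in> borel_measurable borel" for f :: "real^'d \<Rightarrow> real"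
      unfolding \<gamma>_eq using that v0 by (subst integral_density) auto
    have int_h: "integrable ?\<gamma> h"
    proof (rule Bochner_Integration.integrable_bound)
      show "integrable ?\<gamma> (\<lambda>y. K * \<eta> * (1 + norm y) powr real s)"
        by (intro integrable_mult_right integrable_gauss_norm_powr) simp
      have "(1 + norm y) ^ s = (1 + norm y) powr real s" for y :: "real^'d"
        by (subst powr_realpow) (auto simp: add_pos_nonneg)
      then show "AE y in ?\<gamma>. norm (h y) \<le> norm (K * \<eta> * (1 + norm y) powr real s)"
        using hK K \<eta> by (intro AE_I2) simp
    qed simp
    \<comment> \<open>The density over \<open>L\<close> of the signed measure whose total variation
      is bounded by hypothesis.\<close>
    define f where "f y = u y - v y * (1 + h y)" for y
    have f[measurable]: "f \<in> borel_measurable borel" unfolding f_def by measurable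
    have int_u: "integrable L u"
    proof (rule integrableI_nonneg)
      have "(\<integral>\<^sup>+x. ennreal (u x) \<partial>L) = emeasure \<mu> (space \<mu>)"
        unfolding \<mu>_eq by (simp add: emeasure_density)
      then show "(\<integral>\<^sup>+x. ennreal (u x) \<partial>L) < \<infinity>" by (simp add: \<mu>.emeasure_space_1)
    qed (use u0 in auto)
    have int_vh: "integrable L (\<lambda>y. v y * (1 + h y))"
      using int_h by (subst int_\<gamma>[symmetric]) auto
    have int_f: "integrable L f" unfolding f_def using int_u int_vh by simp
    have tv_eq: "total_variation borel (\<lambda>A. measure \<mu> A - signed_density lborel (\<lambda>y. gauss_density y * (1 + h y)) A) =
        density L (\<lambda>y. ennreal \<bar>f y\<bar>)"
    proof (rule total_variation_eq_density[OF int_f])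
      fix A assume "A \<in> sets L"
      then have A[measurable]: "A \<in> sets borel" by simp
      have "measure \<mu> A = (\<integral>y. indicator A y \<partial>\<mu>)"
        using sets_eq_imp_space_eq[OF sets_\<mu>] by simp
      also have "\<dots> = (\<integral>y. indicator A y * u y \<partial>L)"
        unfolding \<mu>_eq using u0 by (subst integral_density) (auto simp: mult.commute)
      finally have m: "measure \<mu> A = (\<integral>y. indicator A y * u y \<partial>L)" .
      have "signed_density lborel (\<lambda>y. gauss_density y * (1 + h y)) A =
          (\<integral>y. gauss_density y * (indicator A y * (1 + h y)) \<partial>lborel)"
        by (simp add: signed_density_def set_lebesgue_integral_def mult_ac)
      also have "\<dots> = (\<integral>y. indicator A y * (1 + h y) \<partial>?\<gamma>)"
        unfolding gauss_measure_def by (subst integral_density) auto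
      also have "\<dots> = (\<integral>y. indicator A y * (v y * (1 + h y)) \<partial>L)"
        by (subst integral_\<gamma>) (auto simp: mult_ac)
      finally have s: "signed_density lborel (\<lambda>y. gauss_density y * (1 + h y)) A =
          (\<integral>y. indicator A y * (v y * (1 + h y)) \<partial>L)" .
      have "integrable L (\<lambda>y. indicator A y * u y)" "integrable L (\<lambda>y. indicator A y * (v y * (1 + h y)))"
        using integrable_mult_indicator[OF _ int_u, of A] integrable_mult_indicator[OF _ int_vh, of A] by simp_all
      then show "measure \<mu> A - signed_density lborel (\<lambda>y. gauss_density y * (1 + h y)) A = signed_density L f A"
        unfolding m s
        by (simp add: signed_density_def set_lebesgue_integral_def f_def right_diff_distrib)
    qed simp
    have f_\<delta>: "(\<integral>\<^sup>+y. ennreal (\<bar>f y\<bar> * (1 + norm y) powr p) \<partial>L) \<le> ennreal \<delta>"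
      using tv unfolding tv_eq by (subst (asm) nn_integral_density) (simp_all add: ennreal_mult)
    have one_le: "1 \<le> (1 + norm y) powr p" for y :: "real^'d"
      using p by (intro ge_one_powr_ge_zero) auto
    \<comment> \<open>\<open>\<mu>\<close> and the Gaussian law both have mass 1, so the signed
      difference has total mass minus the integral of \<open>h\<close>. As the weight is at least 1,
      \<open>\<delta>\<close> bounds it: closeness to a probability measure forces the perturbation
      to be almost centred.\<close>
    have h_\<delta>: "\<bar>\<integral>y. h y \<partial>?\<gamma>\<bar> \<le> \<delta>"
    proof -
      have "(\<integral>y. u y \<partial>L) = 1"
      proof -
        have "(\<integral>\<^sup>+x. ennreal (u x) \<partial>L) = emeasure \<mu> (space \<mu>)"
          unfolding \<mu>_eq by (simp add: emeasure_density)
        then have "ennreal (\<integral>y. u y \<partial>L) = 1"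
          using nn_integral_eq_integral[OF int_u] u0 by (simp add: \<mu>.emeasure_space_1)
        then show ?thesis by simp
      qed
      moreover have "(\<integral>y. v y * (1 + h y) \<partial>L) = 1 + (\<integral>y. h y \<partial>?\<gamma>)"
        using int_h gauss.prob_space[where 'd='d] by (subst integral_\<gamma>[symmetric]) auto
      ultimately have "(\<integral>y. f y \<partial>L) = - (\<integral>y. h y \<partial>?\<gamma>)"
        unfolding f_def using int_u int_vh by simp
      then have "\<bar>\<integral>y. h y \<partial>?\<gamma>\<bar> = \<bar>\<integral>y. f y \<partial>L\<bar>" by simp
      also have "ennreal \<dots> \<le> (\<integral>\<^sup>+y. ennreal \<bar>f y\<bar> \<partial>L)"
        using integral_norm_bound_ennreal[OF int_f] by simp
      also have "\<dots> \<le> (\<integral>\<^sup>+y. ennreal (\<bar>f y\<bar> * (1 + norm y) powr p) \<partial>L)"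
        using mult_left_mono[OF one_le] by (intro nn_integral_mono ennreal_leI) force
      also note f_\<delta>
      finally show ?thesis using \<delta> by simp
    qed
    define w where "w y = v y * (1 + h' y)" for y
    have w[measurable]: "w \<in> borel_measurable borel" unfolding w_def by measurable
    have h'0: "0 \<le> 1 + h' y" for y using h'_bounds[rule_format, of y] by simp
    have w0: "0 \<le> w y" for y using v0 h'0 by (simp add: w_def)
    have w_eq: "density L (\<lambda>y. ennreal (w y)) = density ?\<gamma> (\<lambda>y. ennreal (1 + h' y))"
      unfolding \<gamma>_eq w_def using v0 h'0 by (subst density_density_eq) (auto simp: ennreal_mult)
    have \<mu>': "prob_space (density L (\<lambda>x. ennreal (u x)))" using \<mu> \<mu>_eq by simp
    have \<nu>': "prob_space (density L (\<lambda>x. ennreal (w x)))" using pr' w_eq by simp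
    obtain \<Omega> :: "(((real^'d) \<times> (real^'d)) \<times> real) measure" and X Z where \<Omega>: "prob_space \<Omega>"
      and X[measurable]: "X \<in> borel_measurable \<Omega>" and Z[measurable]: "Z \<in> borel_measurable \<Omega>"
      and distr_X: "distr \<Omega> borel X = density L (\<lambda>x. ennreal (u x))"
      and distr_Z: "distr \<Omega> borel Z = density L (\<lambda>x. ennreal (w x))"
      and XZ: "(\<integral>\<^sup>+\<omega>. ennreal (norm (X \<omega> - Z \<omega>) powr p) \<partial>\<Omega>) \<le>
        ennreal (2 powr p) * (\<integral>\<^sup>+x. ennreal (\<bar>u x - w x\<bar> * norm x powr p) \<partial>L)"
      using maximal_coupling[OF sets_L u w u0 w0 \<mu>' \<nu>' p0] by blast
    \<comment> \<open>\<open>u - w = f + v * (h - h')\<close>: the hypothesis bounds the first part,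
      clipping and normalisation account for the second.\<close>
    have uw: "(\<integral>\<^sup>+x. ennreal (\<bar>u x - w x\<bar> * norm x powr p) \<partial>L) \<le> ennreal ((1 + K') * (\<delta> + \<eta> ^ (n + 1)))"
    proof -
      have "(\<integral>\<^sup>+x. ennreal (\<bar>u x - w x\<bar> * norm x powr p) \<partial>L) \<le>
          (\<integral>\<^sup>+y. ennreal (\<bar>f y\<bar> * (1 + norm y) powr p) + ennreal (v y) * ennreal (\<bar>h y - h' y\<bar> * (1 + norm y) powr p) \<partial>L)"
      proof (intro nn_integral_mono)
        fix y
        have "u y - w y = f y + v y * (h y - h' y)" by (simp add: f_def w_def algebra_simps)
        then have "\<bar>u y - w y\<bar> \<le> \<bar>f y\<bar> + v y * \<bar>h y - h' y\<bar>"
          using abs_triangle_ineq[of "f y" "v y * (h y - h' y)"] v0[of y] by (simp add: abs_mult)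
        moreover have "norm y powr p \<le> (1 + norm y) powr p" using p by (intro powr_mono2) auto
        ultimately have "\<bar>u y - w y\<bar> * norm y powr p \<le> (\<bar>f y\<bar> + v y * \<bar>h y - h' y\<bar>) * (1 + norm y) powr p"
          by (intro mult_mono) auto
        then show "ennreal (\<bar>u y - w y\<bar> * norm y powr p) \<le>
          ennreal (\<bar>f y\<bar> * (1 + norm y) powr p) + ennreal (v y) * ennreal (\<bar>h y - h' y\<bar> * (1 + norm y) powr p)"
          using v0[of y]
          by (simp add: ennreal_mult[symmetric] ennreal_plus[symmetric] ennreal_leI algebra_simps del: ennreal_plus)
      qed
      also have "\<dots> = (\<integral>\<^sup>+y. ennreal (\<bar>f y\<bar> * (1 + norm y) powr p) \<partial>L) +
          (\<integral>\<^sup>+y. ennreal (\<bar>h y - h' y\<bar> * (1 + norm y) powr p) \<partial>?\<gamma>)"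
        unfolding \<gamma>_eq by (simp add: nn_integral_add nn_integral_density)
      also have "\<dots> \<le> ennreal \<delta> + ennreal (K' * (\<delta> + \<eta> ^ (n + 1)))"
      proof (rule add_mono[OF f_\<delta> order_trans[OF hh']], rule ennreal_leI)
        show "K' * (\<bar>\<integral>y. h y \<partial>?\<gamma>\<bar> + \<eta> ^ (n + 1)) \<le> K' * (\<delta> + \<eta> ^ (n + 1))"
          using K' h_\<delta> by (intro mult_left_mono) auto
      qed
      also have "\<dots> \<le> ennreal ((1 + K') * (\<delta> + \<eta> ^ (n + 1)))"
        using K' \<delta> \<eta>
        by (simp add: ennreal_plus[symmetric] ennreal_leI algebra_simps del: ennreal_plus)
      finally show ?thesis .
    qed
    have ZT: "(\<integral>\<^sup>+\<omega>. ennreal (norm (T (Z \<omega>) - Z \<omega>) powr p) \<partial>\<Omega>) \<le> ennreal (D * (K' * \<eta>) powr p)"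
    proof -
      have "(\<integral>\<^sup>+\<omega>. ennreal (norm (T (Z \<omega>) - Z \<omega>) powr p) \<partial>\<Omega>) = (\<integral>\<^sup>+y. ennreal (norm (T y - y) powr p) \<partial>distr \<Omega> borel Z)"
        by (subst nn_integral_distr) auto
      then show ?thesis using T_cost by (simp add: distr_Z w_eq)
    qed
    \<comment> \<open>Under the final \<open>p\<close>-th root the summand
      \<open>\<eta> powr p\<close> turns back into \<open>\<eta>\<close>, while
      \<open>\<delta>\<close> and \<open>\<eta> ^ (n + 1)\<close> keep the root.\<close>
    define Q where "Q = \<delta> + \<eta> ^ (n + 1) + \<eta> powr p"
    have Q: "0 \<le> Q" using \<delta> \<eta> by (simp add: Q_def)
    have cost: "(\<integral>\<^sup>+\<omega>. ennreal (infnorm (X \<omega> - T (Z \<omega>)) powr p) \<partial>\<Omega>) \<le> ennreal (B * Q)"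
    proof -
      have "(\<integral>\<^sup>+\<omega>. ennreal (infnorm (X \<omega> - T (Z \<omega>)) powr p) \<partial>\<Omega>) \<le>
          (\<integral>\<^sup>+\<omega>. ennreal (2 powr p) * (ennreal (norm (X \<omega> - Z \<omega>) powr p) + ennreal (norm (T (Z \<omega>) - Z \<omega>) powr p)) \<partial>\<Omega>)"
      proof (intro nn_integral_mono)
        fix \<omega>
        have "infnorm (X \<omega> - T (Z \<omega>)) \<le> norm (X \<omega> - Z \<omega>) + norm (T (Z \<omega>) - Z \<omega>)"
          using infnorm_le_norm[of "X \<omega> - T (Z \<omega>)"] norm_triangle_ineq4[of "X \<omega> - Z \<omega>" "T (Z \<omega>) - Z \<omega>"] by simp
        then have "infnorm (X \<omega> - T (Z \<omega>)) powr p \<le> (norm (X \<omega> - Z \<omega>) + norm (T (Z \<omega>) - Z \<omega>)) powr p"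
          using p by (intro powr_mono2) (auto simp: infnorm_pos_le)
        also have "\<dots> \<le> 2 powr p * (norm (X \<omega> - Z \<omega>) powr p + norm (T (Z \<omega>) - Z \<omega>) powr p)"
          using p by (intro powr_add_le) auto
        finally show "ennreal (infnorm (X \<omega> - T (Z \<omega>)) powr p) \<le>
          ennreal (2 powr p) * (ennreal (norm (X \<omega> - Z \<omega>) powr p) + ennreal (norm (T (Z \<omega>) - Z \<omega>) powr p))"
          by (simp add: ennreal_mult[symmetric] ennreal_plus[symmetric] ennreal_leI del: ennreal_plus)
      qed
      also have "\<dots> = ennreal (2 powr p) * ((\<integral>\<^sup>+\<omega>. ennreal (norm (X \<omega> - Z \<omega>) powr p) \<partial>\<Omega>) +
          (\<integral>\<^sup>+\<omega>. ennreal (norm (T (Z \<omega>) - Z \<omega>) powr p) \<partial>\<Omega>))"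
        by (simp add: nn_integral_cmult nn_integral_add)
      also have "\<dots> \<le> ennreal (2 powr p) * (ennreal (2 powr p) * ennreal ((1 + K') * (\<delta> + \<eta> ^ (n + 1))) + ennreal (D * (K' * \<eta>) powr p))"
        by (intro mult_left_mono add_mono order_trans[OF XZ] ZT uw) auto
      also have "\<dots> = ennreal (2 powr p * (2 powr p * ((1 + K') * (\<delta> + \<eta> ^ (n + 1))) + D * (K' * \<eta>) powr p))"
        using K' \<delta> \<eta> D by (simp add: ennreal_mult[symmetric] ennreal_plus[symmetric] del: ennreal_plus)
      also have "\<dots> \<le> ennreal (B * Q)"
      proof (rule ennreal_leI)
        have "2 powr p * ((1 + K') * (\<delta> + \<eta> ^ (n + 1))) \<le> 2 powr p * (1 + K') * Q"
          using K' \<eta> by (simp add: Q_def mult.assoc mult_left_mono)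
        moreover have "D * (K' * \<eta>) powr p \<le> D * K' powr p * Q"
          using K' D \<eta> \<delta> by (simp add: Q_def powr_mult mult.assoc mult_left_mono)
        ultimately have "2 powr p * ((1 + K') * (\<delta> + \<eta> ^ (n + 1))) + D * (K' * \<eta>) powr p \<le>
            (2 powr p * (1 + K') + D * K' powr p) * Q"
          unfolding distrib_right[of "2 powr p * (1 + K')"] by (rule add_mono)
        then show "2 powr p * (2 powr p * ((1 + K') * (\<delta> + \<eta> ^ (n + 1))) + D * (K' * \<eta>) powr p) \<le> B * Q"
          by (simp add: B_def mult.assoc mult_left_mono)
      qed
      finally show ?thesis .
    qed
    have "wasserstein p \<mu> ?\<gamma> \<le> ennreal_root p (\<integral>\<^sup>+\<omega>. ennreal (infnorm (X \<omega> - T (Z \<omega>)) powr p) \<partial>\<Omega>)"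
    proof (rule wasserstein_le[OF \<Omega>])
      show "distr \<Omega> borel X = \<mu>" using distr_X \<mu>_eq by simp
      show "distr \<Omega> borel (\<lambda>\<omega>. T (Z \<omega>)) = ?\<gamma>"
        using distr_distr[OF T Z] distr_T by (simp add: distr_Z w_eq o_def)
    qed measurable
    also have "\<dots> \<le> ennreal ((B * Q) powr (1 / p))"
      using B Q by (intro ennreal_root_le p cost) auto
    also have "\<dots> \<le> ennreal (C * (\<eta> + \<delta> powr (1 / p) + (\<eta> ^ (n + 1)) powr (1 / p)))"
    proof (rule ennreal_leI)
      have "Q powr (1 / p) \<le> 3 powr (1 / p) * (\<delta> powr (1 / p) + (\<eta> ^ (n + 1)) powr (1 / p) + (\<eta> powr p) powr (1 / p))"
        unfolding Q_def using \<delta> \<eta> p by (intro powr_add3_le) auto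
      also have "(\<eta> powr p) powr (1 / p) = \<eta>" using p \<eta> by (simp add: powr_powr)
      finally have "B powr (1 / p) * Q powr (1 / p) \<le>
          B powr (1 / p) * (3 powr (1 / p) * (\<delta> powr (1 / p) + (\<eta> ^ (n + 1)) powr (1 / p) + \<eta>))"
        by (intro mult_left_mono) auto
      then show "(B * Q) powr (1 / p) \<le> C * (\<eta> + \<delta> powr (1 / p) + (\<eta> ^ (n + 1)) powr (1 / p))"
        using B Q by (simp add: C_def powr_mult algebra_simps)
    qed
    finally show "wasserstein p \<mu> ?\<gamma> \<le> ennreal (C * (\<eta> + \<delta> powr (1 / p) + (\<eta> ^ (n + 1)) powr (1 / p)))" .
  qed
qed


section \<open>Polynomial perturbations\<close>

lemma finite_bounded_degree:
  "finite {m :: 'd::finite \<Rightarrow>\<^sub>0 nat. (\<Sum>i\<in>UNIV. Poly_Mapping.lookup m i) \<le> s}"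
proof (rule finite_imageD)
  have "Poly_Mapping.lookup ` {m :: 'd \<Rightarrow>\<^sub>0 nat. (\<Sum>i\<in>UNIV. Poly_Mapping.lookup m i) \<le> s} \<subseteq> Pi\<^sub>E UNIV (\<lambda>_. {..s})"
  proof (rule image_subsetI)
    fix m :: "'d \<Rightarrow>\<^sub>0 nat" assume m: "m \<in> {m. (\<Sum>i\<in>UNIV. Poly_Mapping.lookup m i) \<le> s}"
    have "Poly_Mapping.lookup m i \<le> s" for i
      using m member_le_sum[of i UNIV "Poly_Mapping.lookup m"] by simp
    then show "Poly_Mapping.lookup m \<in> Pi\<^sub>E UNIV (\<lambda>_. {..s})" by auto
  qed
  then show "finite (Poly_Mapping.lookup ` {m :: 'd \<Rightarrow>\<^sub>0 nat. (\<Sum>i\<in>UNIV. Poly_Mapping.lookup m i) \<le> s})"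
    by (rule finite_subset) (intro finite_PiE, auto)
  show "inj_on Poly_Mapping.lookup {m :: 'd \<Rightarrow>\<^sub>0 nat. (\<Sum>i\<in>UNIV. Poly_Mapping.lookup m i) \<le> s}"
    by (intro inj_onI) (simp add: poly_mapping_eqI)
qed

text \<open>As \<open>1 + norm y >= 1\<close>, each monomial of degree at most \<open>s\<close> is
  bounded by the \<open>s\<close>-th power. The number of monomials depends only on the dimension
  and \<open>s\<close>.\<close>

lemma abs_mvpoly_eval_le:
  fixes q :: "'d::finite mvpoly"
  assumes M: "\<And>m. \<bar>Poly_Mapping.lookup q m\<bar> \<le> M" and deg: "mvpoly_degree q \<le> s"
  shows "\<bar>mvpoly_eval q y\<bar> \<le>
    real (card {m :: 'd \<Rightarrow>\<^sub>0 nat. (\<Sum>i\<in>UNIV. Poly_Mapping.lookup m i) \<le> s}) * M * (1 + norm y) ^ s"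
proof -
  let ?F = "{m :: 'd \<Rightarrow>\<^sub>0 nat. (\<Sum>i\<in>UNIV. Poly_Mapping.lookup m i) \<le> s}"
  have M0: "0 \<le> M" using M[of 0] by linarith
  have keys: "Poly_Mapping.keys q \<subseteq> ?F"
  proof
    fix m assume "m \<in> Poly_Mapping.keys q"
    then have "(\<Sum>i\<in>UNIV. Poly_Mapping.lookup m i) \<le> mvpoly_degree q"
      unfolding mvpoly_degree_def by (intro Max_ge) auto
    then show "m \<in> ?F" using deg by simp
  qed
  have "\<bar>mvpoly_eval q y\<bar> \<le> (\<Sum>m\<in>Poly_Mapping.keys q. M * (1 + norm y) ^ s)"
    unfolding mvpoly_eval_def
  proof (rule order_trans[OF sum_abs sum_mono])
    fix m assume m: "m \<in> Poly_Mapping.keys q"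
    have "\<bar>\<Prod>i\<in>UNIV. (y $ i) ^ Poly_Mapping.lookup m i\<bar> \<le> (\<Prod>i\<in>UNIV. (1 + norm y) ^ Poly_Mapping.lookup m i)"
      unfolding abs_prod power_abs
    proof (intro prod_mono conjI power_mono)
      show "\<bar>y $ i\<bar> \<le> 1 + norm y" for i using component_le_norm_cart[of y i] by simp
    qed auto
    also have "\<dots> = (1 + norm y) ^ (\<Sum>i\<in>UNIV. Poly_Mapping.lookup m i)" by (rule power_sum[symmetric])
    also have "\<dots> \<le> (1 + norm y) ^ s" using keys m by (intro power_increasing) auto
    finally show "\<bar>Poly_Mapping.lookup q m * (\<Prod>i\<in>UNIV. (y $ i) ^ Poly_Mapping.lookup m i)\<bar> \<le> M * (1 + norm y) ^ s"
      unfolding abs_mult using M M0 by (intro mult_mono) auto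
  qed
  also have "\<dots> \<le> (\<Sum>m\<in>?F. M * (1 + norm y) ^ s)"
    using keys M0 by (intro sum_mono2 finite_bounded_degree) auto
  finally show ?thesis by simp
qed


text \<open>The general bound is applied with \<open>\<eta> = \<epsilon> ^ n\<^sub>0\<close>. The
  constant is fixed by \<open>p\<close>, \<open>M\<close>, \<open>n\<close>, \<open>s\<close> and
  the dimension before the remaining data are introduced.\<close>

theorem proposition3p1:
  fixes p M :: real and n s :: nat
  assumes "1 \<le> p" and "0 < M"
  shows "\<exists>C::real. 0 < C \<and>
    (\<forall>(\<epsilon>::real) (n\<^sub>0::nat) (S :: nat \<Rightarrow> 'd::finite mvpoly) (\<mu> :: (real^'d) measure) (\<delta>::real).
      0 < \<epsilon> \<longrightarrow> \<epsilon> < 1 \<longrightarrow>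
      1 \<le> n\<^sub>0 \<longrightarrow> n\<^sub>0 \<le> n \<longrightarrow>
      (\<forall>j\<in>{1..n}. \<forall>m. \<bar>Poly_Mapping.lookup (S j) m\<bar> \<le> M) \<longrightarrow>
      s = Max ((\<lambda>j. mvpoly_degree (S j)) ` {1..n}) \<longrightarrow>
      prob_space \<mu> \<longrightarrow> sets \<mu> = sets borel \<longrightarrow>
      0 \<le> \<delta> \<longrightarrow>
      (\<integral>\<^sup>+y. ennreal ((1 + norm y) powr p)
         \<partial>total_variation borel
            (\<lambda>A. measure \<mu> A - signed_density lborel (perturbed_density \<epsilon> n\<^sub>0 n S) A)) \<le> ennreal \<delta> \<longrightarrow>
      wasserstein p \<mu> gauss_measure \<le>
        ennreal (C * (\<epsilon> ^ n\<^sub>0 + \<delta> powr (1 / p) + \<epsilon> powr (real (n + 1) / p))))"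
proof -
  define N where "N = real (card {m :: 'd \<Rightarrow>\<^sub>0 nat. (\<Sum>i\<in>UNIV. Poly_Mapping.lookup m i) \<le> s}) * M"
  \<comment> \<open>\<open>N\<close> bounds a single polynomial, and the sum over \<open>j\<close>
    has at most \<open>n + 1\<close> terms.\<close>
  define K where "K = real (n + 1) * N"
  have N: "0 \<le> N" using assms(2) by (simp add: N_def)
  then have K: "0 \<le> K" by (simp add: K_def)
  from wasserstein_perturbed_gauss[OF assms(1) K, where 'd='d and s=s and n=n]
  obtain C where C: "0 < C" and W: "\<forall>(h :: real^'d \<Rightarrow> real) \<eta> \<mu> \<delta>. h \<in> borel_measurable borel \<longrightarrow> 0 \<le> \<eta> \<longrightarrow>
    (\<forall>y. \<bar>h y\<bar> \<le> K * \<eta> * (1 + norm y) ^ s) \<longrightarrow> prob_space \<mu> \<longrightarrow> sets \<mu> = sets borel \<longrightarrow> 0 \<le> \<delta> \<longrightarrow>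
    (\<integral>\<^sup>+y. ennreal ((1 + norm y) powr p) \<partial>total_variation borel
      (\<lambda>A. measure \<mu> A - signed_density lborel (\<lambda>y. gauss_density y * (1 + h y)) A)) \<le> ennreal \<delta> \<longrightarrow>
    wasserstein p \<mu> gauss_measure \<le> ennreal (C * (\<eta> + \<delta> powr (1 / p) + (\<eta> ^ (n + 1)) powr (1 / p)))"
    by (elim exE conjE) (rule that)
  show ?thesis
  proof (intro exI[of _ C] conjI allI impI)
    show "0 < C" by fact
    fix \<epsilon> \<delta> :: real and n\<^sub>0 and S :: "nat \<Rightarrow> 'd mvpoly" and \<mu> :: "(real^'d) measure"
    assume \<epsilon>: "0 < \<epsilon>" "\<epsilon> < 1" and n0: "1 \<le> n\<^sub>0" "n\<^sub>0 \<le> n"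
      and coeff: "\<forall>j\<in>{1..n}. \<forall>m. \<bar>Poly_Mapping.lookup (S j) m\<bar> \<le> M"
      and s: "s = Max ((\<lambda>j. mvpoly_degree (S j)) ` {1..n})"
      and \<mu>: "prob_space \<mu>" "sets \<mu> = sets borel" and \<delta>: "0 \<le> \<delta>"
      and tv: "(\<integral>\<^sup>+y. ennreal ((1 + norm y) powr p) \<partial>total_variation borel
        (\<lambda>A. measure \<mu> A - signed_density lborel (perturbed_density \<epsilon> n\<^sub>0 n S) A)) \<le> ennreal \<delta>"
    define h where "h y = (\<Sum>j=n\<^sub>0..n. \<epsilon> ^ j * mvpoly_eval (S j) y)" for y
    have h: "h \<in> borel_measurable borel" unfolding h_def mvpoly_eval_def by measurable
    have hK: "\<forall>y. \<bar>h y\<bar> \<le> K * \<epsilon> ^ n\<^sub>0 * (1 + norm y) ^ s"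
    proof
      fix y
      have "\<bar>h y\<bar> \<le> (\<Sum>j=n\<^sub>0..n. \<epsilon> ^ n\<^sub>0 * (N * (1 + norm y) ^ s))"
        unfolding h_def
      proof (rule order_trans[OF sum_abs sum_mono])
        fix j assume j: "j \<in> {n\<^sub>0..n}"
        then have j': "j \<in> {1..n}" using n0 by simp
        then have "mvpoly_degree (S j) \<le> s" unfolding s by (intro Max_ge) auto
        then have "\<bar>mvpoly_eval (S j) y\<bar> \<le> N * (1 + norm y) ^ s"
          unfolding N_def using coeff j' by (intro abs_mvpoly_eval_le) auto
        moreover have "\<epsilon> ^ j \<le> \<epsilon> ^ n\<^sub>0" using j \<epsilon> by (intro power_decreasing) auto
        ultimately show "\<bar>\<epsilon> ^ j * mvpoly_eval (S j) y\<bar> \<le> \<epsilon> ^ n\<^sub>0 * (N * (1 + norm y) ^ s)"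
          unfolding abs_mult using \<epsilon> by (intro mult_mono) auto
      qed
      also have "\<dots> = real (card {n\<^sub>0..n}) * (\<epsilon> ^ n\<^sub>0 * (N * (1 + norm y) ^ s))" by simp
      also have "\<dots> \<le> real (n + 1) * (\<epsilon> ^ n\<^sub>0 * (N * (1 + norm y) ^ s))"
        using N \<epsilon> by (intro mult_right_mono) auto
      finally show "\<bar>h y\<bar> \<le> K * \<epsilon> ^ n\<^sub>0 * (1 + norm y) ^ s" by (simp add: K_def mult_ac)
    qed
    have "perturbed_density \<epsilon> n\<^sub>0 n S = (\<lambda>y. gauss_density y * (1 + h y))"
      by (simp add: perturbed_density_def h_def fun_eq_iff)
    note tv' = tv[unfolded this]
    have "0 \<le> \<epsilon> ^ n\<^sub>0" using \<epsilon> by simp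
    from W[THEN spec, THEN spec, THEN spec, THEN spec, THEN mp, THEN mp, THEN mp, THEN mp, THEN mp, THEN mp, THEN mp,
        OF h this hK \<mu> \<delta> tv']
    have "wasserstein p \<mu> gauss_measure \<le>
        ennreal (C * (\<epsilon> ^ n\<^sub>0 + \<delta> powr (1 / p) + ((\<epsilon> ^ n\<^sub>0) ^ (n + 1)) powr (1 / p)))" .
    also have "\<dots> \<le> ennreal (C * (\<epsilon> ^ n\<^sub>0 + \<delta> powr (1 / p) + \<epsilon> powr (real (n + 1) / p)))"
    proof (intro ennreal_leI mult_left_mono add_left_mono)
      \<comment> \<open>\<open>1 <= n\<^sub>0\<close> and \<open>\<epsilon> < 1\<close> give
        \<open>\<epsilon> ^ n\<^sub>0 <= \<epsilon>\<close>, so the clipping error lies within the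
        third term of the claim.\<close>
      have "(\<epsilon> ^ n\<^sub>0) ^ (n + 1) \<le> \<epsilon> ^ (n + 1)"
        using \<epsilon> n0 by (intro power_mono power_le_one) (auto simp: power_le_one intro: order_trans[OF power_decreasing[of 1]])
      then have "((\<epsilon> ^ n\<^sub>0) ^ (n + 1)) powr (1 / p) \<le> (\<epsilon> ^ (n + 1)) powr (1 / p)"
        using \<epsilon> assms(1) by (intro powr_mono2) auto
      also have "\<dots> = \<epsilon> powr (real (n + 1) / p)"
        using \<epsilon> by (subst powr_realpow[symmetric]) (auto simp: powr_powr)
      finally show "((\<epsilon> ^ n\<^sub>0) ^ (n + 1)) powr (1 / p) \<le> \<epsilon> powr (real (n + 1) / p)" .
    qed (use C in simp)
    finally show "wasserstein p \<mu> gauss_measure \<le>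
      ennreal (C * (\<epsilon> ^ n\<^sub>0 + \<delta> powr (1 / p) + \<epsilon> powr (real (n + 1) / p)))" .
  qed
qed

end
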